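(* Let $P$ be a finite poset and $k[P]$ the incidence algebra of $P$ over a field $k$. Then the following conditions are equivalent. (a) The interval resolution global dimension of $k[P]$ is zero (equivalently, all $k[P]$-modules are interval-decomposable). (b) Each connected component of the Hasse diagram of $P$ is either $A_n(a)$ for some $n$ and some orientation $a$, or the Hasse diagram of $C_{m,\ell}$ for some positive integers $m,\ell$. In particular, these conditions do not depend on the characteristic of the base field $k$.
   Context: For a finite poset $P$, the Hasse diagram of $P$ is the quiver with vertex set $P$ and an arrow $x\to y$ if and only if $x<y$ and there is no $z\in P$ with $x<z<y$. The incidence algebra $k[P]$ is the quotient of the path algebra over $k$ of the Hasse diagram by the two-sided ideal generated by all commutativity relations (differences of parallel paths). All modules are finitely generated right modules; $k[P]$-modules are identified with functors from $P$ (viewed as a category with a unique morphism $a\to b$ iff $a\le b$) to finite dimensional $k$-vector spaces. $A_n(a)$ is the quiver $1\leftrightarrow 2\leftrightarrow\cdots\leftrightarrow n$, where each $\leftrightarrow$ is either $\rightarrow$ or $\leftarrow$ as assigned by the orientation $a$. For positive integers $m,\ell$, $C_{m,\ell}$ is the poset with elements $\hat 0,\hat 1,1,\dots,m,1',\dots,\ell'$ whose Hasse diagram consists of the two directed paths $\hat 0\to 1\to 2\to\cdots\to m\to\hat 1$ and $\hat 0\to 1'\to 2'\to\cdots\to \ell'\to\hat 1$ (so $\hat0$ is the global minimum and $\hat 1$ the global maximum). A full subposet is a subset with the induced order. An interval of $P$ is a (nonempty) full subposet $I$ which is connected as a poset and convex in $P$ (if $x,y\in I$, $z\in P$ and $x<z<y$,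 then $z\in I$). For an interval $I$, the module $k_I$ has $(k_I)_a=k$ if $a\in I$ and $0$ otherwise, and $k_I(a\le b)=1_k$ if $a,b\in I$ and $0$ otherwise. Interval modules are the modules isomorphic to some $k_I$; a module is interval-decomposable if it is isomorphic to a finite direct sum of interval modules. An interval cover of $M$ is a morphism $f\colon X\to M$ with $X$ interval-decomposable such that $\mathrm{Hom}(Y,f)$ is surjective for every interval-decomposable $Y$, and such that every $g\colon X\to X$ with $fg=f$ is an isomorphism. Every $k[P]$-module has an interval cover, unique up to isomorphism, and it is surjective. Let $\Omega(M)$ be the kernel of the interval cover of $M$, $\Omega^0(M)=M$ and $\Omega^i(M)=\Omega(\Omega^{i-1}(M))$. The interval resolution dimension of $M$ is $m$ if $m\ge 0$ is the smallest integer with $\Omega^{m+1}(M)=0$, and $\infty$ if there is no such $m$. The interval resolution global dimension of $k[P]$ is the supremum of the interval resolution dimensions of all $k[P]$-modules. *)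

theory Defs
  imports "HOL-Library.Function_Algebras" "HOL-Library.Extended_Nat" "HOL-Library.Nat_Bijection"
begin

section \<open>Vector spaces\<close>

text \<open>
  Every finite dimensional \<open>k\<close>-vector space is isomorphic to a subspace of the space of all
  sequences \<open>nat \<Rightarrow> 'k\<close>.  Modules are therefore modelled with values in the
  finite dimensional subspaces of this one ambient space; this contains every module up to
  isomorphism, and makes it possible to quantify over all modules.
\<close>

definition vscale :: "'k::field \<Rightarrow> (nat \<Rightarrow> 'k) \<Rightarrow> nat \<Rightarrow> 'k" where
  "vscale c v = (\<lambda>i. c * v i)"

global_interpretation vec: vector_space "vscale :: 'k::field \<Rightarrow> (nat \<Rightarrow> 'k) \<Rightarrow> nat \<Rightarrow> 'k"
  by unfold_locales (auto simp: vscale_def fun_eq_iff algebra_simps)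

definition fin_dim_space :: "(nat \<Rightarrow> 'k::field) set \<Rightarrow> bool" where
  "fin_dim_space V \<longleftrightarrow> (\<exists>B. finite B \<and> vec.span B = V)"

definition linear_on ::
  "(nat \<Rightarrow> 'k::field) set \<Rightarrow> (nat \<Rightarrow> 'k) set \<Rightarrow> ((nat \<Rightarrow> 'k) \<Rightarrow> nat \<Rightarrow> 'k) \<Rightarrow> bool" where
  "linear_on V W f \<longleftrightarrow> f ` V \<subseteq> W
     \<and> (\<forall>u\<in>V. \<forall>v\<in>V. f (u + v) = f u + f v)
     \<and> (\<forall>c. \<forall>v\<in>V. f (vscale c v) = vscale c (f v))"

section \<open>Modules over the incidence algebra\<close>

text \<open>
  A finite poset is a finite subset \<open>P\<close> of a type of class \<open>order\<close>, with the induced order.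
  A module over its incidence algebra is a functor from \<open>P\<close> to finite dimensional vector
  spaces: \<open>vspace M a\<close> is its value at \<open>a\<close>, and \<open>vmap M a b\<close> its value at \<open>a \<le> b\<close>.
  The values of \<open>vspace\<close> outside \<open>P\<close>, and of \<open>vmap M a b\<close> outside \<open>vspace M a\<close>, are junk;
  all notions below ignore them.
\<close>

record ('a, 'k) rep =
  vspace :: "'a \<Rightarrow> (nat \<Rightarrow> 'k) set"
  vmap :: "'a \<Rightarrow> 'a \<Rightarrow> (nat \<Rightarrow> 'k) \<Rightarrow> nat \<Rightarrow> 'k"

definition is_rep :: "'a::order set \<Rightarrow> ('a, 'k::field) rep \<Rightarrow> bool" where
  "is_rep P M \<longleftrightarrow>
     (\<forall>a\<in>P. fin_dim_space (vspace M a))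
   \<and> (\<forall>a\<in>P. \<forall>b\<in>P. a \<le> b \<longrightarrow> linear_on (vspace M a) (vspace M b) (vmap M a b))
   \<and> (\<forall>a\<in>P. \<forall>v\<in>vspace M a. vmap M a a v = v)
   \<and> (\<forall>a\<in>P. \<forall>b\<in>P. \<forall>c\<in>P. a \<le> b \<longrightarrow> b \<le> c \<longrightarrow>
        (\<forall>v\<in>vspace M a. vmap M b c (vmap M a b v) = vmap M a c v))"

definition is_zero_rep :: "'a::order set \<Rightarrow> ('a, 'k::field) rep \<Rightarrow> bool" where
  "is_zero_rep P M \<longleftrightarrow> (\<forall>a\<in>P. vspace M a = {0})"

type_synonym ('a, 'k) rep_map = "'a \<Rightarrow> (nat \<Rightarrow> 'k) \<Rightarrow> nat \<Rightarrow> 'k"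

definition is_hom ::
  "'a::order set \<Rightarrow> ('a, 'k::field) rep \<Rightarrow> ('a, 'k) rep \<Rightarrow> ('a, 'k) rep_map \<Rightarrow> bool" where
  "is_hom P M N f \<longleftrightarrow>
     (\<forall>a\<in>P. linear_on (vspace M a) (vspace N a) (f a))
   \<and> (\<forall>a\<in>P. \<forall>b\<in>P. a \<le> b \<longrightarrow>
        (\<forall>v\<in>vspace M a. f b (vmap M a b v) = vmap N a b (f a v)))"

definition hom_eq ::
  "'a::order set \<Rightarrow> ('a, 'k::field) rep \<Rightarrow> ('a, 'k) rep_map \<Rightarrow> ('a, 'k) rep_map \<Rightarrow> bool" where
  "hom_eq P M f g \<longleftrightarrow> (\<forall>a\<in>P. \<forall>v\<in>vspace M a. f a v = g a v)"

definition hom_comp :: "('a, 'k) rep_map \<Rightarrow> ('a, 'k) rep_map \<Rightarrow> ('a, 'k) rep_map" where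
  "hom_comp g f = (\<lambda>a. g a \<circ> f a)"

definition hom_id :: "('a, 'k) rep_map" where
  "hom_id = (\<lambda>a v. v)"

definition is_iso ::
  "'a::order set \<Rightarrow> ('a, 'k::field) rep \<Rightarrow> ('a, 'k) rep \<Rightarrow> ('a, 'k) rep_map \<Rightarrow> bool" where
  "is_iso P M N f \<longleftrightarrow> is_hom P M N f \<and>
     (\<exists>g. is_hom P N M g \<and> hom_eq P M (hom_comp g f) hom_id \<and> hom_eq P N (hom_comp f g) hom_id)"

definition isomorphic :: "'a::order set \<Rightarrow> ('a, 'k::field) rep \<Rightarrow> ('a, 'k) rep \<Rightarrow> bool" where
  "isomorphic P M N \<longleftrightarrow> (\<exists>f. is_iso P M N f)"

definition kernel_rep :: "('a, 'k::field) rep \<Rightarrow> ('a, 'k) rep_map \<Rightarrow> ('a, 'k) rep" where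
  "kernel_rep X f = \<lparr>vspace = (\<lambda>a. {v \<in> vspace X a. f a v = 0}), vmap = vmap X\<rparr>"

text \<open>
  The pairing \<open>prod_encode\<close> splits a sequence into countably many sequences; the
  \<open>i\<close>-th of these carries the \<open>i\<close>-th summand of a direct sum.
\<close>

definition vblock :: "nat \<Rightarrow> (nat \<Rightarrow> 'k) \<Rightarrow> nat \<Rightarrow> 'k" where
  "vblock i v = (\<lambda>j. v (prod_encode (i, j)))"

definition direct_sum :: "('a, 'k::field) rep list \<Rightarrow> ('a, 'k) rep" where
  "direct_sum Ms =
     \<lparr>vspace = (\<lambda>a. {v. \<forall>i. vblock i v \<in> (if i < length Ms then vspace (Ms ! i) a else {0})}),
      vmap = (\<lambda>a b v n. case prod_decode n of (i, j) \<Rightarrow>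
        if i < length Ms then vmap (Ms ! i) a b (vblock i v) j else 0)\<rparr>"

section \<open>Intervals and interval modules\<close>

definition connected_poset :: "'a::order set \<Rightarrow> bool" where
  "connected_poset I \<longleftrightarrow>
     (\<forall>x\<in>I. \<forall>y\<in>I. (x, y) \<in> {(u, v). u \<in> I \<and> v \<in> I \<and> (u \<le> v \<or> v \<le> u)}\<^sup>*)"

definition is_interval :: "'a::order set \<Rightarrow> 'a set \<Rightarrow> bool" where
  "is_interval P I \<longleftrightarrow> I \<subseteq> P \<and> I \<noteq> {} \<and> connected_poset I
     \<and> (\<forall>x\<in>I. \<forall>y\<in>I. \<forall>z\<in>P. x < z \<and> z < y \<longrightarrow> z \<in> I)"

text \<open>The field as a one-dimensional space: the sequences concentrated in position \<open>0\<close>.\<close>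

definition base_line :: "(nat \<Rightarrow> 'k::field) set" where
  "base_line = {v. \<forall>i>0. v i = 0}"

definition interval_module :: "'a::order set \<Rightarrow> ('a, 'k::field) rep" where
  "interval_module I =
     \<lparr>vspace = (\<lambda>a. if a \<in> I then base_line else {0}),
      vmap = (\<lambda>a b v. if a \<in> I \<and> b \<in> I then v else 0)\<rparr>"

definition interval_decomposable :: "'a::order set \<Rightarrow> ('a, 'k::field) rep \<Rightarrow> bool" where
  "interval_decomposable P M \<longleftrightarrow>
     (\<exists>Is. (\<forall>I\<in>set Is. is_interval P I) \<and> isomorphic P M (direct_sum (map interval_module Is)))"

section \<open>Interval resolutions\<close>

definition is_interval_cover ::
  "'a::order set \<Rightarrow> ('a, 'k::field) rep \<Rightarrow> ('a, 'k) rep \<Rightarrow> ('a, 'k) rep_map \<Rightarrow> bool" where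
  "is_interval_cover P M X f \<longleftrightarrow>
     is_rep P X \<and> interval_decomposable P X \<and> is_hom P X M f
   \<and> (\<forall>Y h. is_rep P Y \<and> interval_decomposable P Y \<and> is_hom P Y M h \<longrightarrow>
        (\<exists>g. is_hom P Y X g \<and> hom_eq P Y (hom_comp f g) h))
   \<and> (\<forall>g. is_hom P X X g \<and> hom_eq P X (hom_comp f g) f \<longrightarrow> is_iso P X X g)"

text \<open>Interval covers exist and are unique up to isomorphism, so any choice of one will do.\<close>

definition Omega :: "'a::order set \<Rightarrow> ('a, 'k::field) rep \<Rightarrow> ('a, 'k) rep" where
  "Omega P M = (case (SOME (X, f). is_interval_cover P M X f) of (X, f) \<Rightarrow> kernel_rep X f)"

text \<open>In \<open>enat\<close> the infimum of the empty set is \<open>\<infinity>\<close>.\<close>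

definition interval_resdim :: "'a::order set \<Rightarrow> ('a, 'k::field) rep \<Rightarrow> enat" where
  "interval_resdim P M = Inf {enat m | m. is_zero_rep P ((Omega P ^^ (m + 1)) M)}"

definition interval_resgldim :: "'k::field itself \<Rightarrow> 'a::order set \<Rightarrow> enat" where
  "interval_resgldim _ P = (SUP M\<in>{M :: ('a, 'k) rep. is_rep P M}. interval_resdim P M)"

section \<open>Hasse diagrams\<close>

text \<open>
  All quivers involved have at most one arrow from one vertex to another, so a quiver
  is given by its vertex set together with a relation.
\<close>

type_synonym 'v quiver = "'v set \<times> ('v \<times> 'v) set"

definition quiver_iso :: "'v quiver \<Rightarrow> 'w quiver \<Rightarrow> bool" where
  "quiver_iso Q R \<longleftrightarrow> (\<exists>f. bij_betw f (fst Q) (fst R) \<and>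
     (\<forall>x\<in>fst Q. \<forall>y\<in>fst Q. (x, y) \<in> snd Q \<longleftrightarrow> (f x, f y) \<in> snd R))"

definition quiver_components :: "'v quiver \<Rightarrow> 'v quiver set" where
  "quiver_components Q =
     (\<lambda>C. (C, snd Q \<inter> C \<times> C)) ` (fst Q // ((snd Q \<union> (snd Q)\<inverse>)\<^sup>* \<inter> fst Q \<times> fst Q))"

definition hasse :: "'a::order set \<Rightarrow> 'a quiver" where
  "hasse P = (P, {(x, y). x \<in> P \<and> y \<in> P \<and> x < y \<and> \<not> (\<exists>z\<in>P. x < z \<and> z < y)})"

text \<open>The arrow between \<open>i\<close> and \<open>i + 1\<close> points upwards iff \<open>a i\<close>.\<close>

definition A_quiver :: "nat \<Rightarrow> (nat \<Rightarrow> bool) \<Rightarrow> nat quiver" where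
  "A_quiver n a = ({1..n},
     {(i, i + 1) | i. 1 \<le> i \<and> i < n \<and> a i} \<union> {(i + 1, i) | i. 1 \<le> i \<and> i < n \<and> \<not> a i})"

datatype c_elem = Hat0 | Hat1 | Unprimed nat | Primed nat

instantiation c_elem :: order
begin

fun less_eq_c_elem :: "c_elem \<Rightarrow> c_elem \<Rightarrow> bool" where
  "less_eq_c_elem Hat0 y = True"
| "less_eq_c_elem x Hat1 = True"
| "less_eq_c_elem (Unprimed i) (Unprimed j) = (i \<le> j)"
| "less_eq_c_elem (Primed i) (Primed j) = (i \<le> j)"
| "less_eq_c_elem x y = False"

definition less_c_elem :: "c_elem \<Rightarrow> c_elem \<Rightarrow> bool" where
  "less_c_elem x y \<longleftrightarrow> x \<le> y \<and> \<not> y \<le> x"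

instance
proof
  fix x y z :: c_elem
  show "x < y \<longleftrightarrow> x \<le> y \<and> \<not> y \<le> x" by (rule less_c_elem_def)
  show "x \<le> x" by (cases x) auto
  show "x \<le> y \<Longrightarrow> y \<le> z \<Longrightarrow> x \<le> z" by (cases x; cases y; cases z) auto
  show "x \<le> y \<Longrightarrow> y \<le> x \<Longrightarrow> x = y" by (cases x; cases y) auto
qed

end

definition C_poset :: "nat \<Rightarrow> nat \<Rightarrow> c_elem set" where
  "C_poset m l = {Hat0, Hat1} \<union> Unprimed ` {1..m} \<union> Primed ` {1..l}"

lemma hasse_C_poset:
  assumes "0 < m" and "0 < l"
  shows "snd (hasse (C_poset m l)) =
     {(Hat0, Unprimed 1), (Unprimed m, Hat1), (Hat0, Primed 1), (Primed l, Hat1)}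
   \<union> {(Unprimed i, Unprimed (i + 1)) | i. 1 \<le> i \<and> i < m}
   \<union> {(Primed i, Primed (i + 1)) | i. 1 \<le> i \<and> i < l}"
  (is "?L = ?R")
proof (intro set_eqI iffI)
  fix e assume "e \<in> ?L"
  then obtain x y where e: "e = (x, y)" and x: "x \<in> C_poset m l" and y: "y \<in> C_poset m l"
    and lt: "x \<le> y" "x \<noteq> y" and cov: "\<And>z. z \<in> C_poset m l \<Longrightarrow> x \<le> z \<Longrightarrow> z \<le> y \<Longrightarrow> z = x \<or> z = y"
    unfolding hasse_def by (auto simp: order.strict_iff_order)
  have U: "Unprimed i \<in> C_poset m l \<longleftrightarrow> 1 \<le> i \<and> i \<le> m"
    and V: "Primed i \<in> C_poset m l \<longleftrightarrow> 1 \<le> i \<and> i \<le> l" for i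
    by (auto simp: C_poset_def)
  show "e \<in> ?R"
  proof (cases x; cases y)
    assume "x = Hat0" "y = Hat1"
    then show ?thesis using cov[of "Unprimed 1"] assms U by auto
  next
    fix j assume "x = Hat0" "y = Unprimed j"
    then show ?thesis using cov[of "Unprimed 1"] y assms U by (auto simp: e)
  next
    fix j assume "x = Hat0" "y = Primed j"
    then show ?thesis using cov[of "Primed 1"] y assms V by (auto simp: e)
  next
    fix i assume "x = Unprimed i" "y = Hat1"
    then show ?thesis using cov[of "Unprimed m"] x assms U by (auto simp: e)
  next
    fix i assume "x = Primed i" "y = Hat1"
    then show ?thesis using cov[of "Primed l"] x assms V by (auto simp: e)
  next
    fix i j assume xy: "x = Unprimed i" "y = Unprimed j"
    then have "j = i + 1" using cov[of "Unprimed (i + 1)"] x y lt U by auto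
    then show ?thesis using xy x y U by (auto simp: e)
  next
    fix i j assume xy: "x = Primed i" "y = Primed j"
    then have "j = i + 1" using cov[of "Primed (i + 1)"] x y lt V by auto
    then show ?thesis using xy x y V by (auto simp: e)
  qed (use lt in auto)
next
  fix e assume e: "e \<in> ?R"
  obtain x y where xy: "e = (x, y)" by fastforce
  have mem: "x \<in> C_poset m l" "y \<in> C_poset m l" and lt: "x \<le> y" "x \<noteq> y"
    using e xy assms by (auto simp: C_poset_def)
  have "z = x \<or> z = y" if "z \<in> C_poset m l" "x \<le> z" "z \<le> y" for z
    using e xy that by (cases z) (auto simp: C_poset_def)
  then have "\<not> (\<exists>z\<in>C_poset m l. x < z \<and> z < y)"
    by (metis order.strict_iff_order)
  moreover have "x < y" using lt by (rule order.not_eq_order_implies_strict[rotated])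
  ultimately show "e \<in> ?L"
    using mem unfolding xy hasse_def by simp
qed

section \<open>The constructions stay within the class of modules\<close>

lemma fin_dim_space_subspace: "fin_dim_space V \<Longrightarrow> vec.subspace V"
  by (auto simp: fin_dim_space_def)

lemma fin_dim_base_line: "fin_dim_space (base_line :: (nat \<Rightarrow> 'k::field) set)"
proof -
  let ?e = "\<lambda>i::nat. if i = 0 then (1::'k) else 0"
  have "vec.span {?e} = base_line"
  proof
    show "vec.span {?e} \<subseteq> base_line"
      by (auto simp: vec.span_singleton base_line_def vscale_def)
    show "base_line \<subseteq> vec.span {?e}"
    proof
      fix v :: "nat \<Rightarrow> 'k" assume "v \<in> base_line"
      then have "v = vscale (v 0) ?e" by (auto simp: base_line_def vscale_def fun_eq_iff)
      then show "v \<in> vec.span {?e}" by (metis vec.span_base vec.span_scale singletonI)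
    qed
  qed
  then show ?thesis unfolding fin_dim_space_def by blast
qed

lemma fin_dim_zero: "fin_dim_space {0}"
  unfolding fin_dim_space_def by (rule exI[of _ "{}"]) simp

lemma is_rep_interval_module:
  assumes "is_interval P I"
  shows "is_rep P (interval_module I :: ('a::order, 'k::field) rep)"
proof -
  have conv: "b \<in> I" if "a \<in> I" "c \<in> I" "b \<in> P" "a \<le> b" "b \<le> c" for a b c
    using that assms unfolding is_interval_def by (metis order_le_less)
  have lin: "linear_on (vspace (interval_module I) a) (vspace (interval_module I) b)
      (vmap (interval_module I :: ('a, 'k) rep) a b)" for a b
    by (auto simp: interval_module_def linear_on_def base_line_def)
  have comp: "vmap (interval_module I) b c (vmap (interval_module I) a b v)
        = vmap (interval_module I :: ('a, 'k) rep) a c v"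
    if "b \<in> P" "a \<le> b" "b \<le> c" for a b c v
    using conv[of a c b] that by (auto simp: interval_module_def)
  have "fin_dim_space (vspace (interval_module I :: ('a, 'k) rep) a)" for a
    by (simp add: interval_module_def fin_dim_base_line fin_dim_zero)
  moreover have "vmap (interval_module I) a a v = v"
    if "v \<in> vspace (interval_module I :: ('a, 'k) rep) a" for a v
    using that by (auto simp: interval_module_def split: if_splits)
  ultimately show ?thesis
    unfolding is_rep_def using lin comp by blast
qed

lemma fin_dim_space_mono:
  assumes "fin_dim_space V" and "vec.subspace W" and "W \<subseteq> V"
  shows "fin_dim_space W"
proof -
  obtain A where A: "finite A" "vec.span A = V" using assms(1) by (auto simp: fin_dim_space_def)
  obtain B where B: "B \<subseteq> W" "vec.independent B" "W \<subseteq> vec.span B"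
    using vec.maximal_independent_subset by metis
  have "finite B" using vec.independent_span_bound[OF A(1) B(2)] A(2) B(1) assms(3) by auto
  moreover have "vec.span B = W" using B assms(2) by (meson subset_antisym vec.span_minimal)
  ultimately show ?thesis unfolding fin_dim_space_def by blast
qed

lemma linear_on_zero:
  assumes "linear_on V W f" and "fin_dim_space V"
  shows "f 0 = 0"
proof -
  have "0 \<in> V" using assms(2) fin_dim_space_subspace vec.subspace_0 by auto
  then have "f (vscale 0 0) = vscale 0 (f 0)" using assms(1) unfolding linear_on_def by metis
  then show ?thesis by simp
qed

lemma is_rep_kernel_rep:
  assumes "is_rep P X" and "is_rep P M" and "is_hom P X M f"
  shows "is_rep P (kernel_rep X f)"
proof -
  have f0: "f a 0 = 0" if "a \<in> P" for a
    using assms(1,3) that by (intro linear_on_zero) (auto simp: is_rep_def is_hom_def)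
  have m0: "vmap M a b 0 = 0" if "a \<in> P" "b \<in> P" "a \<le> b" for a b
    using assms(2) that by (intro linear_on_zero[of "vspace M a" "vspace M b"]) (simp_all add: is_rep_def)
  have fd: "fin_dim_space {v \<in> vspace X a. f a v = 0}" if "a \<in> P" for a
  proof (rule fin_dim_space_mono)
    show X: "fin_dim_space (vspace X a)" using assms(1) that by (simp add: is_rep_def)
    have "linear_on (vspace X a) (vspace M a) (f a)" using assms(3) that by (simp add: is_hom_def)
    then show "vec.subspace {v \<in> vspace X a. f a v = 0}"
      using fin_dim_space_subspace[OF X] f0[OF that]
      unfolding vec.subspace_def linear_on_def by auto
  qed auto
  have "f b (vmap X a b v) = 0"
    if "a \<in> P" "b \<in> P" "a \<le> b" "v \<in> vspace X a" "f a v = 0" for a b v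
    using assms(3) m0 that unfolding is_hom_def by metis
  then have lin: "linear_on (vspace (kernel_rep X f) a) (vspace (kernel_rep X f) b) (vmap X a b)"
    if "a \<in> P" "b \<in> P" "a \<le> b" for a b
    using assms(1) that unfolding is_rep_def linear_on_def kernel_rep_def image_subset_iff by simp
  have fin: "fin_dim_space (vspace (kernel_rep X f) a)" if "a \<in> P" for a
    using fd[OF that] by (simp add: kernel_rep_def)
  have map_eq: "vmap (kernel_rep X f) = vmap X"
    by (simp add: kernel_rep_def)
  have sub: "v \<in> vspace X a" if "v \<in> vspace (kernel_rep X f) a" for a v
    using that by (simp add: kernel_rep_def)
  have idt: "vmap X a a v = v" if "a \<in> P" "v \<in> vspace X a" for a v
    using assms(1) that by (simp add: is_rep_def)
  have comp: "vmap X b c (vmap X a b v) = vmap X a c v"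
    if "a \<in> P" "b \<in> P" "c \<in> P" "a \<le> b" "b \<le> c" "v \<in> vspace X a" for a b c v
    using assms(1) that unfolding is_rep_def by blast
  show ?thesis
    unfolding is_rep_def map_eq
    by (intro conjI ballI impI) (simp_all add: fin lin idt comp sub)
qed

lemma vblock_simps [simp]:
  "vblock i (u + v) = vblock i u + vblock i v"
  "vblock i (vscale c v) = vscale c (vblock i v)"
  "vblock i 0 = 0"
  by (auto simp: vblock_def vscale_def fun_eq_iff)

lemma vblock_eqI: "(\<And>i. vblock i u = vblock i v) \<Longrightarrow> u = v"
  by (metis (no_types, lifting) vblock_def ext prod_decode_inverse surj_pair)

lemma vblock_direct_sum_vmap:
  "vblock i (vmap (direct_sum Ms) a b v) =
     (if i < length Ms then vmap (Ms ! i) a b (vblock i v) else 0)"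
  by (auto simp: vblock_def direct_sum_def fun_eq_iff)

lemma in_direct_sum_iff:
  "v \<in> vspace (direct_sum Ms) a \<longleftrightarrow>
     (\<forall>i. vblock i v \<in> (if i < length Ms then vspace (Ms ! i) a else {0}))"
  by (simp add: direct_sum_def)

lemma fin_dim_direct_sum:
  fixes Ms :: "('a, 'k::field) rep list"
  assumes "\<And>i. i < length Ms \<Longrightarrow> fin_dim_space (vspace (Ms ! i) a)"
  shows "fin_dim_space (vspace (direct_sum Ms) a)"
proof -
  define emb :: "nat \<Rightarrow> (nat \<Rightarrow> 'k) \<Rightarrow> nat \<Rightarrow> 'k" where
    "emb i w = (\<lambda>n. case prod_decode n of (i', j) \<Rightarrow> if i' = i then w j else 0)" for i w
  have blk: "vblock i' (emb i w) = (if i' = i then w else 0)" for i i' w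
    by (auto simp: vblock_def emb_def fun_eq_iff)
  have "\<forall>i<length Ms. \<exists>B. finite B \<and> vec.span B = vspace (Ms ! i) a"
    using assms by (simp add: fin_dim_space_def)
  then obtain B where B: "\<And>i. i < length Ms \<Longrightarrow> finite (B i) \<and> vec.span (B i) = vspace (Ms ! i) a"
    by metis
  let ?E = "\<Union>i<length Ms. emb i ` B i"
  have sub0: "vec.subspace (vspace (Ms ! i) a)" if "i < length Ms" for i
    using fin_dim_space_subspace[OF assms[OF that]] .
  have sub: "vec.subspace (vspace (direct_sum Ms) a)"
  proof -
    have "vec.subspace (if i < length Ms then vspace (Ms ! i) a else {0})" for i
      using sub0 by simp
    moreover have "vspace (direct_sum Ms) a =
        {v. \<forall>i. vblock i v \<in> (if i < length Ms then vspace (Ms ! i) a else {0})}"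
      by (simp add: direct_sum_def)
    ultimately show ?thesis
      unfolding vec.subspace_def mem_Collect_eq Ball_def vblock_simps by simp
  qed
  have "finite ?E" using B by auto
  have emb_in: "emb i w \<in> vec.span ?E" if i: "i < length Ms" and w: "w \<in> vec.span (B i)" for i w
  proof -
    have "emb i 0 = 0" "emb i (x + y) = emb i x + emb i y" "emb i (vscale c x) = vscale c (emb i x)"
      for c x y by (auto simp: emb_def vscale_def fun_eq_iff split: prod.splits)
    then have "vec.subspace {w. emb i w \<in> vec.span ?E}"
      unfolding vec.subspace_def mem_Collect_eq Ball_def
      by (simp add: vec.span_zero vec.span_add vec.span_scale)
    moreover have "B i \<subseteq> {w. emb i w \<in> vec.span ?E}"
      using i by (auto intro: vec.span_base)
    ultimately show ?thesis using vec.span_minimal w by blast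
  qed
  have blksum: "vblock j (\<Sum>i<n. g i) = (\<Sum>i<n. vblock j (g i))" for j n and g :: "nat \<Rightarrow> nat \<Rightarrow> 'k"
    using sum_comp_morphism[of "vblock j" g "{..<n}"] by (simp add: comp_def)
  have "v \<in> vec.span ?E" if v: "v \<in> vspace (direct_sum Ms) a" for v
  proof -
    have "v = (\<Sum>i<length Ms. emb i (vblock i v))"
    proof (rule vblock_eqI)
      fix j
      show "vblock j v = vblock j (\<Sum>i<length Ms. emb i (vblock i v))"
        using v[unfolded in_direct_sum_iff, rule_format, of j]
        by (auto simp: blksum blk)
    qed
    also have "\<dots> \<in> vec.span ?E"
      using v B by (intro vec.span_sum emb_in) (auto simp: in_direct_sum_iff split: if_splits)
    finally show ?thesis .
  qed
  moreover have "?E \<subseteq> vspace (direct_sum Ms) a"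
  proof -
    have "w \<in> vspace (Ms ! i) a" if "i < length Ms" "w \<in> B i" for i w
      using B[OF that(1)] that(2) vec.span_base by metis
    then show ?thesis
      using sub0 by (auto simp: in_direct_sum_iff blk vec.subspace_0)
  qed
  then have "vec.span ?E \<subseteq> vspace (direct_sum Ms) a" using sub by (rule vec.span_minimal)
  ultimately have "vec.span ?E = vspace (direct_sum Ms) a" by blast
  with \<open>finite ?E\<close> show ?thesis unfolding fin_dim_space_def by blast
qed

lemma is_rep_direct_sum:
  fixes Ms :: "('a::order, 'k::field) rep list"
  assumes "\<forall>M\<in>set Ms. is_rep P M"
  shows "is_rep P (direct_sum Ms)"
proof -
  have r: "is_rep P (Ms ! i)" if "i < length Ms" for i using assms that by simp
  have blk: "vblock i v \<in> vspace (Ms ! i) a"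
    if "v \<in> vspace (direct_sum Ms) a" "i < length Ms" for v i a
    using that by (metis in_direct_sum_iff)
  have blk0: "vblock i v = 0" if "v \<in> vspace (direct_sum Ms) a" "\<not> i < length Ms" for v i a
    using that by (metis in_direct_sum_iff singletonD)
  have fin: "fin_dim_space (vspace (direct_sum Ms) a)" if "a \<in> P" for a
    using r that by (intro fin_dim_direct_sum) (simp add: is_rep_def)
  have lin: "linear_on (vspace (direct_sum Ms) a) (vspace (direct_sum Ms) b) (vmap (direct_sum Ms) a b)"
    if ab: "a \<in> P" "b \<in> P" "a \<le> b" for a b
  proof -
    have l: "linear_on (vspace (Ms ! i) a) (vspace (Ms ! i) b) (vmap (Ms ! i) a b)"
      if "i < length Ms" for i using r[OF that] ab by (simp add: is_rep_def)
    have l1: "vmap (Ms ! i) a b u \<in> vspace (Ms ! i) b"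
      if "i < length Ms" "u \<in> vspace (Ms ! i) a" for i u
      using l[OF that(1)] that(2) unfolding linear_on_def by blast
    have l2: "vmap (Ms ! i) a b (u + w) = vmap (Ms ! i) a b u + vmap (Ms ! i) a b w"
      if "i < length Ms" "u \<in> vspace (Ms ! i) a" "w \<in> vspace (Ms ! i) a" for i u w
      using l[OF that(1)] that(2,3) unfolding linear_on_def by blast
    have l3: "vmap (Ms ! i) a b (vscale c u) = vscale c (vmap (Ms ! i) a b u)"
      if "i < length Ms" "u \<in> vspace (Ms ! i) a" for i c u
      using l[OF that(1)] that(2) unfolding linear_on_def by blast
    show ?thesis
      unfolding linear_on_def
    proof (intro conjI ballI allI image_subsetI)
      fix v assume v: "v \<in> vspace (direct_sum Ms) a"
      then show "vmap (direct_sum Ms) a b v \<in> vspace (direct_sum Ms) b"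
        unfolding in_direct_sum_iff[of _ _ b] vblock_direct_sum_vmap
        by (simp add: l1 blk[OF v])
      show "vmap (direct_sum Ms) a b (vscale c v) = vscale c (vmap (direct_sum Ms) a b v)" for c
        by (rule vblock_eqI) (simp add: vblock_direct_sum_vmap l3 blk[OF v])
      fix u assume u: "u \<in> vspace (direct_sum Ms) a"
      show "vmap (direct_sum Ms) a b (v + u) = vmap (direct_sum Ms) a b v + vmap (direct_sum Ms) a b u"
        by (rule vblock_eqI) (simp add: vblock_direct_sum_vmap l2 blk[OF v] blk[OF u])
    qed
  qed
  have idt: "vmap (direct_sum Ms) a a v = v" if "a \<in> P" "v \<in> vspace (direct_sum Ms) a" for a v
  proof (rule vblock_eqI)
    fix i
    show "vblock i (vmap (direct_sum Ms) a a v) = vblock i v"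
      using r[of i] blk[OF that(2), of i] blk0[OF that(2), of i] that(1)
      by (simp add: vblock_direct_sum_vmap is_rep_def)
  qed
  have comp: "vmap (direct_sum Ms) b c (vmap (direct_sum Ms) a b v) = vmap (direct_sum Ms) a c v"
    if "a \<in> P" "b \<in> P" "c \<in> P" "a \<le> b" "b \<le> c" "v \<in> vspace (direct_sum Ms) a" for a b c v
  proof (rule vblock_eqI)
    fix i
    have "vmap (Ms ! i) b c (vmap (Ms ! i) a b (vblock i v)) = vmap (Ms ! i) a c (vblock i v)"
      if "i < length Ms"
      using r[OF that] blk[OF \<open>v \<in> vspace (direct_sum Ms) a\<close> that]
        \<open>a \<in> P\<close> \<open>b \<in> P\<close> \<open>c \<in> P\<close> \<open>a \<le> b\<close> \<open>b \<le> c\<close>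
      unfolding is_rep_def by blast
    then show "vblock i (vmap (direct_sum Ms) b c (vmap (direct_sum Ms) a b v))
        = vblock i (vmap (direct_sum Ms) a c v)"
      by (simp add: vblock_direct_sum_vmap)
  qed
  show ?thesis
    unfolding is_rep_def using fin lin idt comp by blast
qed

end

theory Submission
  imports Defs
begin

text \<open>
  A module is a sum of interval modules as soon as every nonzero module has an interval summand.  On a
  zigzag \<open>P\<close> with an end \<open>y\<close>, the intervals containing \<open>y\<close> are totally preordered by the existence
  of a morphism that does not vanish at \<open>y\<close>.  If a leaf \<open>x\<close> is attached at \<open>y\<close>, a module on the larger
  poset has an interval summand: either the map between \<open>x\<close> and \<open>y\<close> is bijective and a summand on \<open>P\<close>
  extends, or its kernel or cokernel yields a summand, by Gaussian elimination along the preorder.  The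
  posets \<open>C\<^sub>m\<^sub>,\<^sub>l\<close> reduce to zigzags by removing the top or the bottom.

  Conversely, a vertex of the Hasse diagram with three neighbours supports a module of type \<open>D\<^sub>4\<close>, and a
  cycle with at least two sources supports a two-dimensional local system with nontrivial monodromy.  A
  connected graph without vertices of degree three is a path or a cycle, and a cycle with only one
  source is the Hasse diagram of some \<open>C\<^sub>m\<^sub>,\<^sub>l\<close>.

  Interval covers exist and are surjective, so \<open>\<Omega>(M) = 0\<close> if and only if \<open>M\<close> is interval-decomposable.
\<close>

section \<open>Linear maps and functionals\<close>

text \<open>Gaussian elimination needs totality at \<open>y\<close>: a kernel vector of a new map at
  \<open>y\<close> combines many generators, and only if one of the intervals involved maps to all
  the others can it be made the generator of a single summand. At an inner point this fails: in 1 ->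
  2 <- 3 the intervals {1,2} and {2,3} have no morphism in either direction that is nonzero at 2.
  Hence vertices are attached only at a free end. The modules for the converse must exist over every
  field. Three lines in a plane do; scalar monodromy does not, since the field with two elements has
  no scalars besides 0 and 1, so a unipotent matrix is used. Splitting off a summand means giving a
  morphism from \<open>k_I\<close> and one back with composite 1. Both are stored as families
  indexed by the vertices, which makes extension by zero from a smaller poset a local check at the
  boundary. In the existence of covers, antisymmetry of \<open>hom_le\<close> stands in for the
  locality of endomorphism rings: a cycle of components that are all nonzero at one vertex joins
  only equal intervals, and endomorphisms of \<open>k_I\<close> are scalars.\<close>

definition lin_fun :: "(nat \<Rightarrow> 'k::field) set \<Rightarrow> ((nat \<Rightarrow> 'k) \<Rightarrow> 'k) \<Rightarrow> bool" where
  "lin_fun V \<phi> \<longleftrightarrow> (\<forall>u\<in>V. \<forall>v\<in>V. \<phi> (u + v) = \<phi> u + \<phi> v)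
     \<and> (\<forall>c. \<forall>v\<in>V. \<phi> (vscale c v) = c * \<phi> v)"

lemma sum_fun_apply: "(\<Sum>t\<in>T. f t) i = (\<Sum>t\<in>T. f t i)" for f :: "'i \<Rightarrow> nat \<Rightarrow> 'k::field"
  by (induction T rule: infinite_finite_induct) auto

lemma vscale_sum: "vscale c (\<Sum>t\<in>T. f t) = (\<Sum>t\<in>T. vscale c (f t))"
  by (rule vec.scale_sum_right)

lemma linear_onD:
  assumes "linear_on V W f"
  shows "v \<in> V \<Longrightarrow> f v \<in> W" "u \<in> V \<Longrightarrow> v \<in> V \<Longrightarrow> f (u + v) = f u + f v"
    "v \<in> V \<Longrightarrow> f (vscale c v) = vscale c (f v)"
  using assms unfolding linear_on_def by auto

lemma linear_on_0: "linear_on V W f \<Longrightarrow> vec.subspace V \<Longrightarrow> f 0 = 0"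
  using linear_onD(3)[of V W f 0 0] vec.subspace_0 by fastforce

lemma linear_on_sum:
  assumes "linear_on V W f" "vec.subspace V" "\<And>t. t \<in> T \<Longrightarrow> u t \<in> V"
  shows "f (\<Sum>t\<in>T. vscale (a t) (u t)) = (\<Sum>t\<in>T. vscale (a t) (f (u t)))"
  using assms(3)
proof (induction T rule: infinite_finite_induct)
  case (insert x F)
  have "(\<Sum>t\<in>F. vscale (a t) (u t)) \<in> V"
    using insert.prems by (intro vec.subspace_sum[OF assms(2)] vec.subspace_scale[OF assms(2)]) auto
  moreover have ux: "u x \<in> V" using insert.prems by simp
  moreover have "vscale (a x) (u x) \<in> V" using ux by (rule vec.subspace_scale[OF assms(2)])
  ultimately have "f (vscale (a x) (u x) + (\<Sum>t\<in>F. vscale (a t) (u t)))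
      = f (vscale (a x) (u x)) + f (\<Sum>t\<in>F. vscale (a t) (u t))"
    using linear_onD(2)[OF assms(1)] by blast
  then show ?case
    using linear_onD(3)[OF assms(1) ux] insert.IH insert.prems
    by (subst (1 2) sum.insert[OF insert(1,2)]) (simp only: insertI2)
qed (use linear_on_0[OF assms(1,2)] in auto)

lemma linear_on_diff:
  assumes "linear_on V W f" "vec.subspace V" "u \<in> V" "v \<in> V"
  shows "f (u - v) = f u - f v"
proof -
  have "f (u - v + v) = f (u - v) + f v"
    using linear_onD(2)[OF assms(1)] vec.subspace_diff[OF assms(2)] assms(3,4) by blast
  then show ?thesis by simp
qed

lemma lin_funD:
  assumes "lin_fun V f"
  shows "u \<in> V \<Longrightarrow> v \<in> V \<Longrightarrow> f (u + v) = f u + f v"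
    "v \<in> V \<Longrightarrow> f (vscale c v) = c * f v"
  using assms unfolding lin_fun_def by auto

lemma lin_fun_0: "lin_fun V f \<Longrightarrow> vec.subspace V \<Longrightarrow> f 0 = 0"
  using lin_funD(2)[of V f 0 0] vec.subspace_0 by fastforce

lemma lin_fun_sum:
  assumes "lin_fun V f" "vec.subspace V" "\<And>t. t \<in> T \<Longrightarrow> u t \<in> V"
  shows "f (\<Sum>t\<in>T. vscale (a t) (u t)) = (\<Sum>t\<in>T. a t * f (u t))"
  using assms(3)
proof (induction T rule: infinite_finite_induct)
  case (insert x F)
  have "(\<Sum>t\<in>F. vscale (a t) (u t)) \<in> V"
    using insert.prems by (intro vec.subspace_sum[OF assms(2)] vec.subspace_scale[OF assms(2)]) auto
  moreover have ux: "u x \<in> V" using insert.prems by simp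
  moreover have "vscale (a x) (u x) \<in> V" using ux by (rule vec.subspace_scale[OF assms(2)])
  ultimately have "f (vscale (a x) (u x) + (\<Sum>t\<in>F. vscale (a t) (u t)))
      = f (vscale (a x) (u x)) + f (\<Sum>t\<in>F. vscale (a t) (u t))"
    using lin_funD(1)[OF assms(1)] by blast
  then show ?case
    using lin_funD(2)[OF assms(1) ux] insert.IH insert.prems
    by (subst (1 2) sum.insert[OF insert(1,2)]) (simp only: insertI2)
qed (use lin_fun_0[OF assms(1,2)] in auto)

lemma lin_fun_diff:
  assumes "lin_fun V f" "vec.subspace V" "u \<in> V" "v \<in> V"
  shows "f (u - v) = f u - f v"
proof -
  have "f (u - v + v) = f (u - v) + f v"
    using lin_funD(1)[OF assms(1)] vec.subspace_diff[OF assms(2)] assms(3,4) by blast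
  then show ?thesis by simp
qed

lemma lin_fun_subset: "lin_fun V f \<Longrightarrow> U \<subseteq> V \<Longrightarrow> lin_fun U f"
  unfolding lin_fun_def by blast

text \<open>A basis of \<open>S\<close> stays independent after adding \<open>w\<close>, so the
  values 0 on it and 1 at \<open>w\<close> extend linearly to all sequences. This separates a vector
  from the image of a map, or from 0.\<close>

lemma exists_functional:
  assumes "vec.subspace S" "w \<notin> S"
  obtains \<phi> :: "(nat \<Rightarrow> 'k::field) \<Rightarrow> 'k" where "lin_fun UNIV \<phi>" "\<And>s. s \<in> S \<Longrightarrow> \<phi> s = 0" "\<phi> w = 1"
proof -
  interpret vp: vector_space_pair "vscale :: 'k \<Rightarrow> (nat \<Rightarrow> 'k) \<Rightarrow> nat \<Rightarrow> 'k" "(*) :: 'k \<Rightarrow> 'k \<Rightarrow> 'k"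
    by unfold_locales (auto simp: algebra_simps)
  obtain B where B: "B \<subseteq> S" "vec.independent B" "S \<subseteq> vec.span B"
    using vec.maximal_independent_subset by metis
  have sp: "vec.span B = S" using B assms(1) by (meson subset_antisym vec.span_minimal)
  have "vec.independent (insert w B)"
    using B sp assms(2) by (simp add: vec.independent_insert)
  then obtain g where g: "Vector_Spaces.linear vscale (*) g"
      "\<forall>x\<in>insert w B. g x = (if x = w then 1 else 0)"
    using vp.linear_independent_extend[of "insert w B" "\<lambda>x. if x = w then 1 else 0"] by blast
  have "g s = 0" if "s \<in> S" for s
    using vp.linear_eq_0_on_span[OF g(1), of B s] g(2) B(1) assms(2) that sp by (metis subsetD insertI2)
  moreover have "lin_fun UNIV g"
    using vp.linear_add[OF g(1)] vp.linear_scale[OF g(1)] unfolding lin_fun_def by blast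
  ultimately show thesis using that g(2) by simp
qed

section \<open>Morphisms from and to interval modules\<close>

lemma rep_subspace: "is_rep P M \<Longrightarrow> p \<in> P \<Longrightarrow> vec.subspace (vspace M p)"
  by (rule fin_dim_space_subspace) (simp add: is_rep_def)

lemma rep_linear: "is_rep P M \<Longrightarrow> p \<in> P \<Longrightarrow> q \<in> P \<Longrightarrow> p \<le> q \<Longrightarrow>
    linear_on (vspace M p) (vspace M q) (vmap M p q)"
  by (simp add: is_rep_def)

lemma rep_id: "is_rep P M \<Longrightarrow> p \<in> P \<Longrightarrow> v \<in> vspace M p \<Longrightarrow> vmap M p p v = v"
  by (simp add: is_rep_def)

lemma rep_comp: "is_rep P M \<Longrightarrow> p \<in> P \<Longrightarrow> q \<in> P \<Longrightarrow> r \<in> P \<Longrightarrow> p \<le> q \<Longrightarrow> q \<le> r \<Longrightarrow> v \<in> vspace M p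
    \<Longrightarrow> vmap M q r (vmap M p q v) = vmap M p r v"
  unfolding is_rep_def by blast

lemma rep_in: "is_rep P M \<Longrightarrow> p \<in> P \<Longrightarrow> q \<in> P \<Longrightarrow> p \<le> q \<Longrightarrow> v \<in> vspace M p \<Longrightarrow>
    vmap M p q v \<in> vspace M q"
  by (rule linear_onD(1)[OF rep_linear])

lemma rep_0: "is_rep P M \<Longrightarrow> p \<in> P \<Longrightarrow> q \<in> P \<Longrightarrow> p \<le> q \<Longrightarrow> vmap M p q 0 = 0"
  by (rule linear_on_0[OF rep_linear rep_subspace])

lemma rep_subset: "is_rep P M \<Longrightarrow> Q \<subseteq> P \<Longrightarrow> is_rep Q M"
  unfolding is_rep_def by (meson subsetD)

text \<open>A morphism \<open>k\<^sub>I \<rightarrow> M\<close> is given by the images \<open>v p\<close> of \<open>1\<close>, a morphism \<open>M \<rightarrow> k\<^sub>I\<close> by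
  functionals; both are normalised to be zero off \<open>I\<close>.\<close>

definition sect :: "'a::order set \<Rightarrow> ('a, 'k::field) rep \<Rightarrow> 'a set \<Rightarrow> ('a \<Rightarrow> nat \<Rightarrow> 'k) \<Rightarrow> bool" where
  "sect P M I v \<longleftrightarrow> (\<forall>p\<in>P. v p \<in> vspace M p) \<and> (\<forall>p. p \<notin> I \<longrightarrow> v p = 0)
     \<and> (\<forall>p\<in>I. \<forall>q\<in>P. p \<le> q \<longrightarrow> vmap M p q (v p) = v q)"

definition cosect :: "'a::order set \<Rightarrow> ('a, 'k::field) rep \<Rightarrow> 'a set \<Rightarrow> ('a \<Rightarrow> (nat \<Rightarrow> 'k) \<Rightarrow> 'k) \<Rightarrow> bool" where
  "cosect P M I \<phi> \<longleftrightarrow> (\<forall>p\<in>P. lin_fun (vspace M p) (\<phi> p)) \<and> (\<forall>p w. p \<notin> I \<longrightarrow> \<phi> p w = 0)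
     \<and> (\<forall>q\<in>I. \<forall>p\<in>P. p \<le> q \<longrightarrow> (\<forall>w\<in>vspace M p. \<phi> q (vmap M p q w) = \<phi> p w))"

lemma sectD:
  assumes "sect P M I v"
  shows "p \<in> P \<Longrightarrow> v p \<in> vspace M p" "p \<notin> I \<Longrightarrow> v p = 0"
    "p \<in> I \<Longrightarrow> q \<in> P \<Longrightarrow> p \<le> q \<Longrightarrow> vmap M p q (v p) = v q"
  using assms unfolding sect_def by auto

lemma cosectD:
  assumes "cosect P M I \<phi>"
  shows "p \<in> P \<Longrightarrow> lin_fun (vspace M p) (\<phi> p)" "p \<notin> I \<Longrightarrow> \<phi> p w = 0"
    "q \<in> I \<Longrightarrow> p \<in> P \<Longrightarrow> p \<le> q \<Longrightarrow> w \<in> vspace M p \<Longrightarrow> \<phi> q (vmap M p q w) = \<phi> p w"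
  using assms unfolding cosect_def by auto

text \<open>A basis and its dual basis, both compatible with the maps of \<open>M\<close>.
  Biorthogonality is asked only on \<open>I t\<close>, because \<open>v t\<close> is 0 elsewhere;
  the last clause says that the summands exhaust \<open>M\<close>. Numbering by \<open>t < n\<close>
  lets a new summand be appended at \<open>n\<close>.\<close>

definition interval_decomp :: "'a::order set \<Rightarrow> ('a, 'k::field) rep \<Rightarrow> nat \<Rightarrow> (nat \<Rightarrow> 'a set) \<Rightarrow>
    (nat \<Rightarrow> 'a \<Rightarrow> nat \<Rightarrow> 'k) \<Rightarrow> (nat \<Rightarrow> 'a \<Rightarrow> (nat \<Rightarrow> 'k) \<Rightarrow> 'k) \<Rightarrow> bool" where
  "interval_decomp P M n I v \<phi> \<longleftrightarrow>
     (\<forall>t<n. is_interval P (I t) \<and> sect P M (I t) (v t) \<and> cosect P M (I t) (\<phi> t))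
   \<and> (\<forall>t<n. \<forall>s<n. \<forall>p\<in>I t. \<phi> s p (v t p) = (if s = t then 1 else 0))
   \<and> (\<forall>p\<in>P. \<forall>w\<in>vspace M p. (\<Sum>t<n. vscale (\<phi> t p w) (v t p)) = w)"

lemma interval_decompD:
  assumes "interval_decomp P M n I v \<phi>"
  shows "t < n \<Longrightarrow> is_interval P (I t)" "t < n \<Longrightarrow> sect P M (I t) (v t)"
    "t < n \<Longrightarrow> cosect P M (I t) (\<phi> t)"
    "t < n \<Longrightarrow> s < n \<Longrightarrow> p \<in> I t \<Longrightarrow> \<phi> s p (v t p) = (if s = t then 1 else 0)"
    "p \<in> P \<Longrightarrow> w \<in> vspace M p \<Longrightarrow> (\<Sum>t<n. vscale (\<phi> t p w) (v t p)) = w"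
  using assms unfolding interval_decomp_def by blast+

section \<open>Coordinates on sums of interval modules\<close>

abbreviation interval_sum :: "'a::order set list \<Rightarrow> ('a, 'k::field) rep" where
  "interval_sum Is \<equiv> direct_sum (map interval_module Is)"

text \<open>\<open>base_line\<close> is concentrated in position 0, so block \<open>t\<close> of a
  sum of interval modules has only the entry with code \<open>(t, 0)\<close>; \<open>icoord\<close>
  reads this entry.\<close>

definition icoord :: "nat \<Rightarrow> (nat \<Rightarrow> 'k::field) \<Rightarrow> 'k" where
  "icoord t w = w (prod_encode (t, 0))"

definition iunit :: "nat \<Rightarrow> nat \<Rightarrow> 'k::field" where
  "iunit t = (\<lambda>m. if m = prod_encode (t, 0) then 1 else 0)"

lemma icoord_simps [simp]:
  "icoord t (u + w) = icoord t u + icoord t w" "icoord t (vscale c w) = c * icoord t w"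
  "icoord t 0 = 0" "icoord t (u - w) = icoord t u - icoord t w"
  "icoord t (iunit s) = (if t = s then 1 else 0)"
  by (auto simp: icoord_def vscale_def iunit_def)

lemma icoord_sum [simp]: "icoord t (\<Sum>s\<in>S. f s) = (\<Sum>s\<in>S. icoord t (f s))"
  by (simp add: icoord_def sum_fun_apply)

lemma in_interval_sum:
  "w \<in> vspace (interval_sum Is) p \<longleftrightarrow>
     (\<forall>t j. w (prod_encode (t, j)) \<noteq> 0 \<longrightarrow> j = 0 \<and> t < length Is \<and> p \<in> Is ! t)"
  (is "?L = ?R")
proof -
  have "vblock t w \<in> (if t < length Is then vspace (map interval_module Is ! t) p else {0}) \<longleftrightarrow>
      (\<forall>j. w (prod_encode (t, j)) \<noteq> 0 \<longrightarrow> j = 0 \<and> t < length Is \<and> p \<in> Is ! t)" for t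
    by (auto simp: interval_module_def base_line_def vblock_def fun_eq_iff)
  then show ?thesis unfolding in_direct_sum_iff by simp
qed

lemma vmap_interval_sum:
  "vmap (interval_sum Is) p q w (prod_encode (t, j)) =
     (if t < length Is \<and> p \<in> Is ! t \<and> q \<in> Is ! t then w (prod_encode (t, j)) else 0)"
  by (auto simp: direct_sum_def interval_module_def vblock_def)

lemma interval_sum_eqI:
  assumes "u \<in> vspace (interval_sum Is) p" "w \<in> vspace (interval_sum Is) p"
    "\<And>t. t < length Is \<Longrightarrow> p \<in> Is ! t \<Longrightarrow> icoord t u = icoord t w"
  shows "u = w"
proof
  fix m obtain t j where m: "m = prod_encode (t, j)" by (metis prod_decode_inverse surj_pair)
  show "u m = w m"
    using assms unfolding in_interval_sum icoord_def m by (metis insertI1)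
qed

lemma icoord_zero: "w \<in> vspace (interval_sum Is) p \<Longrightarrow> \<not> (t < length Is \<and> p \<in> Is ! t) \<Longrightarrow> icoord t w = 0"
  unfolding in_interval_sum icoord_def by blast

lemma icoord_vmap: "icoord t (vmap (interval_sum Is) p q w) =
     (if t < length Is \<and> p \<in> Is ! t \<and> q \<in> Is ! t then icoord t w else 0)"
  unfolding icoord_def vmap_interval_sum ..

lemma iunit_in: "t < length Is \<Longrightarrow> p \<in> Is ! t \<Longrightarrow> iunit t \<in> vspace (interval_sum Is) p"
  by (auto simp: in_interval_sum iunit_def)

lemma is_rep_interval_sum: "\<forall>I\<in>set Is. is_interval P I \<Longrightarrow> is_rep P (interval_sum Is :: ('a::order, 'k::field) rep)"
  by (intro is_rep_direct_sum) (auto intro: is_rep_interval_module)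

lemma combination_in_interval_sum:
  assumes "\<And>t. t < length Is \<Longrightarrow> p \<notin> Is ! t \<Longrightarrow> c t = 0"
  shows "(\<Sum>t<length Is. vscale (c t) (iunit t)) \<in> vspace (interval_sum Is) p"
  unfolding in_interval_sum
proof (intro allI impI)
  fix t j assume "(\<Sum>t<length Is. vscale (c t) (iunit t)) (prod_encode (t, j)) \<noteq> 0"
  then obtain s where "s < length Is" "vscale (c s) (iunit s) (prod_encode (t, j)) \<noteq> 0"
    unfolding sum_fun_apply by (metis (mono_tags, lifting) lessThan_iff sum.neutral)
  then show "j = 0 \<and> t < length Is \<and> p \<in> Is ! t"
    using assms by (auto simp: vscale_def iunit_def split: if_splits)
qed

lemma icoord_combination:
  "icoord s (\<Sum>t<n. vscale (c t) (iunit t)) = (if s < n then c s else 0)"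
proof -
  have "icoord s (\<Sum>t<n. vscale (c t) (iunit t)) = (\<Sum>t<n. if s = t then c t else 0)"
    unfolding icoord_sum by (rule sum.cong) auto
  then show ?thesis by simp
qed

lemma interval_sum_expand:
  assumes "w \<in> vspace (interval_sum Is) p"
  shows "(\<Sum>t<length Is. vscale (icoord t w) (iunit t)) = w"
  by (rule interval_sum_eqI[OF combination_in_interval_sum assms]) (use icoord_zero[OF assms] in \<open>auto simp: icoord_combination simp del: icoord_sum\<close>)

text \<open>Additivity of Hom in the first argument. Leaving \<open>Is ! t\<close> is harmless
  because the section is 0 outside, and entering it is harmless because the coordinate was 0
  before.\<close>

lemma sections_hom:
  fixes M :: "('a::order, 'k::field) rep"
  assumes M: "is_rep P M" and s: "\<And>t. t < length Is \<Longrightarrow> sect P M (Is ! t) (v t)"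
  shows "is_hom P (interval_sum Is) M (\<lambda>p u. \<Sum>t<length Is. vscale (icoord t u) (v t p))"
  unfolding is_hom_def linear_on_def
proof (intro conjI ballI allI impI)
  fix p assume p: "p \<in> P"
  have vin: "v t p \<in> vspace M p" if "t < length Is" for t using sectD(1)[OF s[OF that] p] .
  show "(\<lambda>u. \<Sum>t<length Is. vscale (icoord t u) (v t p)) ` vspace (interval_sum Is) p \<subseteq> vspace M p"
    using vin by (auto intro!: vec.subspace_sum[OF rep_subspace[OF M p]] vec.subspace_scale[OF rep_subspace[OF M p]])
  fix u :: "nat \<Rightarrow> 'k"
  show "(\<Sum>t<length Is. vscale (icoord t (vscale c u)) (v t p)) = vscale c (\<Sum>t<length Is. vscale (icoord t u) (v t p))" for c
    unfolding vscale_sum by (intro sum.cong) auto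
  fix w :: "nat \<Rightarrow> 'k"
  show "(\<Sum>t<length Is. vscale (icoord t (u + w)) (v t p))
      = (\<Sum>t<length Is. vscale (icoord t u) (v t p)) + (\<Sum>t<length Is. vscale (icoord t w) (v t p))"
    unfolding sum.distrib[symmetric] by (intro sum.cong) (auto simp: vec.scale_left_distrib)
next
  fix p q w assume pq: "p \<in> P" "q \<in> P" "p \<le> q" and w: "w \<in> vspace (interval_sum Is :: ('a, 'k) rep) p"
  have "vmap M p q (\<Sum>t<length Is. vscale (icoord t w) (v t p)) = (\<Sum>t<length Is. vscale (icoord t w) (vmap M p q (v t p)))"
    using sectD(1)[OF s] pq
    by (intro linear_on_sum[OF rep_linear[OF M pq] rep_subspace[OF M pq(1)]]) auto
  also have "\<dots> = (\<Sum>t<length Is. vscale (icoord t (vmap (interval_sum Is) p q w)) (v t q))"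
  proof (rule sum.cong)
    fix t assume "t \<in> {..<length Is}"
    then have t: "t < length Is" by simp
    show "vscale (icoord t w) (vmap M p q (v t p)) = vscale (icoord t (vmap (interval_sum Is) p q w)) (v t q)"
      using icoord_zero[of w Is p t] w sectD(2,3)[OF s[OF t]] pq t
      by (cases "p \<in> Is ! t"; cases "q \<in> Is ! t") (auto simp: icoord_vmap)
  qed simp
  finally show "(\<Sum>t<length Is. vscale (icoord t (vmap (interval_sum Is) p q w)) (v t q))
      = vmap M p q (\<Sum>t<length Is. vscale (icoord t w) (v t p))" by simp
qed

text \<open>Dual to \<open>sections_hom\<close>: a morphism to a sum of interval modules is one
  cosection for each summand.\<close>

lemma cosections_hom:
  fixes M :: "('a::order, 'k::field) rep"
  assumes Is: "\<forall>I\<in>set Is. is_interval P I" and s: "\<And>t. t < length Is \<Longrightarrow> cosect P M (Is ! t) (\<phi> t)"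
  shows "is_hom P M (interval_sum Is) (\<lambda>p w. \<Sum>t<length Is. vscale (\<phi> t p w) (iunit t))"
proof -
  let ?f = "\<lambda>p w. \<Sum>t<length Is. vscale (\<phi> t p w) (iunit t)"
  have fin: "?f p w \<in> vspace (interval_sum Is) p" for p w
    using combination_in_interval_sum[of Is p "\<lambda>t. \<phi> t p w"] cosectD(2)[OF s] by simp
  show ?thesis
    unfolding is_hom_def linear_on_def
  proof (intro conjI ballI allI impI)
    fix p assume p: "p \<in> P"
    show "?f p ` vspace M p \<subseteq> vspace (interval_sum Is) p" using fin by blast
    fix u assume u: "u \<in> vspace M p"
    show "?f p (vscale c u) = vscale c (?f p u)" for c
      unfolding vscale_sum using lin_funD[OF cosectD(1)[OF s p]] u
      by (intro sum.cong) auto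
    fix w assume w: "w \<in> vspace M p"
    show "?f p (u + w) = ?f p u + ?f p w"
      unfolding sum.distrib[symmetric] using lin_funD[OF cosectD(1)[OF s p]] u w
      by (intro sum.cong) (auto simp: vec.scale_left_distrib)
  next
    fix p q w assume pq: "p \<in> P" "q \<in> P" "p \<le> q" and w: "w \<in> vspace M p"
    have r: "vmap (interval_sum Is) p q (?f p w) \<in> vspace (interval_sum Is) q"
      using rep_in[OF is_rep_interval_sum[OF Is] pq fin] .
    show "?f q (vmap M p q w) = vmap (interval_sum Is) p q (?f p w)"
    proof (rule interval_sum_eqI[OF fin r])
      fix t assume t: "t < length Is" "q \<in> Is ! t"
      have "\<phi> t q (vmap M p q w) = \<phi> t p w"
        using cosectD(3)[OF s[OF t(1)] t(2) pq(1,3) w] .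
      then show "icoord t (?f q (vmap M p q w)) = icoord t (vmap (interval_sum Is) p q (?f p w))"
        using t cosectD(2)[OF s[OF t(1)]] unfolding icoord_vmap icoord_combination by simp
    qed
  qed
qed

lemma isomorphicE:
  assumes "isomorphic P M N"
  obtains f g where "is_hom P M N f" "is_hom P N M g"
    "\<And>p w. p \<in> P \<Longrightarrow> w \<in> vspace M p \<Longrightarrow> g p (f p w) = w"
    "\<And>p w. p \<in> P \<Longrightarrow> w \<in> vspace N p \<Longrightarrow> f p (g p w) = w"
  using assms unfolding isomorphic_def is_iso_def hom_eq_def hom_comp_def hom_id_def
  by auto

lemma homD:
  assumes "is_hom P M N f"
  shows "p \<in> P \<Longrightarrow> linear_on (vspace M p) (vspace N p) (f p)"
    "p \<in> P \<Longrightarrow> q \<in> P \<Longrightarrow> p \<le> q \<Longrightarrow> w \<in> vspace M p \<Longrightarrow> f q (vmap M p q w) = vmap N p q (f p w)"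
    "p \<in> P \<Longrightarrow> w \<in> vspace M p \<Longrightarrow> f p w \<in> vspace N p"
  using assms linear_onD(1) unfolding is_hom_def by blast+

text \<open>An isomorphism \<open>f\<close> with inverse \<open>g\<close> turns unit vectors into
  sections and coordinates into cosections. Both are cut off outside the interval to meet the
  normalisation of \<open>sect\<close> and \<open>cosect\<close>.\<close>

lemma interval_decomposable_imp_decomp:
  fixes M :: "('a::order, 'k::field) rep"
  assumes M: "is_rep P M" and "interval_decomposable P M"
  shows "\<exists>n I v \<phi>. interval_decomp P M n I v \<phi>"
proof -
  obtain Is where Is: "\<forall>I\<in>set Is. is_interval P I" "isomorphic P M (interval_sum Is)"
    using assms(2) unfolding interval_decomposable_def by blast
  define N :: "('a, 'k) rep" where "N = interval_sum Is"
  define n where "n = length Is"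
  have N: "is_rep P N" unfolding N_def by (rule is_rep_interval_sum[OF Is(1)])
  obtain f g where f: "is_hom P M N f" and g: "is_hom P N M g"
    and gf: "\<And>p w. p \<in> P \<Longrightarrow> w \<in> vspace M p \<Longrightarrow> g p (f p w) = w"
    and fg: "\<And>p w. p \<in> P \<Longrightarrow> w \<in> vspace N p \<Longrightarrow> f p (g p w) = w"
    using isomorphicE[OF Is(2)] unfolding N_def by metis
  define v where "v t p = (if p \<in> Is ! t then g p (iunit t) else 0)" for t p
  define \<phi> where "\<phi> t p w = (if p \<in> Is ! t then icoord t (f p w) else 0)" for t p w
  have IP: "p \<in> P" if "t < n" "p \<in> Is ! t" for t p
    using Is(1) that unfolding n_def is_interval_def by (meson nth_mem subsetD)
  have un: "iunit t \<in> vspace N p" if "t < n" "p \<in> Is ! t" for t p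
    using that iunit_in unfolding n_def N_def by blast
  have 1: "sect P M (Is ! t) (v t)" if t: "t < n" for t
    unfolding sect_def
  proof (intro conjI ballI allI impI)
    fix p assume "p \<in> P" then show "v t p \<in> vspace M p"
      using homD(3)[OF g _ un[OF t]] vec.subspace_0[OF rep_subspace[OF M]] by (auto simp: v_def)
  next
    fix p q assume p: "p \<in> Is ! t" and q: "q \<in> P" "p \<le> q"
    have pP: "p \<in> P" using IP t p by blast
    have "vmap M p q (v t p) = g q (vmap N p q (iunit t))"
      using homD(2)[OF g pP q un[OF t p]] p by (simp add: v_def)
    also have "vmap N p q (iunit t) = (if q \<in> Is ! t then iunit t else 0)"
    proof -
      have "vmap N p q (iunit t) \<in> vspace N q" using rep_in[OF N pP q un[OF t p]] .
      moreover have "(if q \<in> Is ! t then iunit t else 0) \<in> vspace N q"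
        using un[OF t] vec.subspace_0[OF rep_subspace[OF N q(1)]] by auto
      ultimately show ?thesis
        unfolding N_def by (rule interval_sum_eqI) (use p in \<open>auto simp: icoord_vmap\<close>)
    qed
    also have "g q \<dots> = v t q"
      using linear_on_0[OF homD(1)[OF g q(1)] rep_subspace[OF N q(1)]] by (auto simp: v_def)
    finally show "vmap M p q (v t p) = v t q" .
  qed (simp add: v_def)
  have 2: "cosect P M (Is ! t) (\<phi> t)" if t: "t < n" for t
    unfolding cosect_def
  proof (intro conjI ballI allI impI)
    fix p assume "p \<in> P" then show "lin_fun (vspace M p) (\<phi> t p)"
      using linear_onD[OF homD(1)[OF f]] unfolding lin_fun_def \<phi>_def by auto
  next
    fix q p w assume q: "q \<in> Is ! t" and p: "p \<in> P" "p \<le> q" "w \<in> vspace M p"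
    have qP: "q \<in> P" using IP t q by blast
    have "icoord t (f p w) = 0" if "p \<notin> Is ! t"
      using icoord_zero[of "f p w" Is p t] homD(3)[OF f p(1,3)] that unfolding N_def by blast
    then show "\<phi> t q (vmap M p q w) = \<phi> t p w"
      using homD(2)[OF f p(1) qP p(2,3)] q t by (simp add: \<phi>_def N_def icoord_vmap n_def)
  qed (simp add: \<phi>_def)
  have 3: "\<phi> s p (v t p) = (if s = t then 1 else 0)" if "t < n" "s < n" "p \<in> Is ! t" for s t p
    using fg[OF IP[OF that(1,3)] un[OF that(1,3)]] that by (auto simp: \<phi>_def v_def)
  have 4: "(\<Sum>t<n. vscale (\<phi> t p w) (v t p)) = w" if p: "p \<in> P" and w: "w \<in> vspace M p" for p w
  proof -
    have fw: "f p w \<in> vspace N p" using homD(3)[OF f p w] .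
    let ?T = "{t\<in>{..<n}. p \<in> Is ! t}"
    have "(\<Sum>t<n. vscale (\<phi> t p w) (v t p)) = (\<Sum>t\<in>?T. vscale (\<phi> t p w) (v t p))"
      by (rule sum.mono_neutral_right) (auto simp: v_def)
    also have "\<dots> = (\<Sum>t\<in>?T. vscale (icoord t (f p w)) (g p (iunit t)))"
      by (rule sum.cong) (auto simp: \<phi>_def v_def)
    also have "\<dots> = g p (\<Sum>t\<in>?T. vscale (icoord t (f p w)) (iunit t))"
      by (rule linear_on_sum[symmetric, OF homD(1)[OF g p] rep_subspace[OF N p]]) (use un in auto)
    also have "(\<Sum>t\<in>?T. vscale (icoord t (f p w)) (iunit t)) = (\<Sum>t<n. vscale (icoord t (f p w)) (iunit t))"
      by (rule sum.mono_neutral_left) (use icoord_zero[of "f p w" Is p] fw in \<open>auto simp: N_def n_def\<close>)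
    also have "\<dots> = f p w" using interval_sum_expand[of "f p w" Is p] fw by (simp add: N_def n_def)
    finally show ?thesis using gf[OF p w] by simp
  qed
  have "interval_decomp P M n ((!) Is) v \<phi>"
    unfolding interval_decomp_def using 1 2 3 4 Is(1) by (auto simp: n_def)
  then show ?thesis by blast
qed

text \<open>The cosections assemble to a morphism into the sum, the sections to one out of it;
  biorthogonality and the resolution of the identity make them mutually inverse.\<close>

lemma decomp_imp_interval_decomposable:
  fixes M :: "('a::order, 'k::field) rep"
  assumes M: "is_rep P M" and D: "interval_decomp P M n I v \<phi>"
  shows "interval_decomposable P M"
proof -
  define Is where "Is = map I [0..<n]"
  define N :: "('a, 'k) rep" where "N = interval_sum Is"
  have len [simp]: "length Is = n" and nth [simp]: "t < n \<Longrightarrow> Is ! t = I t" for t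
    by (auto simp: Is_def)
  have Isint: "\<forall>J\<in>set Is. is_interval P J" using interval_decompD(1)[OF D] by (auto simp: Is_def)
  then have N: "is_rep P N" unfolding N_def by (rule is_rep_interval_sum)
  define f where "f p w = (\<Sum>t<n. vscale (\<phi> t p w) (iunit t))" for p w
  define g where "g p u = (\<Sum>t<n. vscale (icoord t u) (v t p))" for p u
  have fin: "f p w \<in> vspace N p" for p w
    unfolding f_def N_def using combination_in_interval_sum[of Is p "\<lambda>t. \<phi> t p w"]
      cosectD(2)[OF interval_decompD(3)[OF D]] by simp
  have cf: "icoord t (f p w) = \<phi> t p w" if "t < n" for t p w
    using that unfolding f_def icoord_combination by simp
  have f: "is_hom P M N f"
    using cosections_hom[OF Isint, of M \<phi>] interval_decompD(3)[OF D] unfolding N_def f_def[abs_def] by simp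
  have g: "is_hom P N M g"
    using sections_hom[OF M, of Is v] interval_decompD(2)[OF D] unfolding N_def g_def[abs_def] by simp
  have "g p (f p w) = w" if "p \<in> P" "w \<in> vspace M p" for p w
    using interval_decompD(5)[OF D that] unfolding g_def by (simp add: cf cong: sum.cong_simp)
  moreover have "f p (g p u) = u" if p: "p \<in> P" and u: "u \<in> vspace N p" for p u
  proof -
    have "icoord t (f p (g p u)) = icoord t u" if t: "t < n" "p \<in> I t" for t
    proof -
      have "icoord t (f p (g p u)) = \<phi> t p (g p u)" using cf t by blast
      also have "\<dots> = (\<Sum>s<n. icoord s u * \<phi> t p (v s p))"
        unfolding g_def using sectD(1)[OF interval_decompD(2)[OF D]] p
        by (intro lin_fun_sum[OF cosectD(1)[OF interval_decompD(3)[OF D t(1)] p] rep_subspace[OF M p]]) auto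
      also have "\<dots> = (\<Sum>s<n. if s = t then icoord s u else 0)"
      proof (rule sum.cong)
        fix s assume "s \<in> {..<n}"
        then show "icoord s u * \<phi> t p (v s p) = (if s = t then icoord s u else 0)"
          using interval_decompD(4)[OF D, of s t p] icoord_zero[of u Is p s] u t
          by (cases "p \<in> I s") (auto simp: N_def)
      qed simp
      finally show ?thesis using t by simp
    qed
    then show ?thesis
      using fin[of p "g p u"] u unfolding N_def by (intro interval_sum_eqI[of _ Is p]) auto
  qed
  ultimately have "isomorphic P M (interval_sum Is)"
    unfolding isomorphic_def is_iso_def hom_eq_def hom_comp_def hom_id_def using f g
    by (intro exI[of _ f] conjI exI[of _ g]) (auto simp: N_def)
  then show ?thesis unfolding interval_decomposable_def using Isint by blast
qed

section \<open>Splitting off one interval summand at a time\<close>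

definition decomposable_poset :: "'k::field itself \<Rightarrow> 'a::order set \<Rightarrow> bool" where
  "decomposable_poset _ P \<longleftrightarrow>
     (\<forall>M :: ('a, 'k) rep. is_rep P M \<longrightarrow> (\<exists>n I v \<phi>. interval_decomp P M n I v \<phi>))"

text \<open>The composite from \<open>k_I\<close> to \<open>M\<close> and back is the identity, so
  \<open>k_I\<close> is a direct summand. The complement is not mentioned, since it is recovered as
  the kernel of \<open>\<phi>\<close>.\<close>

definition interval_summand :: "'a::order set \<Rightarrow> ('a, 'k::field) rep \<Rightarrow> bool" where
  "interval_summand P M \<longleftrightarrow> (\<exists>I v \<phi>. is_interval P I \<and> sect P M I v \<and> cosect P M I \<phi> \<and> (\<forall>p\<in>I. \<phi> p (v p) = 1))"

lemma is_intervalD: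
  assumes "is_interval P I"
  shows "I \<subseteq> P" "I \<noteq> {}" "connected_poset I"
    "x \<in> I \<Longrightarrow> y \<in> I \<Longrightarrow> z \<in> P \<Longrightarrow> x \<le> z \<Longrightarrow> z \<le> y \<Longrightarrow> z \<in> I"
proof -
  have "z \<in> I" if "x \<in> I" "y \<in> I" "z \<in> P" "x \<le> z" "z \<le> y"
    using assms that unfolding is_interval_def order_le_less[of x] order_le_less[of z] by blast
  then show "x \<in> I \<Longrightarrow> y \<in> I \<Longrightarrow> z \<in> P \<Longrightarrow> x \<le> z \<Longrightarrow> z \<le> y \<Longrightarrow> z \<in> I" .
  show "I \<subseteq> P" "I \<noteq> {}" "connected_poset I"
    using assms unfolding is_interval_def by blast+
qed

lemma is_intervalI:
  assumes "I \<subseteq> P" "I \<noteq> {}" "connected_poset I"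
    "\<And>x y z. x \<in> I \<Longrightarrow> y \<in> I \<Longrightarrow> z \<in> P \<Longrightarrow> x < z \<Longrightarrow> z < y \<Longrightarrow> z \<in> I"
  shows "is_interval P I"
  using assms unfolding is_interval_def by blast

lemma connected_poset_induct:
  assumes "connected_poset I" "a \<in> I" "b \<in> I" "Q a"
    and step: "\<And>x y. x \<in> I \<Longrightarrow> y \<in> I \<Longrightarrow> x \<le> y \<or> y \<le> x \<Longrightarrow> Q x \<Longrightarrow> Q y"
  shows "Q b"
proof -
  have "(a, b) \<in> {(u, v). u \<in> I \<and> v \<in> I \<and> (u \<le> v \<or> v \<le> u)}\<^sup>*"
    using assms(1-3) unfolding connected_poset_def by blast
  then show ?thesis
    by (induction rule: rtrancl_induct) (use assms(4) step in auto)
qed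

lemma interval_decomp_single:
  assumes "is_rep P M" "interval_decomp P M n I v \<phi>" "t < n"
  shows "is_interval P (I t)" "sect P M (I t) (v t)" "cosect P M (I t) (\<phi> t)"
    "\<forall>p\<in>I t. \<phi> t p (v t p) = 1"
  using interval_decompD[OF assms(2)] assms(3) by simp_all

text \<open>The ambient sequence space is infinite dimensional, so finiteness of the bases has to
  come from a finite spanning set of \<open>V\<close>. The strict decrease drives the induction that
  splits off summands.\<close>

lemma fin_dim_space_dim_less:
  assumes V: "fin_dim_space V" and W: "vec.subspace W" "W \<subset> V"
  shows "vec.dim W < vec.dim (V :: (nat \<Rightarrow> 'k::field) set)"
proof -
  obtain A where A: "finite A" "vec.span A = V" using V by (auto simp: fin_dim_space_def)
  obtain B where B: "B \<subseteq> V" "vec.independent B" "V \<subseteq> vec.span B" "card B = vec.dim V"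
    using vec.basis_exists by metis
  obtain C where C: "C \<subseteq> W" "vec.independent C" "W \<subseteq> vec.span C" "card C = vec.dim W"
    using vec.basis_exists by metis
  have fB: "finite B" using vec.independent_span_bound[OF A(1) B(2)] A(2) B(1) by auto
  have fC: "finite C" using vec.independent_span_bound[OF A(1) C(2)] A(2) C(1) W(2) by auto
  obtain x where x: "x \<in> V" "x \<notin> W" using W(2) by blast
  have sp: "vec.span C = W" using C W(1) by (meson subset_antisym vec.span_minimal)
  have "vec.independent (insert x C)" using C sp x by (simp add: vec.independent_insert)
  moreover have "insert x C \<subseteq> vec.span B" using x C(1) W(2) B(3) by blast
  ultimately have "card (insert x C) \<le> card B" using vec.independent_span_bound[OF fB] by blast
  moreover have "x \<notin> C" using x C(1) by blast
  ultimately show ?thesis using fC B(4) C(4) by simp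
qed

lemma is_rep_subrep:
  assumes M: "is_rep P M"
    and sub: "\<And>p. p \<in> P \<Longrightarrow> vec.subspace (S p)" "\<And>p. p \<in> P \<Longrightarrow> S p \<subseteq> vspace M p"
    and closed: "\<And>p q w. p \<in> P \<Longrightarrow> q \<in> P \<Longrightarrow> p \<le> q \<Longrightarrow> w \<in> S p \<Longrightarrow> vmap M p q w \<in> S q"
  shows "is_rep P \<lparr>vspace = S, vmap = vmap M\<rparr>"
  unfolding is_rep_def rep.simps
proof (intro conjI ballI impI)
  fix p assume p: "p \<in> P"
  show "fin_dim_space (S p)"
    by (rule fin_dim_space_mono[OF _ sub(1)[OF p] sub(2)[OF p]]) (use M p in \<open>simp add: is_rep_def\<close>)
  show "vmap M p p w = w" if "w \<in> S p" for w
    using rep_id[OF M p] sub(2)[OF p] that by blast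
  fix q assume q: "q \<in> P" "p \<le> q"
  show "linear_on (S p) (S q) (vmap M p q)"
    unfolding linear_on_def
  proof (intro conjI ballI allI)
    show "vmap M p q ` S p \<subseteq> S q" using closed[OF p q] by blast
    show "vmap M p q (u + w) = vmap M p q u + vmap M p q w" if "u \<in> S p" "w \<in> S p" for u w
      by (rule linear_onD(2)[OF rep_linear[OF M p q]]) (use sub(2)[OF p] that in auto)
    show "vmap M p q (vscale c w) = vscale c (vmap M p q w)" if "w \<in> S p" for c w
      by (rule linear_onD(3)[OF rep_linear[OF M p q]]) (use sub(2)[OF p] that in auto)
  qed
  fix r w assume "r \<in> P" "q \<le> r" "w \<in> S p"
  then show "vmap M q r (vmap M p q w) = vmap M p r w"
    using rep_comp[OF M p q(1) _ q(2)] sub(2)[OF p] by blast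
qed

text \<open>Sending \<open>w\<close> to \<open>w - \<phi>(w) v\<close> is an idempotent endomorphism
  of \<open>M\<close> whose image is the kernel of \<open>\<phi>\<close>. Cosections of the kernel
  are pulled back along it; sections of the kernel are already sections of \<open>M\<close>.\<close>

lemma decomp_add_summand:
  fixes M :: "('a::order, 'k::field) rep"
  assumes M: "is_rep P M"
    and I: "is_interval P I" and v: "sect P M I v" and \<phi>: "cosect P M I \<phi>" and 1: "\<forall>p\<in>I. \<phi> p (v p) = 1"
    and D: "interval_decomp P \<lparr>vspace = (\<lambda>p. {w \<in> vspace M p. \<phi> p w = 0}), vmap = vmap M\<rparr> n J u \<psi>"
  shows "interval_decomp P M (Suc n) (J(n := I)) (u(n := v))
    ((\<lambda>t p w. \<psi> t p (w - vscale (\<phi> p w) (v p)))(n := \<phi>))"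
proof -
  define K where "K p = {w \<in> vspace M p. \<phi> p w = 0}" for p
  define N where "N = \<lparr>vspace = K, vmap = vmap M\<rparr>"
  have Ns [simp]: "vspace N = K" "vmap N = vmap M" by (simp_all add: N_def)
  have D: "interval_decomp P N n J u \<psi>" using D unfolding N_def K_def .
  note sub = rep_subspace[OF M]
  have vin: "v p \<in> vspace M p" if "p \<in> P" for p using sectD(1)[OF v that] .
  \<comment> \<open>Outside \<open>I\<close> both sides vanish, so the projection formula needs no
    case distinction on the vertex.\<close>
  have one: "\<phi> p w * \<phi> p (v p) = \<phi> p w" for p w
    using 1 cosectD(2)[OF \<phi>] by (cases "p \<in> I") auto
  have proj: "w - vscale (\<phi> p w) (v p) \<in> K p" if "p \<in> P" "w \<in> vspace M p" for p w
  proof -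
    have sv: "vscale (\<phi> p w) (v p) \<in> vspace M p" using vec.subspace_scale[OF sub[OF that(1)] vin[OF that(1)]] .
    have "\<phi> p (w - vscale (\<phi> p w) (v p)) = \<phi> p w - \<phi> p w * \<phi> p (v p)"
      using lin_fun_diff[OF cosectD(1)[OF \<phi> that(1)] sub[OF that(1)] that(2) sv]
        lin_funD(2)[OF cosectD(1)[OF \<phi> that(1)] vin[OF that(1)]] by simp
    then show ?thesis using one vec.subspace_diff[OF sub[OF that(1)] that(2) sv] by (simp add: K_def)
  qed
  define \<psi>' where "\<psi>' t p w = \<psi> t p (w - vscale (\<phi> p w) (v p))" for t p w
  have KM: "K p \<subseteq> vspace M p" for p by (auto simp: K_def)
  have su: "sect P M (J t) (u t)" if "t < n" for t
    using interval_decompD(2)[OF D that] KM unfolding sect_def by fastforce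
  have cu: "cosect P M (J t) (\<psi>' t)" if t: "t < n" for t
    unfolding cosect_def
  proof (intro conjI ballI allI impI)
    note c = interval_decompD(3)[OF D t]
    fix p assume p: "p \<in> P"
    note l = lin_funD[OF cosectD(1)[OF \<phi> p]] and l' = lin_funD[OF cosectD(1)[OF c p], unfolded Ns]
    show "lin_fun (vspace M p) (\<psi>' t p)"
      unfolding lin_fun_def
    proof (intro conjI ballI allI)
      fix x y assume x: "x \<in> vspace M p" and y: "y \<in> vspace M p"
      have "x + y - vscale (\<phi> p (x + y)) (v p) = (x - vscale (\<phi> p x) (v p)) + (y - vscale (\<phi> p y) (v p))"
        using l(1)[OF x y] by (simp add: vec.scale_left_distrib)
      then show "\<psi>' t p (x + y) = \<psi>' t p x + \<psi>' t p y"
        unfolding \<psi>'_def using l'(1)[OF proj[OF p x] proj[OF p y]] by (simp only:)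
    next
      fix c x assume x: "x \<in> vspace M p"
      have "vscale c x - vscale (\<phi> p (vscale c x)) (v p) = vscale c (x - vscale (\<phi> p x) (v p))"
        using l(2)[OF x] by (simp add: vec.scale_right_diff_distrib)
      then show "\<psi>' t p (vscale c x) = c * \<psi>' t p x"
        unfolding \<psi>'_def using l'(2)[OF proj[OF p x]] by (simp only:)
    qed
  next
    fix p w assume "p \<notin> J t"
    then show "\<psi>' t p w = 0" unfolding \<psi>'_def using cosectD(2)[OF interval_decompD(3)[OF D t]] by blast
  next
    fix q p w assume q: "q \<in> J t" and p: "p \<in> P" "p \<le> q" and w: "w \<in> vspace M p"
    have qP: "q \<in> P" using is_intervalD(1)[OF interval_decompD(1)[OF D t]] q by blast
    have eq: "vmap M p q (w - vscale (\<phi> p w) (v p)) = vmap M p q w - vscale (\<phi> p w) (vmap M p q (v p))"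
      using linear_on_diff[OF rep_linear[OF M p(1) qP p(2)] sub[OF p(1)] w vec.subspace_scale[OF sub[OF p(1)] vin[OF p(1)]]]
        linear_onD(3)[OF rep_linear[OF M p(1) qP p(2)] vin[OF p(1)]] by simp
    \<comment> \<open>Naturality of the projection: \<open>\<phi>\<close> followed by
      \<open>v\<close> is a composite of two morphisms, also where \<open>p\<close> or
      \<open>q\<close> leaves \<open>I\<close>.\<close>
    have "vscale (\<phi> p w) (vmap M p q (v p)) = vscale (\<phi> q (vmap M p q w)) (v q)"
    proof (cases "p \<in> I")
      case True
      then have "vmap M p q (v p) = v q" using sectD(3)[OF v] qP p(2) by blast
      moreover have "\<phi> q (vmap M p q w) = \<phi> p w" if "q \<in> I" using cosectD(3)[OF \<phi> that p w] .
      ultimately show ?thesis using sectD(2)[OF v] by (cases "q \<in> I") auto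
    next
      case False
      have z: "\<phi> p w = 0" using cosectD(2)[OF \<phi>] False by blast
      then have "\<phi> q (vmap M p q w) = 0" using cosectD(3)[OF \<phi> _ p w] cosectD(2)[OF \<phi>] by (cases "q \<in> I") auto
      then show ?thesis using z by simp
    qed
    then have "vmap M p q w - vscale (\<phi> q (vmap M p q w)) (v q) = vmap M p q (w - vscale (\<phi> p w) (v p))"
      using eq by simp
    then show "\<psi>' t q (vmap M p q w) = \<psi>' t p w"
      unfolding \<psi>'_def using cosectD(3)[OF interval_decompD(3)[OF D t] q p, unfolded Ns, OF proj[OF p(1) w]] by simp
  qed
  have uK: "u t p \<in> K p" if "t < n" "p \<in> P" for t p
    using sectD(1)[OF interval_decompD(2)[OF D that(1)] that(2)] by simp
  have \<phi>u: "\<phi> p (u t p) = 0" if "t < n" "p \<in> P" for t p using uK[OF that] by (simp add: K_def)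
  have \<psi>v: "\<psi>' t p (v p) = 0" if t: "t < n" and p: "p \<in> P" for t p
  proof -
    have "v p - vscale (\<phi> p (v p)) (v p) = 0"
      using 1 sectD(2)[OF v] by (cases "p \<in> I") auto
    moreover have "\<psi> t p 0 = 0"
    proof -
      have "0 \<in> K p" using proj[OF p vin[OF p]] \<open>v p - vscale (\<phi> p (v p)) (v p) = 0\<close> by simp
      then show ?thesis using lin_funD(2)[OF cosectD(1)[OF interval_decompD(3)[OF D t] p], of 0 0] by simp
    qed
    ultimately show ?thesis by (simp add: \<psi>'_def)
  qed
  have sum: "(\<Sum>t<n. vscale (\<psi>' t p w) (u t p)) + vscale (\<phi> p w) (v p) = w" if "p \<in> P" "w \<in> vspace M p" for p w
    using interval_decompD(5)[OF D that(1), of "w - vscale (\<phi> p w) (v p)"] proj[OF that] by (simp add: \<psi>'_def)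
  have JP: "p \<in> P" if "t < n" "p \<in> J t" for t p
    using is_intervalD(1)[OF interval_decompD(1)[OF D that(1)]] that(2) by blast
  have IP: "p \<in> P" if "p \<in> I" for p using is_intervalD(1)[OF I] that by blast
  have "interval_decomp P M (Suc n) (J(n := I)) (u(n := v)) (\<psi>'(n := \<phi>))"
    unfolding interval_decomp_def
  proof (intro conjI allI impI ballI)
    fix t assume "t < Suc n"
    then have t: "t < n \<or> t = n" by linarith
    show "is_interval P ((J(n := I)) t)" using t I interval_decompD(1)[OF D] by auto
    show "sect P M ((J(n := I)) t) ((u(n := v)) t)" using t v su by auto
    show "cosect P M ((J(n := I)) t) ((\<psi>'(n := \<phi>)) t)" using t \<phi> cu by auto
    fix s p assume "s < Suc n" and p: "p \<in> (J(n := I)) t"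
    then have s: "s < n \<or> s = n" by linarith
    show "(\<psi>'(n := \<phi>)) s p ((u(n := v)) t p) = (if s = t then 1 else 0)"
    proof (cases "t = n")
      case True
      then show ?thesis using s p \<psi>v IP 1 by auto
    next
      case False
      then have t: "t < n" and pJ: "p \<in> J t" using t p by auto
      show ?thesis
      proof (cases "s = n")
        case True
        then show ?thesis using False \<phi>u[OF t JP[OF t pJ]] by auto
      next
        case sn: False
        then have "s < n" using s by blast
        then show ?thesis
          using sn False interval_decompD(4)[OF D t _ pJ] \<phi>u[OF t JP[OF t pJ]] by (simp add: \<psi>'_def)
      qed
    qed
  next
    fix p w assume "p \<in> P" "w \<in> vspace M p"
    from sum[OF this] show "(\<Sum>t<Suc n. vscale ((\<psi>'(n := \<phi>)) t p w) ((u(n := v)) t p)) = w"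
      by simp
  qed
  moreover have "\<psi>' = (\<lambda>t p w. \<psi> t p (w - vscale (\<phi> p w) (v p)))" unfolding \<psi>'_def by blast
  ultimately show ?thesis by simp
qed

text \<open>Induction on the total dimension: the complement of a summand, the kernel of
  \<open>\<phi>\<close>, is strictly smaller at the vertices of \<open>I\<close>, and
  \<open>I\<close> is nonempty.\<close>

lemma decomposable_by_summands:
  fixes P :: "'a::order set"
  assumes fin: "finite P"
    and summand: "\<And>M :: ('a, 'k::field) rep. is_rep P M \<Longrightarrow> \<not> is_zero_rep P M \<Longrightarrow> interval_summand P M"
  shows "decomposable_poset TYPE('k) P"
  unfolding decomposable_poset_def
proof (intro allI impI)
  fix M :: "('a, 'k) rep" assume "is_rep P M"
  then show "\<exists>n I v \<phi>. interval_decomp P M n I v \<phi>"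
  proof (induction "\<Sum>p\<in>P. vec.dim (vspace M p)" arbitrary: M rule: less_induct)
    case (less M)
    show ?case
    proof (cases "is_zero_rep P M")
      case True
      have "interval_decomp P M 0 (\<lambda>_. {}) (\<lambda>_ _. 0) (\<lambda>_ _ _. 0)"
        using True unfolding interval_decomp_def is_zero_rep_def by auto
      then show ?thesis by blast
    next
      case False
      obtain I v \<phi> where I: "is_interval P I" and v: "sect P M I v" and \<phi>: "cosect P M I \<phi>"
        and 1: "\<forall>p\<in>I. \<phi> p (v p) = 1"
        using summand[OF less.prems False] unfolding interval_summand_def by blast
      define K where "K p = {w \<in> vspace M p. \<phi> p w = 0}" for p
      have sub: "vec.subspace (K p)" if p: "p \<in> P" for p
        using rep_subspace[OF less.prems p] lin_fun_0[OF cosectD(1)[OF \<phi> p] rep_subspace[OF less.prems p]]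
          lin_funD[OF cosectD(1)[OF \<phi> p]]
        unfolding vec.subspace_def K_def by simp
      have N: "is_rep P \<lparr>vspace = K, vmap = vmap M\<rparr>"
      proof (rule is_rep_subrep[OF less.prems sub])
        fix p q w assume pq: "p \<in> P" "q \<in> P" "p \<le> q" and w: "w \<in> K p"
        have w': "w \<in> vspace M p" "\<phi> p w = 0" using w by (auto simp: K_def)
        have "\<phi> q (vmap M p q w) = 0"
          using cosectD(3)[OF \<phi> _ pq(1,3) w'(1)] cosectD(2)[OF \<phi>] w'(2) by (cases "q \<in> I") auto
        then show "vmap M p q w \<in> K q" using rep_in[OF less.prems pq w'(1)] by (simp add: K_def)
      qed (auto simp: K_def)
      obtain a where a: "a \<in> I" using is_intervalD(2)[OF I] by blast
      then have aP: "a \<in> P" using is_intervalD(1)[OF I] by blast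
      have fd: "fin_dim_space (vspace M p)" if "p \<in> P" for p using less.prems that by (simp add: is_rep_def)
      have le: "vec.dim (K p) \<le> vec.dim (vspace M p)" if "p \<in> P" for p
      proof (cases "K p = vspace M p")
        case False
        then have "K p \<subset> vspace M p" by (auto simp: K_def)
        then show ?thesis using fin_dim_space_dim_less[OF fd[OF that] sub[OF that]] by simp
      qed simp
      have "v a \<in> vspace M a - K a" using sectD(1)[OF v aP] 1 a by (simp add: K_def)
      then have "K a \<subset> vspace M a" by (auto simp: K_def)
      then have "vec.dim (K a) < vec.dim (vspace M a)" using fin_dim_space_dim_less[OF fd[OF aP] sub[OF aP]] by simp
      then have "(\<Sum>p\<in>P. vec.dim (K p)) < (\<Sum>p\<in>P. vec.dim (vspace M p))"
        by (intro sum_strict_mono_ex1[OF fin]) (use le aP in auto)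
      then obtain n J u \<psi> where "interval_decomp P \<lparr>vspace = K, vmap = vmap M\<rparr> n J u \<psi>"
        using less.hyps[OF _ N] by auto
      then show ?thesis
        using decomp_add_summand[OF less.prems I v \<phi> 1] unfolding K_def by blast
    qed
  qed
qed

section \<open>Zigzag posets\<close>

text \<open>The indicator function of \<open>C\<close> is a morphism \<open>k\<^sub>I \<rightarrow> k\<^sub>J\<close> that does not vanish at \<open>a\<close>.\<close>

definition hom_support :: "'a::order \<Rightarrow> 'a set \<Rightarrow> 'a set \<Rightarrow> 'a set \<Rightarrow> bool" where
  "hom_support a I J C \<longleftrightarrow> C \<subseteq> I \<and> C \<subseteq> J \<and> a \<in> C \<and> (\<forall>p q. p \<in> C \<longrightarrow> q \<in> J \<longrightarrow> p \<le> q \<longrightarrow> q \<in> C)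
     \<and> (\<forall>p q. p \<in> C \<longrightarrow> q \<in> I \<longrightarrow> q \<le> p \<longrightarrow> q \<in> C)"

definition hom_le :: "'a::order \<Rightarrow> 'a set \<Rightarrow> 'a set \<Rightarrow> bool" where
  "hom_le a I J \<longleftrightarrow> (\<exists>C. hom_support a I J C)"

lemma hom_supportI:
  assumes "C \<subseteq> I" "C \<subseteq> J" "a \<in> C" "\<And>p q. p \<in> C \<Longrightarrow> q \<in> J \<Longrightarrow> p \<le> q \<Longrightarrow> q \<in> C"
    "\<And>p q. p \<in> C \<Longrightarrow> q \<in> I \<Longrightarrow> q \<le> p \<Longrightarrow> q \<in> C"
  shows "hom_support a I J C"
  unfolding hom_support_def by (intro conjI allI impI) (fact assms)+

lemma hom_supportD:
  assumes "hom_support a I J C"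
  shows "C \<subseteq> I" "C \<subseteq> J" "a \<in> C" "p \<in> C \<Longrightarrow> q \<in> J \<Longrightarrow> p \<le> q \<Longrightarrow> q \<in> C"
    "p \<in> C \<Longrightarrow> q \<in> I \<Longrightarrow> q \<le> p \<Longrightarrow> q \<in> C"
proof -
  note h = assms[unfolded hom_support_def]
  show "C \<subseteq> I" by (rule h[THEN conjunct1])
  show "C \<subseteq> J" by (rule h[THEN conjunct2, THEN conjunct1])
  show "a \<in> C" by (rule h[THEN conjunct2, THEN conjunct2, THEN conjunct1])
  show "p \<in> C \<Longrightarrow> q \<in> J \<Longrightarrow> p \<le> q \<Longrightarrow> q \<in> C"
    by (rule h[THEN conjunct2, THEN conjunct2, THEN conjunct2, THEN conjunct1, rule_format])
  show "p \<in> C \<Longrightarrow> q \<in> I \<Longrightarrow> q \<le> p \<Longrightarrow> q \<in> C"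
    by (rule h[THEN conjunct2, THEN conjunct2, THEN conjunct2, THEN conjunct2, rule_format])
qed

lemma hom_leI: "hom_support a I J C \<Longrightarrow> hom_le a I J"
  unfolding hom_le_def by (rule exI)

text \<open>Composition of the two morphisms: the support of the composite is
  \<open>C \<inter> D\<close>, which still contains \<open>a\<close>.\<close>

lemma hom_le_trans:
  assumes "hom_le a I J" "hom_le a J K"
  shows "hom_le a I K"
proof -
  obtain C where C: "hom_support a I J C" using assms(1) unfolding hom_le_def by (rule exE)
  obtain D where D: "hom_support a J K D" using assms(2) unfolding hom_le_def by (rule exE)
  show ?thesis
  proof (rule hom_leI[of _ _ _ "C \<inter> D"], rule hom_supportI)
    show "C \<inter> D \<subseteq> I" "C \<inter> D \<subseteq> K" "a \<in> C \<inter> D"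
      using hom_supportD(1-3)[OF C] hom_supportD(1-3)[OF D] by auto
    fix p q assume p: "p \<in> C \<inter> D"
    show "q \<in> C \<inter> D" if q: "q \<in> K" "p \<le> q"
    proof -
      have "q \<in> D" using hom_supportD(4)[OF D, of p q] p q by simp
      moreover from this have "q \<in> J" using hom_supportD(1)[OF D] by auto
      ultimately show ?thesis using hom_supportD(4)[OF C, of p q] p q by simp
    qed
    show "q \<in> C \<inter> D" if q: "q \<in> I" "q \<le> p"
    proof -
      have "q \<in> C" using hom_supportD(5)[OF C, of p q] p q by simp
      moreover from this have "q \<in> J" using hom_supportD(2)[OF C] by auto
      ultimately show ?thesis using hom_supportD(5)[OF D, of p q] p q by simp
    qed
  qed
qed

text \<open>The relation is a total preorder, reflexivity being totality for \<open>s = t\<close>.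
  Antisymmetry cannot be expected, since different summands may have equal intervals.\<close>

lemma finite_total_least:
  assumes "finite S" "S \<noteq> {}" "\<And>s t. s \<in> S \<Longrightarrow> t \<in> S \<Longrightarrow> r s t \<or> r t s" "\<And>a b c. r a b \<Longrightarrow> r b c \<Longrightarrow> r a c"
  shows "\<exists>m\<in>S. \<forall>s\<in>S. r m s"
  using assms(1-3)
proof (induction S rule: finite_ne_induct)
  case (insert x F)
  then obtain m where m: "m \<in> F" "\<forall>s\<in>F. r m s" by auto
  show ?case
  proof (cases "r m x")
    case False
    then have "r x m" "r x x" using insert.prems[of x m] insert.prems[of x x] m by auto
    then show ?thesis using m assms(4) by blast
  qed (use m in auto)
qed auto

section \<open>Attaching and removing a leaf of a poset\<close>

lemma connected_insert:
  assumes "connected_poset I" "y \<in> I" "x \<le> y \<or> y \<le> x"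
  shows "connected_poset (insert x I)"
proof -
  let ?R = "{(u, v). u \<in> insert x I \<and> v \<in> insert x I \<and> (u \<le> v \<or> v \<le> u)}"
  have from_y: "(y, b) \<in> ?R\<^sup>*" if "b \<in> insert x I" for b
  proof (cases "b = x")
    case True
    then have "(y, b) \<in> ?R" using assms by auto
    then show ?thesis by blast
  next
    case False
    then have "b \<in> I" using that by blast
    with assms(1,2) show ?thesis
    proof (rule connected_poset_induct)
      show "(y, v) \<in> ?R\<^sup>*" if "u \<in> I" "v \<in> I" "u \<le> v \<or> v \<le> u" "(y, u) \<in> ?R\<^sup>*" for u v
        using that by (intro rtrancl_into_rtrancl[OF that(4)]) auto
    qed simp
  qed
  have "sym ?R" by (auto simp: sym_def)
  then have "sym (?R\<^sup>*)" by (rule sym_rtrancl)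
  then show ?thesis
    unfolding connected_poset_def using from_y by (meson rtrancl_trans symD)
qed

text \<open>A vertex of degree one joined upward to \<open>y\<close>, said without the diagram; this
  is what lets every map from \<open>P\<close> into \<open>x\<close> factor through the value at
  \<open>y\<close>.\<close>

definition leaf_above :: "'a::order set \<Rightarrow> 'a \<Rightarrow> 'a \<Rightarrow> bool" where
  "leaf_above P y x \<longleftrightarrow> y \<in> P \<and> x \<notin> P \<and> (\<forall>p\<in>P. \<not> x \<le> p \<and> (p \<le> x \<longleftrightarrow> p \<le> y))"

definition leaf_below :: "'a::order set \<Rightarrow> 'a \<Rightarrow> 'a \<Rightarrow> bool" where
  "leaf_below P y x \<longleftrightarrow> y \<in> P \<and> x \<notin> P \<and> (\<forall>p\<in>P. \<not> p \<le> x \<and> (x \<le> p \<longleftrightarrow> y \<le> p))"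

lemma leaf_aboveD:
  assumes "leaf_above P y x"
  shows "y \<in> P" "x \<notin> P" "y \<le> x" "p \<in> P \<Longrightarrow> \<not> x \<le> p" "p \<in> P \<Longrightarrow> p \<le> x \<Longrightarrow> p \<le> y"
  using assms unfolding leaf_above_def by blast+

lemma leaf_belowD:
  assumes "leaf_below P y x"
  shows "y \<in> P" "x \<notin> P" "x \<le> y" "p \<in> P \<Longrightarrow> \<not> p \<le> x" "p \<in> P \<Longrightarrow> x \<le> p \<Longrightarrow> y \<le> p"
  using assms unfolding leaf_below_def by blast+

lemma leafD:
  assumes "leaf_above P y x \<or> leaf_below P y x"
  shows "y \<in> P" "x \<notin> P" "x \<le> y \<or> y \<le> x" "p \<in> P \<Longrightarrow> p \<le> x \<Longrightarrow> p \<le> y" "p \<in> P \<Longrightarrow> x \<le> p \<Longrightarrow> y \<le> p"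
  using assms leaf_aboveD[of P y x] leaf_belowD[of P y x] by blast+

text \<open>The second argument is the last vertex attached, and the next one may be attached only
  there; hence the Hasse diagram is a path and not an arbitrary tree.\<close>

inductive zigzag_poset :: "'a::order set \<Rightarrow> 'a \<Rightarrow> bool" where
  single: "zigzag_poset {y} y"
| above: "zigzag_poset P y \<Longrightarrow> leaf_above P y x \<Longrightarrow> zigzag_poset (insert x P) x"
| below: "zigzag_poset P y \<Longrightarrow> leaf_below P y x \<Longrightarrow> zigzag_poset (insert x P) x"

lemma zigzag_finite: "zigzag_poset P y \<Longrightarrow> finite P"
  by (induction rule: zigzag_poset.induct) auto

lemma interval_singleton: "p \<in> P \<Longrightarrow> is_interval P {p}"
  by (rule is_intervalI) (auto simp: connected_poset_def)

text \<open>A leaf is maximal or minimal, hence never strictly between two elements of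
  \<open>P\<close>, and convexity is not disturbed.\<close>

lemma interval_insert_leaf:
  assumes "leaf_above P y x \<or> leaf_below P y x" "is_interval P I"
  shows "is_interval (insert x P) I"
proof (rule is_intervalI)
  show "I \<subseteq> insert x P" "I \<noteq> {}" "connected_poset I" using is_intervalD[OF assms(2)] by blast+
  show "z \<in> I" if "p \<in> I" "q \<in> I" "z \<in> insert x P" "p < z" "z < q" for p q z
  proof (cases "z = x")
    case True
    have "p \<in> P" "q \<in> P" using that is_intervalD(1)[OF assms(2)] by blast+
    then show ?thesis
      using assms(1) leaf_aboveD(4)[of P y x q] leaf_belowD(4)[of P y x p] that True by (auto dest: less_imp_le)
  next
    case False
    then show ?thesis using is_intervalD(4)[OF assms(2) that(1,2)] that(3-5) by (auto dest: less_imp_le)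
  qed
qed

text \<open>A vertex of \<open>P\<close> between \<open>x\<close> and an element of \<open>I\<close>
  is also between \<open>y\<close> and that element, so convexity of \<open>I\<close>
  suffices.\<close>

lemma interval_extend_leaf:
  assumes x: "leaf_above P y x \<or> leaf_below P y x" and I: "is_interval P I" and y: "y \<in> I"
  shows "is_interval (insert x P) (insert x I)"
proof (rule is_intervalI)
  have cmp: "x \<le> y \<or> y \<le> x" using x leaf_aboveD(3) leaf_belowD(3) by blast
  show "insert x I \<subseteq> insert x P" "insert x I \<noteq> {}" using is_intervalD[OF I] by blast+
  show "connected_poset (insert x I)" by (rule connected_insert[OF is_intervalD(3)[OF I] y cmp])
  show "z \<in> insert x I" if p: "p \<in> insert x I" and q: "q \<in> insert x I" and z: "z \<in> insert x P" "p < z" "z < q" for p q z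
  proof (cases "z = x")
    case False
    then have zP: "z \<in> P" using z by blast
    from x have "z \<in> I"
    proof
      assume l: "leaf_above P y x"
      have "p \<in> I" using p leaf_aboveD(4)[OF l zP] z(2) by (auto dest: less_imp_le)
      moreover have "\<exists>q'\<in>I. z \<le> q'"
        using q y leaf_aboveD(5)[OF l zP] z(3) by (auto dest: less_imp_le)
      ultimately show ?thesis using is_intervalD(4)[OF I _ _ zP] z(2) less_imp_le by blast
    next
      assume l: "leaf_below P y x"
      have "q \<in> I" using q leaf_belowD(4)[OF l zP] z(3) by (auto dest: less_imp_le)
      moreover have "\<exists>p'\<in>I. p' \<le> z"
        using p y leaf_belowD(5)[OF l zP] z(2) by (auto dest: less_imp_le)
      ultimately show ?thesis using is_intervalD(4)[OF I _ _ zP] z(3) less_imp_le by blast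
    qed
    then show ?thesis by blast
  qed simp
qed

text \<open>Any other element of the interval comparable with \<open>x\<close> is comparable through
  \<open>y\<close>, so convexity puts \<open>y\<close> in \<open>I\<close>. Removing
  \<open>x\<close> keeps \<open>I\<close> connected because a chain of comparabilities through
  \<open>x\<close> can pass through \<open>y\<close> instead.\<close>

lemma interval_remove_leaf:
  assumes x: "leaf_above P y x \<or> leaf_below P y x" and I: "is_interval (insert x P) I" "x \<in> I" "I \<noteq> {x}"
  shows "y \<in> I" "is_interval P (I - {x})"
proof -
  note yP = leafD(1,2)[OF x] and nb1 = leafD(4)[OF x] and nb2 = leafD(5)[OF x]
  have sub: "I - {x} \<subseteq> P" using is_intervalD(1)[OF I(1)] by blast
  have "\<exists>b\<in>I - {x}. b \<le> x \<or> x \<le> b"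
  proof (rule ccontr)
    assume n: "\<not> ?thesis"
    obtain c where c: "c \<in> I" "c \<noteq> x" using I by blast
    have "c = x"
    proof (rule connected_poset_induct[OF is_intervalD(3)[OF I(1)] I(2) c(1)])
      show "x = x" ..
      show "w = x" if "v \<in> I" "w \<in> I" "v \<le> w \<or> w \<le> v" "v = x" for v w
        using n that by blast
    qed
    then show False using c by blast
  qed
  then obtain b where b: "b \<in> I" "b \<in> P" "b \<noteq> x" "b \<le> x \<or> x \<le> b" using sub by blast
  show yI: "y \<in> I"
    using x
  proof
    assume l: "leaf_above P y x"
    have "b \<le> y" "y \<le> x" using b leaf_aboveD(3,4)[OF l] leaf_aboveD(5)[OF l b(2)] by auto
    then show "y \<in> I" using is_intervalD(4)[OF I(1) b(1) I(2)] yP by blast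
  next
    assume l: "leaf_below P y x"
    have "y \<le> b" "x \<le> y" using b leaf_belowD(3,4)[OF l] leaf_belowD(5)[OF l b(2)] by auto
    then show "y \<in> I" using is_intervalD(4)[OF I(1) I(2) b(1)] yP by blast
  qed
  \<comment> \<open>The retraction that sends the leaf to \<open>y\<close>; it preserves
    comparability within \<open>I\<close>.\<close>
  define \<pi> where "\<pi> u = (if u = x then y else u)" for u
  let ?R = "{(u, v). u \<in> I - {x} \<and> v \<in> I - {x} \<and> (u \<le> v \<or> v \<le> u)}"
  have \<pi>: "(\<pi> u, \<pi> v) \<in> ?R" if "u \<in> I" "v \<in> I" "u \<le> v \<or> v \<le> u" for u v
  proof -
    have "u = x \<or> u \<in> I - {x} \<and> u \<in> P" "v = x \<or> v \<in> I - {x} \<and> v \<in> P" using that sub by auto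
    then show ?thesis using that(3) yI yP nb1[of u] nb2[of u] nb1[of v] nb2[of v] unfolding \<pi>_def by auto
  qed
  have conn: "connected_poset (I - {x})"
    unfolding connected_poset_def
  proof (intro ballI)
    fix a c assume a: "a \<in> I - {x}" and c: "c \<in> I - {x}"
    have "(a, \<pi> c) \<in> ?R\<^sup>*"
    proof (rule connected_poset_induct[OF is_intervalD(3)[OF I(1)], of a c])
      show "(a, \<pi> a) \<in> ?R\<^sup>*" using a by (simp add: \<pi>_def)
      show "(a, \<pi> v) \<in> ?R\<^sup>*" if "u \<in> I" "v \<in> I" "u \<le> v \<or> v \<le> u" "(a, \<pi> u) \<in> ?R\<^sup>*" for u v
        using \<pi>[OF that(1-3)] that(4) by (rule rtrancl_into_rtrancl[rotated])
    qed (use a c in auto)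
    then show "(a, c) \<in> ?R\<^sup>*" using c by (simp add: \<pi>_def)
  qed
  show "is_interval P (I - {x})"
  proof (rule is_intervalI[OF sub _ conn])
    show "I - {x} \<noteq> {}" using yI yP by auto
    fix p q z assume pq: "p \<in> I - {x}" "q \<in> I - {x}" "z \<in> P" "p < z" "z < q"
    then have "z \<in> I" using is_intervalD(4)[OF I(1), of p q z] by (auto dest: less_imp_le)
    then show "z \<in> I - {x}" using pq(3) yP(2) by auto
  qed
qed

text \<open>Both intervals shed the leaf \<open>x\<close>, and a comparison at \<open>y\<close>
  extends to \<open>x\<close> by enlarging the support by \<open>x\<close>. If one of them is just
  \<open>{x}\<close>, it is least when \<open>x\<close> is an upper leaf and greatest when
  \<open>x\<close> is a lower leaf.\<close>

lemma zigzag_total: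
  assumes "zigzag_poset P y" "is_interval P I" "is_interval P J" "y \<in> I" "y \<in> J"
  shows "hom_le y I J \<or> hom_le y J I"
  using assms
proof (induction arbitrary: I J rule: zigzag_poset.induct)
  case (single y)
  then have "I = {y}" "J = {y}" using is_intervalD(1) by blast+
  then have "hom_le y I J" by (intro hom_leI[of _ _ _ "{y}"] hom_supportI) auto
  then show ?case ..
next
  case (above P y x)
  note l = leaf_aboveD[OF above.hyps(2)]
  have sx: "hom_le x {x} K" if "is_interval (insert x P) K" "x \<in> K" for K
    using is_intervalD(1)[OF that(1)] that(2) l(4) by (intro hom_leI[of _ _ _ "{x}"] hom_supportI) auto
  have ext: "hom_le x K L" if h: "hom_le y (K - {x}) (L - {x})" and K: "is_interval (insert x P) K" "x \<in> K"
    and L: "is_interval (insert x P) L" "x \<in> L" for K L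
  proof -
    obtain C where C': "hom_support y (K - {x}) (L - {x}) C"
      using h unfolding hom_le_def by (rule exE)
    note C = hom_supportD[OF C']
    show ?thesis
    proof (rule hom_leI[of _ _ _ "insert x C"], rule hom_supportI)
      show "q \<in> insert x C" if "p \<in> insert x C" "q \<in> L" "p \<le> q" for p q
        using that C(4)[of p q] is_intervalD(1)[OF L(1)] l(4)[of q] by auto
      show "q \<in> insert x C" if "p \<in> insert x C" "q \<in> K" "q \<le> p" for p q
        using that C(3) C(5)[of p q] C(5)[of y q] is_intervalD(1)[OF K(1)] l(5)[of q] by auto
    qed (use C(1-3) K(2) L(2) in auto)
  qed
  show ?case
  proof (cases "I = {x} \<or> J = {x}")
    case True
    then show ?thesis using sx above.prems by blast
  next
    case False
    then show ?thesis
      using above.IH[of "I - {x}" "J - {x}"] interval_remove_leaf[of P y x] above.hyps(2) above.prems ext l(1,2)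
      by blast
  qed
next
  case (below P y x)
  note l = leaf_belowD[OF below.hyps(2)]
  have sx: "hom_le x K {x}" if "is_interval (insert x P) K" "x \<in> K" for K
    using is_intervalD(1)[OF that(1)] that(2) l(4) by (intro hom_leI[of _ _ _ "{x}"] hom_supportI) auto
  have ext: "hom_le x K L" if h: "hom_le y (K - {x}) (L - {x})" and K: "is_interval (insert x P) K" "x \<in> K"
    and L: "is_interval (insert x P) L" "x \<in> L" for K L
  proof -
    obtain C where C': "hom_support y (K - {x}) (L - {x}) C"
      using h unfolding hom_le_def by (rule exE)
    note C = hom_supportD[OF C']
    show ?thesis
    proof (rule hom_leI[of _ _ _ "insert x C"], rule hom_supportI)
      show "q \<in> insert x C" if "p \<in> insert x C" "q \<in> L" "p \<le> q" for p q
        using that C(3) C(4)[of p q] C(4)[of y q] is_intervalD(1)[OF L(1)] l(5)[of q] by auto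
      show "q \<in> insert x C" if "p \<in> insert x C" "q \<in> K" "q \<le> p" for p q
        using that C(5)[of p q] is_intervalD(1)[OF K(1)] l(4)[of q] by auto
    qed (use C(1-3) K(2) L(2) in auto)
  qed
  show ?case
  proof (cases "I = {x} \<or> J = {x}")
    case True
    then show ?thesis using sx below.prems by blast
  next
    case False
    then show ?thesis
      using below.IH[of "I - {x}" "J - {x}"] interval_remove_leaf[of P y x] below.hyps(2) below.prems ext l(1,2)
      by blast
  qed
qed

section \<open>Rearranging a decomposition along the preorder\<close>

lemma subspace_image:
  assumes "linear_on V W f" "vec.subspace V"
  shows "vec.subspace (f ` V)"
proof (rule vec.subspaceI)
  show "0 \<in> f ` V" using linear_on_0[OF assms] vec.subspace_0[OF assms(2)] by force
  fix x assume "x \<in> f ` V"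
  then obtain a where a: "a \<in> V" "x = f a" by (rule imageE)
  show "vscale c x \<in> f ` V" for c
    unfolding a(2) linear_onD(3)[OF assms(1) a(1), symmetric]
    by (rule imageI) (rule vec.subspace_scale[OF assms(2) a(1)])
  fix y assume "y \<in> f ` V"
  then obtain b where b: "b \<in> V" "y = f b" by (rule imageE)
  show "x + y \<in> f ` V"
    unfolding a(2) b(2) linear_onD(2)[OF assms(1) a(1) b(1), symmetric]
    by (rule imageI) (rule vec.subspace_add[OF assms(2) a(1) b(1)])
qed

text \<open>The summand with the least interval in the support of \<open>u\<close> is replaced by one whose generator
  takes the value \<open>u\<close> at \<open>y\<close>.\<close>

lemma kernel_decomp_summand:
  fixes M :: "('a::order, 'k::field) rep"
  assumes M: "is_rep P M" and D: "interval_decomp P M n I v \<phi>"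
    and y: "y \<in> P" and u: "u \<in> vspace M y" "u \<noteq> 0"
    and total: "\<And>I J. is_interval P I \<Longrightarrow> is_interval P J \<Longrightarrow> y \<in> I \<Longrightarrow> y \<in> J \<Longrightarrow> hom_le y I J \<or> hom_le y J I"
  obtains K w \<chi> where "is_interval P K" "sect P M K w" "cosect P M K \<chi>" "\<forall>p\<in>K. \<chi> p (w p) = 1" "y \<in> K" "w y = u"
proof -
  define S where "S = {t. t < n \<and> \<phi> t y u \<noteq> 0}"
  have Sn: "s < n" and yS: "y \<in> I s" if "s \<in> S" for s
    using that cosectD(2)[OF interval_decompD(3)[OF D]] by (auto simp: S_def)
  have fS: "finite S" by (simp add: S_def)
  have sumS: "(\<Sum>s\<in>S. vscale (\<phi> s y u) (v s y)) = u"
  proof -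
    have "(\<Sum>s\<in>S. vscale (\<phi> s y u) (v s y)) = (\<Sum>s<n. vscale (\<phi> s y u) (v s y))"
      by (rule sum.mono_neutral_left) (auto simp: S_def)
    then show ?thesis using interval_decompD(5)[OF D y u(1)] by simp
  qed
  then have "S \<noteq> {}" using u(2) by auto
  then have "\<exists>m\<in>S. \<forall>s\<in>S. hom_le y (I m) (I s)"
    using total interval_decompD(1)[OF D Sn] yS by (intro finite_total_least[OF fS]) (auto intro: hom_le_trans)
  then obtain m where m: "m \<in> S" "\<forall>s\<in>S. hom_le y (I m) (I s)" by blast
  then have "\<forall>s\<in>S. \<exists>C. hom_support y (I m) (I s) C" unfolding hom_le_def by blast
  then obtain C0 where C0: "\<forall>s\<in>S. hom_support y (I m) (I s) (C0 s)" by metis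
  \<comment> \<open>For \<open>s = m\<close> the support must be all of \<open>I m\<close>, so that
    the coefficient of \<open>v m\<close> in \<open>w\<close> is a nonzero constant there; this
    makes \<open>\<chi>\<close> a retraction of \<open>w\<close> on all of
    \<open>I m\<close>.\<close>
  define C where "C s = (if s = m then I m else C0 s)" for s
  have "hom_support y (I m) (I m) (I m)" using yS[OF m(1)] by (intro hom_supportI) auto
  then have "hom_support y (I m) (I s) (C s)" if "s \<in> S" for s
    using C0 that unfolding C_def by simp
  note C = hom_supportD[OF this]
  define c where "c s p = (if p \<in> C s then \<phi> s y u else 0)" for s p
  define w where "w p = (\<Sum>s\<in>S. vscale (c s p) (v s p))" for p
  define \<chi> where "\<chi> p z = \<phi> m p z / \<phi> m y u" for p z
  have vin: "v s p \<in> vspace M p" if "s \<in> S" "p \<in> P" for s p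
    using sectD(1)[OF interval_decompD(2)[OF D Sn]] that by blast
  have mn: "m < n" "\<phi> m y u \<noteq> 0" using m(1) by (auto simp: S_def)
  have IP: "p \<in> P" if "p \<in> I m" for p using is_intervalD(1)[OF interval_decompD(1)[OF D mn(1)]] that by blast
  have "sect P M (I m) w"
    unfolding sect_def
  proof (intro conjI ballI allI impI)
    fix p assume p: "p \<in> P"
    show "w p \<in> vspace M p"
      unfolding w_def using vin p by (intro vec.subspace_sum[OF rep_subspace[OF M p]] vec.subspace_scale[OF rep_subspace[OF M p]]) auto
  next
    fix p assume "p \<notin> I m"
    then show "w p = 0" unfolding w_def c_def using C(1) by (intro sum.neutral) auto
  next
    fix p q assume p: "p \<in> I m" and q: "q \<in> P" "p \<le> q"
    have "vmap M p q (w p) = (\<Sum>s\<in>S. vscale (c s p) (vmap M p q (v s p)))"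
      unfolding w_def using vin IP[OF p]
      by (intro linear_on_sum[OF rep_linear[OF M IP[OF p] q] rep_subspace[OF M IP[OF p]]]) auto
    also have "\<dots> = w q"
      unfolding w_def
    proof (rule sum.cong)
      fix s assume s: "s \<in> S"
      note se = sectD[OF interval_decompD(2)[OF D Sn[OF s]]]
      show "vscale (c s p) (vmap M p q (v s p)) = vscale (c s q) (v s q)"
      proof (cases "p \<in> C s")
        case True
        then have "p \<in> I s" using C(2)[OF s] by blast
        then have eq: "vmap M p q (v s p) = v s q" using se(3) q by blast
        show ?thesis
        proof (cases "q \<in> I s")
          case qs: True
          then have "q \<in> C s" using C(4)[OF s True _ q(2)] by blast
          then show ?thesis using True eq by (simp add: c_def)
        next
          case False
          then show ?thesis using se(2) eq by simp
        qed
      next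
        case False
        then have "q \<notin> C s" using C(5)[OF s _ p q(2)] by blast
        then show ?thesis using False by (simp add: c_def)
      qed
    qed simp
    finally show "vmap M p q (w p) = w q" .
  qed
  moreover have "cosect P M (I m) \<chi>"
    using interval_decompD(3)[OF D mn(1)] unfolding cosect_def lin_fun_def \<chi>_def
    by (auto simp: add_divide_distrib)
  moreover have "\<forall>p\<in>I m. \<chi> p (w p) = 1"
  proof
    fix p assume p: "p \<in> I m"
    have "\<phi> m p (w p) = (\<Sum>s\<in>S. c s p * \<phi> m p (v s p))"
      unfolding w_def using vin IP[OF p]
      by (intro lin_fun_sum[OF cosectD(1)[OF interval_decompD(3)[OF D mn(1)] IP[OF p]] rep_subspace[OF M IP[OF p]]]) auto
    also have "\<dots> = (\<Sum>s\<in>S. if s = m then \<phi> m y u else 0)"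
    proof (rule sum.cong)
      fix s assume s: "s \<in> S"
      show "c s p * \<phi> m p (v s p) = (if s = m then \<phi> m y u else 0)"
      proof (cases "p \<in> C s")
        case True
        then have "p \<in> I s" using C(2)[OF s] by blast
        then have "\<phi> m p (v s p) = (if m = s then 1 else 0)" using interval_decompD(4)[OF D Sn[OF s] mn(1)] by blast
        then show ?thesis using True by (simp add: c_def)
      next
        case False
        then show ?thesis using p by (auto simp: c_def C_def)
      qed
    qed simp
    finally show "\<chi> p (w p) = 1" using mn(2) m(1) fS by (simp add: \<chi>_def)
  qed
  moreover have "w y = u" unfolding w_def c_def using C(3) sumS by (simp cong: sum.cong_simp)
  ultimately show thesis using that interval_decompD(1)[OF D mn(1)] yS[OF m(1)] by blast
qed

text \<open>Dual to \<open>kernel_decomp_summand\<close>: among the intervals whose generators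
  \<open>\<psi>\<close> does not kill, the greatest receives morphisms from all the others, so its
  cosection can be replaced by a combination that equals \<open>\<psi>\<close> at \<open>y\<close>.
  The section is only rescaled.\<close>

lemma image_decomp_summand:
  fixes M :: "('a::order, 'k::field) rep"
  assumes M: "is_rep P M" and D: "interval_decomp P M n I v \<phi>"
    and y: "y \<in> P" and \<psi>: "lin_fun (vspace M y) \<psi>" and u: "u \<in> vspace M y" "\<psi> u \<noteq> 0"
    and total: "\<And>I J. is_interval P I \<Longrightarrow> is_interval P J \<Longrightarrow> y \<in> I \<Longrightarrow> y \<in> J \<Longrightarrow> hom_le y I J \<or> hom_le y J I"
  obtains K w \<chi> where "is_interval P K" "sect P M K w" "cosect P M K \<chi>" "\<forall>p\<in>K. \<chi> p (w p) = 1" "y \<in> K"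
    "\<forall>z\<in>vspace M y. \<chi> y z = \<psi> z"
proof -
  define S where "S = {t. t < n \<and> \<psi> (v t y) \<noteq> 0}"
  have \<psi>0: "\<psi> 0 = 0" using lin_fun_0[OF \<psi> rep_subspace[OF M y]] .
  have yI: "y \<in> I t" if "t < n" "\<psi> (v t y) \<noteq> 0" for t
    using that sectD(2)[OF interval_decompD(2)[OF D that(1)]] \<psi>0 by metis
  have Sn: "s < n" and yS: "y \<in> I s" if "s \<in> S" for s
    using that yI by (auto simp: S_def)
  have fS: "finite S" by (simp add: S_def)
  have vy: "v t y \<in> vspace M y" if "t < n" for t using sectD(1)[OF interval_decompD(2)[OF D that] y] .
  have sumS: "(\<Sum>s\<in>S. \<psi> (v s y) * \<phi> s y z) = \<psi> z" if z: "z \<in> vspace M y" for z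
  proof -
    have "(\<Sum>s\<in>S. \<psi> (v s y) * \<phi> s y z) = (\<Sum>s<n. \<phi> s y z * \<psi> (v s y))"
      by (rule sum.mono_neutral_cong_left) (auto simp: S_def)
    also have "\<dots> = \<psi> (\<Sum>s<n. vscale (\<phi> s y z) (v s y))"
      by (rule lin_fun_sum[symmetric, OF \<psi> rep_subspace[OF M y]]) (use vy in auto)
    finally show ?thesis using interval_decompD(5)[OF D y z] by simp
  qed
  have "S \<noteq> {}" using sumS[OF u(1)] u(2) by auto
  \<comment> \<open>The greatest interval is the least one for the reversed preorder.\<close>
  then have "\<exists>m\<in>S. \<forall>s\<in>S. hom_le y (I s) (I m)"
    using total interval_decompD(1)[OF D Sn] yS
    by (intro finite_total_least[OF fS, where r = "\<lambda>s t. hom_le y (I t) (I s)"]) (auto intro: hom_le_trans)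
  then obtain m where m: "m \<in> S" "\<forall>s\<in>S. hom_le y (I s) (I m)" by blast
  then have "\<forall>s\<in>S. \<exists>C. hom_support y (I s) (I m) C" unfolding hom_le_def by blast
  then obtain C0 where C0: "\<forall>s\<in>S. hom_support y (I s) (I m) (C0 s)" by metis
  define C where "C s = (if s = m then I m else C0 s)" for s
  have "hom_support y (I m) (I m) (I m)" using yS[OF m(1)] by (intro hom_supportI) auto
  then have "hom_support y (I s) (I m) (C s)" if "s \<in> S" for s
    using C0 that unfolding C_def by simp
  note C = hom_supportD[OF this]
  define c where "c s p = (if p \<in> C s then \<psi> (v s y) else 0)" for s p
  define \<chi> where "\<chi> p z = (\<Sum>s\<in>S. c s p * \<phi> s p z)" for p z
  have mn: "m < n" "\<psi> (v m y) \<noteq> 0" using m(1) by (auto simp: S_def)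
  define w where "w p = vscale (1 / \<psi> (v m y)) (v m p)" for p
  have IP: "p \<in> P" if "p \<in> I m" for p using is_intervalD(1)[OF interval_decompD(1)[OF D mn(1)]] that by blast
  have "cosect P M (I m) \<chi>"
    unfolding cosect_def
  proof (intro conjI ballI allI impI)
    fix p assume p: "p \<in> P"
    have l: "lin_fun (vspace M p) (\<phi> s p)" if "s \<in> S" for s
      using cosectD(1)[OF interval_decompD(3)[OF D Sn[OF that]] p] .
    show "lin_fun (vspace M p) (\<chi> p)"
      unfolding lin_fun_def \<chi>_def sum_distrib_left sum.distrib[symmetric]
      using lin_funD[OF l] by (auto intro!: sum.cong simp: algebra_simps)
  next
    fix p z assume "p \<notin> I m"
    then show "\<chi> p z = 0" unfolding \<chi>_def c_def using C(2) by (intro sum.neutral) auto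
  next
    fix q p z assume q: "q \<in> I m" and p: "p \<in> P" "p \<le> q" and z: "z \<in> vspace M p"
    show "\<chi> q (vmap M p q z) = \<chi> p z"
      unfolding \<chi>_def
    proof (rule sum.cong)
      fix s assume s: "s \<in> S"
      note ce = cosectD[OF interval_decompD(3)[OF D Sn[OF s]]]
      show "c s q * \<phi> s q (vmap M p q z) = c s p * \<phi> s p z"
      proof (cases "q \<in> C s")
        case True
        then have "q \<in> I s" using C(1)[OF s] by blast
        then have eq: "\<phi> s q (vmap M p q z) = \<phi> s p z" using ce(3) p z by blast
        show ?thesis
        proof (cases "p \<in> I s")
          case ps: True
          then have "p \<in> C s" using C(5)[OF s True _ p(2)] by blast
          then show ?thesis using True eq by (simp add: c_def)
        next
          case False
          then show ?thesis using ce(2) eq by simp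
        qed
      next
        case False
        then have "p \<notin> C s" using C(4)[OF s _ q p(2)] by blast
        then show ?thesis using False by (simp add: c_def)
      qed
    qed simp
  qed
  moreover have "sect P M (I m) w"
    unfolding sect_def w_def
  proof (intro conjI ballI allI impI)
    note se = sectD[OF interval_decompD(2)[OF D mn(1)]]
    show "vscale (1 / \<psi> (v m y)) (v m p) \<in> vspace M p" if "p \<in> P" for p
      using vec.subspace_scale[OF rep_subspace[OF M that] se(1)[OF that]] .
    show "vscale (1 / \<psi> (v m y)) (v m p) = 0" if "p \<notin> I m" for p using se(2)[OF that] by simp
    show "vmap M p q (vscale (1 / \<psi> (v m y)) (v m p)) = vscale (1 / \<psi> (v m y)) (v m q)"
      if "p \<in> I m" "q \<in> P" "p \<le> q" for p q
      using linear_onD(3)[OF rep_linear[OF M IP[OF that(1)] that(2,3)] se(1)[OF IP[OF that(1)]]] se(3)[OF that] by simp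
  qed
  moreover have "\<forall>p\<in>I m. \<chi> p (w p) = 1"
  proof
    fix p assume p: "p \<in> I m"
    have "\<chi> p (w p) = (\<Sum>s\<in>S. if s = m then 1 else 0)"
      unfolding \<chi>_def
    proof (rule sum.cong)
      fix s assume s: "s \<in> S"
      have "\<phi> s p (w p) = 1 / \<psi> (v m y) * \<phi> s p (v m p)"
        unfolding w_def using lin_funD(2)[OF cosectD(1)[OF interval_decompD(3)[OF D Sn[OF s]] IP[OF p]]]
          sectD(1)[OF interval_decompD(2)[OF D mn(1)] IP[OF p]] by blast
      then show "c s p * \<phi> s p (w p) = (if s = m then 1 else 0)"
        using interval_decompD(4)[OF D mn(1) Sn[OF s] p] mn(2) p by (simp add: c_def C_def)
    qed simp
    then show "\<chi> p (w p) = 1" using m(1) fS by simp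
  qed
  moreover have "\<forall>z\<in>vspace M y. \<chi> y z = \<psi> z" unfolding \<chi>_def c_def using C(3) sumS by (simp cong: sum.cong_simp)
  ultimately show thesis using that interval_decompD(1)[OF D mn(1)] yS[OF m(1)] by blast
qed

section \<open>Summands of a module on a larger poset\<close>

lemma interval_summandI:
  assumes "is_interval P I" "sect P M I v" "cosect P M I \<phi>" "\<And>p. p \<in> I \<Longrightarrow> \<phi> p (v p) = 1"
  shows "interval_summand P M"
  unfolding interval_summand_def using assms(4) by (intro exI[of _ I] exI[of _ v] exI[of _ \<phi>] conjI assms(1-3)) simp

lemma decomposable_posetD:
  assumes "decomposable_poset TYPE('k::field) P" "is_rep P (M :: ('a::order, 'k) rep)"
  obtains n I v \<phi> where "interval_decomp P M n I v \<phi>"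
  using assms unfolding decomposable_poset_def by meson

text \<open>If no interval contained \<open>a\<close>, every term of the resolution of the identity
  would vanish at \<open>a\<close>. Control over where the summand lives is needed at the bottom of
  a bounded poset.\<close>

lemma decomposable_summand:
  assumes "decomposable_poset TYPE('k::field) P" "is_rep P (M :: ('a::order, 'k) rep)" "a \<in> P" "vspace M a \<noteq> {0}"
  obtains I v \<phi> where "is_interval P I" "sect P M I v" "cosect P M I \<phi>" "\<And>p. p \<in> I \<Longrightarrow> \<phi> p (v p) = 1" "a \<in> I"
proof -
  obtain n I v \<phi> where D: "interval_decomp P M n I v \<phi>" using decomposable_posetD[OF assms(1,2)] .
  have "0 \<in> vspace M a" using vec.subspace_0[OF rep_subspace[OF assms(2,3)]] .
  then obtain u where u: "u \<in> vspace M a" "u \<noteq> 0" using assms(4) by blast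
  have "\<exists>t<n. a \<in> I t"
  proof (rule ccontr)
    assume n: "\<not> ?thesis"
    have "(\<Sum>t<n. vscale (\<phi> t a u) (v t a)) = 0"
      using n cosectD(2)[OF interval_decompD(3)[OF D]] by (intro sum.neutral) auto
    then show False using interval_decompD(5)[OF D assms(3) u(1)] u(2) by simp
  qed
  then obtain t where t: "t < n" "a \<in> I t" by blast
  note s = interval_decomp_single[OF assms(2) D t(1)]
  show thesis by (rule that[OF s(1-3) _ t(2)]) (use s(4) in simp)
qed

lemma convex_interval_superset:
  assumes "is_interval Q I" "Q \<subseteq> P" "\<And>p q z. p \<in> Q \<Longrightarrow> q \<in> Q \<Longrightarrow> z \<in> P \<Longrightarrow> p < z \<Longrightarrow> z < q \<Longrightarrow> z \<in> Q"
  shows "is_interval P I"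
proof (rule is_intervalI)
  show "I \<subseteq> P" "I \<noteq> {}" "connected_poset I" using is_intervalD(1-3)[OF assms(1)] assms(2) by auto
  fix p q z assume h: "p \<in> I" "q \<in> I" "z \<in> P" "p < z" "z < q"
  then have "z \<in> Q" using is_intervalD(1)[OF assms(1)] assms(3)[of p q z] by auto
  then show "z \<in> I" using is_intervalD(4)[OF assms(1) h(1,2)] h(4,5) by simp
qed

text \<open>Section and cosection are extended by zero. The only new compatibilities concern maps
  that leave \<open>Q\<close> from \<open>K\<close> and maps that enter \<open>K\<close> from
  outside \<open>Q\<close>; these are \<open>up\<close> and \<open>down\<close>.\<close>

lemma interval_summand_extend:
  assumes M: "is_rep P M" and QP: "Q \<subseteq> P" and K: "is_interval P K" "K \<subseteq> Q"
    and w: "sect Q M K w" and \<chi>: "cosect Q M K \<chi>" and 1: "\<And>p. p \<in> K \<Longrightarrow> \<chi> p (w p) = 1"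
    and up: "\<And>p q. p \<in> K \<Longrightarrow> q \<in> P - Q \<Longrightarrow> p \<le> q \<Longrightarrow> vmap M p q (w p) = 0"
    and down: "\<And>p q z. q \<in> K \<Longrightarrow> p \<in> P - Q \<Longrightarrow> p \<le> q \<Longrightarrow> z \<in> vspace M p \<Longrightarrow> \<chi> q (vmap M p q z) = 0"
  shows "interval_summand P M"
proof (rule interval_summandI[OF K(1)])
  have out: "p \<notin> K" if "p \<notin> Q" for p using K(2) that by auto
  show "sect P M K w"
    unfolding sect_def
  proof (intro conjI ballI allI impI)
    fix p assume p: "p \<in> P"
    show "w p \<in> vspace M p"
      using sectD(1)[OF w, of p] sectD(2)[OF w out] vec.subspace_0[OF rep_subspace[OF M p]] by (cases "p \<in> Q") auto
  next
    fix p assume "p \<notin> K" then show "w p = 0" by (rule sectD(2)[OF w])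
  next
    fix p q assume p: "p \<in> K" and q: "q \<in> P" "p \<le> q"
    show "vmap M p q (w p) = w q"
      using sectD(3)[OF w p _ q(2)] up[OF p _ q(2)] sectD(2)[OF w out] q(1) by (cases "q \<in> Q") auto
  qed
  show "cosect P M K \<chi>"
    unfolding cosect_def
  proof (intro conjI ballI allI impI)
    fix p assume p: "p \<in> P"
    show "lin_fun (vspace M p) (\<chi> p)"
      using cosectD(1)[OF \<chi>, of p] cosectD(2)[OF \<chi> out, of p] by (cases "p \<in> Q") (auto simp: lin_fun_def)
  next
    fix p z assume "p \<notin> K" then show "\<chi> p z = 0" by (rule cosectD(2)[OF \<chi>])
  next
    fix q p z assume q: "q \<in> K" and p: "p \<in> P" "p \<le> q" and z: "z \<in> vspace M p"
    show "\<chi> q (vmap M p q z) = \<chi> p z"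
      using cosectD(3)[OF \<chi> q _ p(2) z] down[OF q _ p(2) z] cosectD(2)[OF \<chi> out] p(1) by (cases "p \<in> Q") auto
  qed
qed (rule 1)

text \<open>Extension by zero from the one-point poset \<open>{x}\<close>, which splits off the
  simple module at \<open>x\<close>. It serves for a cokernel at an upper leaf and for a kernel at a
  lower leaf.\<close>

lemma singleton_summand:
  assumes M: "is_rep P M" and x: "x \<in> P" and w: "w \<in> vspace M x" and \<phi>: "lin_fun UNIV \<phi>" "\<phi> w = 1"
    and up: "\<And>q. q \<in> P \<Longrightarrow> x \<le> q \<Longrightarrow> q \<noteq> x \<Longrightarrow> vmap M x q w = 0"
    and down: "\<And>p z. p \<in> P \<Longrightarrow> p \<le> x \<Longrightarrow> p \<noteq> x \<Longrightarrow> z \<in> vspace M p \<Longrightarrow> \<phi> (vmap M p x z) = 0"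
  shows "interval_summand P M"
proof (rule interval_summand_extend[OF M, of "{x}" "{x}" "\<lambda>p. if p = x then w else 0" "\<lambda>p z. if p = x then \<phi> z else 0"])
  show "is_interval P {x}" by (rule interval_singleton[OF x])
  show "sect {x} M {x} (\<lambda>p. if p = x then w else 0)"
    using w rep_id[OF M x w] by (simp add: sect_def)
  show "cosect {x} M {x} (\<lambda>p z. if p = x then \<phi> z else 0)"
    using lin_funD[OF \<phi>(1)] rep_id[OF M x] by (auto simp: cosect_def lin_fun_def)
qed (use x \<phi>(2) up down in auto)

lemma linear_on_inverse:
  assumes f: "linear_on V W f" and sV: "vec.subspace V" and surj: "f ` V = W"
    and kernel: "\<And>u. u \<in> V \<Longrightarrow> f u = 0 \<Longrightarrow> u = 0"
  obtains g where "linear_on W V g" "\<And>u. u \<in> V \<Longrightarrow> g (f u) = u" "\<And>u. u \<in> W \<Longrightarrow> f (g u) = u"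
proof -
  have eq: "u = w" if "u \<in> V" "w \<in> V" "f u = f w" for u w
    using kernel[OF vec.subspace_diff[OF sV that(1,2)]] linear_on_diff[OF f sV that(1,2)] that(3) by simp
  define g where "g = inv_into V f"
  have g: "g u \<in> V" "f (g u) = u" if "u \<in> W" for u
    using that surj inv_into_into[of u f V] f_inv_into_f[of u f V] unfolding g_def by auto
  have gf: "g (f u) = u" if "u \<in> V" for u
    using eq[OF g(1) that] g(2) linear_onD(1)[OF f that] by simp
  have "linear_on W V g"
    unfolding linear_on_def
  proof (intro conjI ballI allI)
    show "g ` W \<subseteq> V" using g(1) by auto
    fix u assume u: "u \<in> W"
    show "g (vscale c u) = vscale c (g u)" for c
      using gf[OF vec.subspace_scale[OF sV g(1)[OF u], of c]] linear_onD(3)[OF f g(1)[OF u], of c] g(2)[OF u] by simp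
    fix w assume w: "w \<in> W"
    show "g (u + w) = g u + g w"
      using gf[OF vec.subspace_add[OF sV g(1)[OF u] g(1)[OF w]]]
      unfolding linear_onD(2)[OF f g(1)[OF u] g(1)[OF w]] g(2)[OF u] g(2)[OF w] .
  qed
  then show thesis using that gf g(2) by blast
qed

text \<open>When the values at \<open>x\<close> and \<open>y\<close> are identified,
  \<open>x\<close> carries no further information: a summand on \<open>P\<close> is copied to
  \<open>x\<close> if its interval contains \<open>y\<close>. One formulation serves both kinds of
  leaf, with \<open>\<theta>\<close> the structure map for an upper leaf and \<open>\<eta>\<close>
  the structure map for a lower one.\<close>

lemma leaf_iso_summand:
  fixes P :: "'a::order set" and M :: "('a, 'k::field) rep"
  assumes M: "is_rep (insert x P) M" and nz: "\<not> is_zero_rep (insert x P) M"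
    and x: "leaf_above P y x \<or> leaf_below P y x" and dec: "decomposable_poset TYPE('k) P"
    and \<theta>: "linear_on (vspace M y) (vspace M x) \<theta>" and \<eta>: "linear_on (vspace M x) (vspace M y) \<eta>"
    and inv: "\<And>u. u \<in> vspace M y \<Longrightarrow> \<eta> (\<theta> u) = u" "\<And>u. u \<in> vspace M x \<Longrightarrow> \<theta> (\<eta> u) = u"
    and into: "\<And>p z. p \<in> P \<Longrightarrow> p \<le> x \<Longrightarrow> z \<in> vspace M p \<Longrightarrow> vmap M p x z = \<theta> (vmap M p y z)"
    and out: "\<And>q z. q \<in> P \<Longrightarrow> x \<le> q \<Longrightarrow> z \<in> vspace M x \<Longrightarrow> vmap M x q z = vmap M y q (\<eta> z)"
  shows "interval_summand (insert x P) M"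
proof -
  note l = leafD[OF x]
  have MP: "is_rep P M" using rep_subset[OF M] by auto
  have xQ: "x \<in> insert x P" and yQ: "y \<in> insert x P" using l(1) by auto
  have sy: "vec.subspace (vspace M y)" and sx: "vec.subspace (vspace M x)"
    using rep_subspace[OF M yQ] rep_subspace[OF M xQ] .
  have "\<exists>a\<in>P. vspace M a \<noteq> {0}"
  proof (rule ccontr)
    assume z: "\<not> ?thesis"
    then have y0: "vspace M y = {0}" using l(1) by auto
    have "u = 0" if u: "u \<in> vspace M x" for u
      using inv(2)[OF u] linear_onD(1)[OF \<eta> u] linear_on_0[OF \<theta> sy] unfolding y0 by simp
    then have "vspace M x = {0}" using vec.subspace_0[OF sx] by auto
    then show False using nz z by (auto simp: is_zero_rep_def)
  qed
  then obtain a where a: "a \<in> P" "vspace M a \<noteq> {0}" by blast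
  obtain K w \<chi> where K: "is_interval P K" and w: "sect P M K w" and \<chi>: "cosect P M K \<chi>"
    and 1: "\<And>p. p \<in> K \<Longrightarrow> \<chi> p (w p) = 1"
    using decomposable_summand[OF dec MP a] by metis
  have KP: "K \<subseteq> P" using is_intervalD(1)[OF K] .
  then have xK: "x \<notin> K" using l(2) by auto
  have wy: "w y \<in> vspace M y" by (rule sectD(1)[OF w l(1)])
  define L where "L = (if y \<in> K then insert x K else K)"
  have LP: "p \<in> K" if "p \<in> L" "p \<noteq> x" for p using that by (auto simp: L_def split: if_splits)
  have xL: "x \<in> L \<longleftrightarrow> y \<in> K" using xK by (auto simp: L_def)
  have KL: "p \<notin> K" if "p \<notin> L" for p using that by (auto simp: L_def split: if_splits)
  define w' where "w' = w(x := \<theta> (w y))"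
  define \<chi>' where "\<chi>' = \<chi>(x := (\<lambda>z. \<chi> y (\<eta> z)))"
  show ?thesis
  proof (rule interval_summandI)
    show "is_interval (insert x P) L"
      unfolding L_def using interval_extend_leaf[OF x K] interval_insert_leaf[OF x K] by simp
    show "sect (insert x P) M L w'"
      unfolding sect_def
    proof (intro conjI ballI allI impI)
      fix p assume p: "p \<in> insert x P"
      show "w' p \<in> vspace M p"
        using sectD(1)[OF w, of p] linear_onD(1)[OF \<theta> wy] p by (auto simp: w'_def)
    next
      fix p assume p: "p \<notin> L"
      show "w' p = 0"
        using p xL KL sectD(2)[OF w] linear_on_0[OF \<theta> sy] by (cases "p = x") (auto simp: w'_def)
    next
      fix p q assume p: "p \<in> L" and q: "q \<in> insert x P" "p \<le> q"
      show "vmap M p q (w' p) = w' q"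
      proof (cases "p = x")
        case px: True
        then have yK: "y \<in> K" using xL p by simp
        show ?thesis
        proof (cases "q = x")
          case True
          then show ?thesis using px rep_id[OF M xQ linear_onD(1)[OF \<theta> wy]] by (simp add: w'_def)
        next
          case False
          then have qP: "q \<in> P" "x \<le> q" using q px by auto
          have "vmap M x q (\<theta> (w y)) = w q"
            using out[OF qP linear_onD(1)[OF \<theta> wy]] inv(1)[OF wy] sectD(3)[OF w yK qP(1) l(5)[OF qP]] by simp
          then show ?thesis using px False by (simp add: w'_def)
        qed
      next
        case px: False
        have pK: "p \<in> K" using LP[OF p px] .
        then have pP: "p \<in> P" using KP by auto
        show ?thesis
        proof (cases "q = x")
          case True
          have le: "p \<le> x" using q(2) True by simp
          have "vmap M p x (w p) = \<theta> (w y)"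
            using into[OF pP le sectD(1)[OF w pP]] sectD(3)[OF w pK l(1) l(4)[OF pP le]] by simp
          then show ?thesis using True px by (simp add: w'_def)
        next
          case False
          then show ?thesis using sectD(3)[OF w pK _ q(2)] q(1) px by (simp add: w'_def)
        qed
      qed
    qed
    show "cosect (insert x P) M L \<chi>'"
      unfolding cosect_def
    proof (intro conjI ballI allI impI)
      fix p assume p: "p \<in> insert x P"
      have "lin_fun (vspace M x) (\<lambda>z. \<chi> y (\<eta> z))"
        using lin_funD[OF cosectD(1)[OF \<chi> l(1)]] linear_onD[OF \<eta>] unfolding lin_fun_def by simp
      then show "lin_fun (vspace M p) (\<chi>' p)"
        using cosectD(1)[OF \<chi>, of p] p by (cases "p = x") (simp_all add: \<chi>'_def)
    next
      fix p z assume p: "p \<notin> L"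
      show "\<chi>' p z = 0"
        using p xL KL cosectD(2)[OF \<chi>] by (cases "p = x") (auto simp: \<chi>'_def)
    next
      fix q p z assume q: "q \<in> L" and p: "p \<in> insert x P" "p \<le> q" and z: "z \<in> vspace M p"
      show "\<chi>' q (vmap M p q z) = \<chi>' p z"
      proof (cases "q = x")
        case qx: True
        then have yK: "y \<in> K" using xL q by simp
        show ?thesis
        proof (cases "p = x")
          case True
          then show ?thesis using qx rep_id[OF M xQ] z by simp
        next
          case False
          then have pP: "p \<in> P" "p \<le> x" using p qx by auto
          have py: "vmap M p y z \<in> vspace M y" by (rule rep_in[OF MP pP(1) l(1) l(4)[OF pP] z])
          have "\<chi> y (\<eta> (vmap M p x z)) = \<chi> p z"
            using into[OF pP z] inv(1)[OF py] cosectD(3)[OF \<chi> yK pP(1) l(4)[OF pP] z] by simp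
          then show ?thesis using qx False by (simp add: \<chi>'_def)
        qed
      next
        case qx: False
        have qK: "q \<in> K" using LP[OF q qx] .
        then have qP: "q \<in> P" using KP by auto
        show ?thesis
        proof (cases "p = x")
          case True
          then have xq: "x \<le> q" and zx: "z \<in> vspace M x" using p z by auto
          have "\<chi> q (vmap M x q z) = \<chi> y (\<eta> z)"
            using out[OF qP xq zx] cosectD(3)[OF \<chi> qK l(1) l(5)[OF qP xq] linear_onD(1)[OF \<eta> zx]] by simp
          then show ?thesis using True qx by (simp add: \<chi>'_def)
        next
          case False
          then have "p \<in> P" using p by auto
          then show ?thesis using cosectD(3)[OF \<chi> qK _ p(2) z] qx False by (simp add: \<chi>'_def)
        qed
      qed
    qed
    show "\<chi>' p (w' p) = 1" if "p \<in> L" for p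
      using 1[of p] 1[of y] LP[OF that] xL that inv(1)[OF wy] by (cases "p = x") (auto simp: \<chi>'_def w'_def)
  qed
qed

text \<open>The map \<open>T\<close> to the leaf fails to be surjective, or has a kernel, or is
  bijective. A vector outside the image generates a simple summand at \<open>x\<close>; a kernel
  vector \<open>u\<close> is made the generator of a summand on \<open>P\<close>, which then does
  not reach \<open>x\<close>; a bijection is handled by \<open>leaf_iso_summand\<close>.\<close>

lemma leaf_above_decomposable:
  fixes P :: "'a::order set"
  assumes fin: "finite P" and x: "leaf_above P y x" and dec: "decomposable_poset TYPE('k::field) P"
    and total: "\<And>I J. is_interval P I \<Longrightarrow> is_interval P J \<Longrightarrow> y \<in> I \<Longrightarrow> y \<in> J \<Longrightarrow> hom_le y I J \<or> hom_le y J I"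
  shows "decomposable_poset TYPE('k) (insert x P)"
proof (rule decomposable_by_summands)
  show "finite (insert x P)" using fin by simp
  fix M :: "('a, 'k) rep" assume M: "is_rep (insert x P) M" and nz: "\<not> is_zero_rep (insert x P) M"
  note l = leaf_aboveD[OF x]
  have MP: "is_rep P M" using rep_subset[OF M] by auto
  have xQ: "x \<in> insert x P" and yQ: "y \<in> insert x P" using l(1) by auto
  define T where "T = vmap M y x"
  have T: "linear_on (vspace M y) (vspace M x) T" unfolding T_def by (rule rep_linear[OF M yQ xQ l(3)])
  have sy: "vec.subspace (vspace M y)" using rep_subspace[OF M yQ] .
  have factor: "vmap M p x w = T (vmap M p y w)" "vmap M p y w \<in> vspace M y"
    if "p \<in> P" "p \<le> x" "w \<in> vspace M p" for p w
    using rep_comp[OF M _ yQ xQ l(5)[OF that(1,2)] l(3) that(3)] rep_in[OF M _ yQ l(5)[OF that(1,2)] that(3)] that(1)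
    unfolding T_def by auto
  show "interval_summand (insert x P) M"
  proof (cases "T ` vspace M y = vspace M x")
    case False
    then obtain w where w: "w \<in> vspace M x" "w \<notin> T ` vspace M y" using linear_onD(1)[OF T] by auto
    obtain \<phi> where \<phi>: "lin_fun UNIV \<phi>" "\<And>s. s \<in> T ` vspace M y \<Longrightarrow> \<phi> s = 0" "\<phi> w = 1"
      using exists_functional[OF subspace_image[OF T sy] w(2)] by metis
    show ?thesis
    proof (rule singleton_summand[OF M xQ w(1) \<phi>(1,3)])
      show "vmap M x q w = 0" if "q \<in> insert x P" "x \<le> q" "q \<noteq> x" for q using l(4)[of q] that by auto
      show "\<phi> (vmap M p x z) = 0" if "p \<in> insert x P" "p \<le> x" "p \<noteq> x" "z \<in> vspace M p" for p z
        using \<phi>(2) factor[of p z] that by simp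
    qed
  next
    case surj: True
    show ?thesis
    proof (cases "\<exists>u\<in>vspace M y. u \<noteq> 0 \<and> T u = 0")
      case True
      then obtain u where u: "u \<in> vspace M y" "u \<noteq> 0" "T u = 0" by blast
      obtain n I v \<phi> where D: "interval_decomp P M n I v \<phi>" using decomposable_posetD[OF dec MP] .
      obtain K w \<chi> where K: "is_interval P K" and w: "sect P M K w" and \<chi>: "cosect P M K \<chi>"
        and 1: "\<forall>p\<in>K. \<chi> p (w p) = 1" and wy: "y \<in> K" "w y = u"
        by (rule kernel_decomp_summand[OF MP D l(1) u(1,2) total])
      have KP: "K \<subseteq> P" using is_intervalD(1)[OF K] .
      show ?thesis
      proof (rule interval_summand_extend[OF M _ interval_insert_leaf[OF disjI1[OF x] K] KP w \<chi>])
        \<comment> \<open>The image of \<open>w p\<close> at \<open>x\<close> passes through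
          \<open>w y = u\<close>, which \<open>T\<close> kills.\<close>
        fix p q assume p: "p \<in> K" and q: "q \<in> insert x P - P" "p \<le> q"
        then have pP: "p \<in> P" "p \<le> x" and qx: "q = x" using KP by auto
        have "vmap M p y (w p) = u" using sectD(3)[OF w p l(1) l(5)[OF pP]] wy(2) by simp
        then show "vmap M p q (w p) = 0" using factor(1)[OF pP sectD(1)[OF w pP(1)]] u(3) qx by simp
      next
        fix p q z assume "q \<in> K" "p \<in> insert x P - P" "p \<le> q"
        then show "\<chi> q (vmap M p q z) = 0" using l(4)[of q] KP by auto
      qed (use 1 in auto)
    next
      case False
      obtain \<eta> where "linear_on (vspace M x) (vspace M y) \<eta>" "\<And>u. u \<in> vspace M y \<Longrightarrow> \<eta> (T u) = u"
          "\<And>u. u \<in> vspace M x \<Longrightarrow> T (\<eta> u) = u"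
        using linear_on_inverse[OF T sy surj] False by metis
      then show ?thesis
        by (rule leaf_iso_summand[OF M nz disjI1[OF x] dec T]) (use factor(1) l(4) in auto)
    qed
  qed
qed

text \<open>Dual to \<open>leaf_above_decomposable\<close>. Here a kernel vector of \<open>T\<close>
  gives a simple summand at \<open>x\<close>, while a functional at \<open>y\<close> that vanishes
  on the image of \<open>T\<close> is made the cosection of a summand, which therefore sees nothing
  that comes from \<open>x\<close>.\<close>

lemma leaf_below_decomposable:
  fixes P :: "'a::order set"
  assumes fin: "finite P" and x: "leaf_below P y x" and dec: "decomposable_poset TYPE('k::field) P"
    and total: "\<And>I J. is_interval P I \<Longrightarrow> is_interval P J \<Longrightarrow> y \<in> I \<Longrightarrow> y \<in> J \<Longrightarrow> hom_le y I J \<or> hom_le y J I"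
  shows "decomposable_poset TYPE('k) (insert x P)"
proof (rule decomposable_by_summands)
  show "finite (insert x P)" using fin by simp
  fix M :: "('a, 'k) rep" assume M: "is_rep (insert x P) M" and nz: "\<not> is_zero_rep (insert x P) M"
  note l = leaf_belowD[OF x]
  have MP: "is_rep P M" using rep_subset[OF M] by auto
  have xQ: "x \<in> insert x P" and yQ: "y \<in> insert x P" using l(1) by auto
  define T where "T = vmap M x y"
  have T: "linear_on (vspace M x) (vspace M y) T" unfolding T_def by (rule rep_linear[OF M xQ yQ l(3)])
  have sx: "vec.subspace (vspace M x)" using rep_subspace[OF M xQ] .
  have factor: "vmap M x q w = vmap M y q (T w)"
    if "q \<in> P" "x \<le> q" "w \<in> vspace M x" for q w
    using rep_comp[OF M xQ yQ _ l(3) l(5)[OF that(1,2)] that(3)] that(1)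
    unfolding T_def by auto
  show "interval_summand (insert x P) M"
  proof (cases "\<exists>u\<in>vspace M x. u \<noteq> 0 \<and> T u = 0")
    case True
    then obtain w where w: "w \<in> vspace M x" "w \<noteq> 0" "T w = 0" by blast
    obtain \<phi> where \<phi>: "lin_fun UNIV \<phi>" "\<phi> w = 1"
      using exists_functional[OF vec.subspace_single_0, of w] w(2) by (metis singletonD)
    show ?thesis
    proof (rule singleton_summand[OF M xQ w(1) \<phi>])
      show "vmap M x q w = 0" if "q \<in> insert x P" "x \<le> q" "q \<noteq> x" for q
        using factor[OF _ that(2) w(1)] rep_0[OF M yQ that(1)] l(5)[of q] w(3) that by auto
      show "\<phi> (vmap M p x z) = 0" if "p \<in> insert x P" "p \<le> x" "p \<noteq> x" for p z using l(4)[of p] that by auto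
    qed
  next
    case kernel: False
    show ?thesis
    proof (cases "T ` vspace M x = vspace M y")
      case False
      then obtain u where u: "u \<in> vspace M y" "u \<notin> T ` vspace M x" using linear_onD(1)[OF T] by auto
      obtain \<psi> where \<psi>: "lin_fun UNIV \<psi>" "\<And>s. s \<in> T ` vspace M x \<Longrightarrow> \<psi> s = 0" "\<psi> u = 1"
        using exists_functional[OF subspace_image[OF T sx] u(2)] by metis
      have \<psi>y: "lin_fun (vspace M y) \<psi>" by (rule lin_fun_subset[OF \<psi>(1)]) simp
      have \<psi>u: "\<psi> u \<noteq> 0" using \<psi>(3) by simp
      obtain n I v \<phi> where D: "interval_decomp P M n I v \<phi>" using decomposable_posetD[OF dec MP] .
      obtain K w \<chi> where K: "is_interval P K" and w: "sect P M K w" and \<chi>: "cosect P M K \<chi>"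
        and 1: "\<forall>p\<in>K. \<chi> p (w p) = 1" and yK: "y \<in> K" and \<chi>y: "\<forall>z\<in>vspace M y. \<chi> y z = \<psi> z"
        by (rule image_decomp_summand[OF MP D l(1) \<psi>y u(1) \<psi>u total])
      have KP: "K \<subseteq> P" using is_intervalD(1)[OF K] .
      show ?thesis
      proof (rule interval_summand_extend[OF M _ interval_insert_leaf[OF disjI2[OF x] K] KP w \<chi>])
        fix p q assume "p \<in> K" "q \<in> insert x P - P" "p \<le> q"
        then show "vmap M p q (w p) = 0" using l(4)[of p] KP by auto
      next
        fix p q z assume q: "q \<in> K" and p: "p \<in> insert x P - P" "p \<le> q" and z: "z \<in> vspace M p"
        then have qP: "q \<in> P" "x \<le> q" and px: "p = x" and zx: "z \<in> vspace M x" using KP by auto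
        have "\<chi> q (vmap M x q z) = \<chi> y (T z)"
          using factor[OF qP zx] cosectD(3)[OF \<chi> q l(1) l(5)[OF qP] linear_onD(1)[OF T zx]] by simp
        also have "\<dots> = 0" using \<chi>y linear_onD(1)[OF T zx] \<psi>(2) zx by simp
        finally show "\<chi> q (vmap M p q z) = 0" using px by simp
      qed (use 1 in auto)
    next
      case surj: True
      obtain \<theta> where \<theta>: "linear_on (vspace M y) (vspace M x) \<theta>" "\<And>u. u \<in> vspace M x \<Longrightarrow> \<theta> (T u) = u"
          "\<And>u. u \<in> vspace M y \<Longrightarrow> T (\<theta> u) = u"
        using linear_on_inverse[OF T sx surj] kernel by metis
      show ?thesis
        by (rule leaf_iso_summand[OF M nz disjI2[OF x] dec \<theta>(1) T \<theta>(3) \<theta>(2)]) (use factor l(4) in auto)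
    qed
  qed
qed

lemma decomposable_singleton: "decomposable_poset TYPE('k::field) {y :: 'a::order}"
proof (rule decomposable_by_summands)
  fix M :: "('a, 'k) rep" assume M: "is_rep {y} M" and nz: "\<not> is_zero_rep {y} M"
  have "0 \<in> vspace M y" using vec.subspace_0[OF rep_subspace[OF M]] by simp
  then obtain w where w: "w \<in> vspace M y" "w \<noteq> 0" using nz by (auto simp: is_zero_rep_def)
  obtain \<phi> where \<phi>: "lin_fun UNIV \<phi>" "\<phi> w = 1"
    using exists_functional[OF vec.subspace_single_0, of w] w(2) by (metis singletonD)
  show "interval_summand {y} M"
    by (rule singleton_summand[OF M _ w(1) \<phi>]) auto
qed simp

lemma zigzag_decomposable: "zigzag_poset P y \<Longrightarrow> decomposable_poset TYPE('k::field) P"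
proof (induction rule: zigzag_poset.induct)
  case (single y)
  show ?case by (rule decomposable_singleton)
next
  case (above P y x)
  show ?case by (rule leaf_above_decomposable[OF zigzag_finite[OF above.hyps(1)] above.hyps(2) above.IH zigzag_total[OF above.hyps(1)]])
next
  case (below P y x)
  show ?case by (rule leaf_below_decomposable[OF zigzag_finite[OF below.hyps(1)] below.hyps(2) below.IH zigzag_total[OF below.hyps(1)]])
qed

section \<open>Bounded posets and components\<close>

text \<open>If the map from bottom to top is nonzero, then \<open>k\<^sub>P\<close> splits off, since it is projective and
  injective.  Otherwise no interval summand of the restriction to \<open>P - {t}\<close> that contains \<open>b\<close>
  contributes to the value at \<open>t\<close>.\<close>

lemma bounded_decomposable:
  fixes P :: "'a::order set"
  assumes fin: "finite P" and b: "b \<in> P" "\<And>p. p \<in> P \<Longrightarrow> b \<le> p" and t: "t \<in> P" "\<And>p. p \<in> P \<Longrightarrow> p \<le> t" and "b \<noteq> t"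
    and decb: "decomposable_poset TYPE('k::field) (P - {b})" and dect: "decomposable_poset TYPE('k) (P - {t})"
  shows "decomposable_poset TYPE('k) P"
proof (rule decomposable_by_summands[OF fin])
  fix M :: "('a, 'k) rep" assume M: "is_rep P M" and nz: "\<not> is_zero_rep P M"
  show "interval_summand P M"
  proof (cases "\<exists>u\<in>vspace M b. vmap M b t u \<noteq> 0")
    case True
    then obtain u where u: "u \<in> vspace M b" "vmap M b t u \<noteq> 0" by blast
    have "vec.subspace {0}" by (rule vec.subspace_single_0)
    then obtain \<chi> where \<chi>: "lin_fun UNIV \<chi>" "\<chi> (vmap M b t u) = 1"
      using exists_functional[of "{0}" "vmap M b t u"] u(2) by (metis singletonD)
    have ub: "vmap M b p u \<in> vspace M p" if "p \<in> P" for p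
      using rep_in[OF M b(1) that b(2)[OF that] u(1)] .
    show ?thesis
    proof (rule interval_summandI[of _ P _ "\<lambda>p. if p \<in> P then vmap M b p u else 0" "\<lambda>p z. if p \<in> P then \<chi> (vmap M p t z) else 0"])
      have "connected_poset P"
        unfolding connected_poset_def
      proof (intro ballI)
        fix p q assume pq: "p \<in> P" "q \<in> P"
        let ?R = "{(u, v). u \<in> P \<and> v \<in> P \<and> (u \<le> v \<or> v \<le> u)}"
        have "(p, b) \<in> ?R" "(b, q) \<in> ?R" using pq b by auto
        then show "(p, q) \<in> ?R\<^sup>*" by (meson r_into_rtrancl rtrancl_trans)
      qed
      then show "is_interval P P" using b(1) by (intro is_intervalI) auto
      show "sect P M P (\<lambda>p. if p \<in> P then vmap M b p u else 0)"
        unfolding sect_def using ub rep_comp[OF M b(1) _ _ b(2) _ u(1)] by simp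
      show "cosect P M P (\<lambda>p z. if p \<in> P then \<chi> (vmap M p t z) else 0)"
        unfolding cosect_def
      proof (intro conjI ballI allI impI)
        fix p assume p: "p \<in> P"
        show "lin_fun (vspace M p) (\<lambda>z. if p \<in> P then \<chi> (vmap M p t z) else 0)"
          using lin_funD[OF \<chi>(1)] linear_onD(2,3)[OF rep_linear[OF M p t(1) t(2)[OF p]]] p
          by (simp add: lin_fun_def)
      next
        fix q p z assume "q \<in> P" "p \<in> P" "p \<le> q" "z \<in> vspace M p"
        then show "(if q \<in> P then \<chi> (vmap M q t (vmap M p q z)) else 0) = (if p \<in> P then \<chi> (vmap M p t z) else 0)"
          using rep_comp[OF M _ _ t(1) _ t(2)] by simp
      qed simp
      show "(if p \<in> P then \<chi> (vmap M p t (if p \<in> P then vmap M b p u else 0)) else 0) = 1" if "p \<in> P" for p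
        using that \<chi>(2) rep_comp[OF M b(1) that t(1) b(2)[OF that] t(2)[OF that] u(1)] by simp
    qed
  next
    case False
    then have zero: "vmap M b t u = 0" if "u \<in> vspace M b" for u using that by blast
    show ?thesis
    proof (cases "vspace M b = {0}")
      case False
      have MQ: "is_rep (P - {t}) M" using rep_subset[OF M] by auto
      have bQ: "b \<in> P - {t}" using b(1) \<open>b \<noteq> t\<close> by simp
      obtain K w \<chi> where K: "is_interval (P - {t}) K" and w: "sect (P - {t}) M K w"
        and \<chi>: "cosect (P - {t}) M K \<chi>" and 1: "\<And>p. p \<in> K \<Longrightarrow> \<chi> p (w p) = 1" and bK: "b \<in> K"
        using decomposable_summand[OF dect MQ bQ False] by metis
      have KP: "K \<subseteq> P - {t}" using is_intervalD(1)[OF K] .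
      have above_t: "p = t" if "p \<in> P" "t \<le> p" for p using that t(2)[OF that(1)] by simp
      show ?thesis
      proof (rule interval_summand_extend[OF M _ convex_interval_superset[OF K] KP w \<chi>])
        show "\<chi> p (w p) = 1" if "p \<in> K" for p by (rule 1[OF that])
        fix p q assume p: "p \<in> K" and q: "q \<in> P - (P - {t})" "p \<le> q"
        have pP: "p \<in> P" "p \<in> P - {t}" using p KP by auto
        have wb: "w b \<in> vspace M b" by (rule sectD(1)[OF w bQ])
        have "vmap M b p (w b) = w p" by (rule sectD(3)[OF w bK pP(2) b(2)[OF pP(1)]])
        then have "vmap M p t (w p) = vmap M b t (w b)"
          using rep_comp[OF M b(1) pP(1) t(1) b(2)[OF pP(1)] t(2)[OF pP(1)] wb] by simp
        then show "vmap M p q (w p) = 0" using q zero[OF wb] by auto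
      next
        fix p q z assume "q \<in> K" "p \<in> P - (P - {t})" "p \<le> q"
        then show "\<chi> q (vmap M p q z) = 0" using above_t[of q] KP by auto
      qed (use above_t in \<open>auto dest: less_imp_le\<close>)
    next
      \<comment> \<open>With value 0 at \<open>b\<close> every map out of \<open>b\<close> is zero,
        so a summand over \<open>P - {b}\<close> extends by zero.\<close>
      case True
      have MQ: "is_rep (P - {b}) M" using rep_subset[OF M] by auto
      obtain a where a: "a \<in> P - {b}" "vspace M a \<noteq> {0}" using nz True by (auto simp: is_zero_rep_def)
      obtain K w \<chi> where K: "is_interval (P - {b}) K" and w: "sect (P - {b}) M K w"
        and \<chi>: "cosect (P - {b}) M K \<chi>" and 1: "\<And>p. p \<in> K \<Longrightarrow> \<chi> p (w p) = 1"
        using decomposable_summand[OF decb MQ a] by metis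
      have KP: "K \<subseteq> P - {b}" using is_intervalD(1)[OF K] .
      have below_b: "p = b" if "p \<in> P" "p \<le> b" for p using that b(2)[OF that(1)] by simp
      show ?thesis
      proof (rule interval_summand_extend[OF M _ convex_interval_superset[OF K] KP w \<chi>])
        show "\<chi> p (w p) = 1" if "p \<in> K" for p by (rule 1[OF that])
        fix p q assume "p \<in> K" "q \<in> P - (P - {b})" "p \<le> q"
        then show "vmap M p q (w p) = 0" using below_b[of p] KP by auto
      next
        fix p q z assume q: "q \<in> K" and p: "p \<in> P - (P - {b})" "p \<le> q" and z: "z \<in> vspace M p"
        have qP: "q \<in> P" "q \<in> P - {b}" using q KP by auto
        have "vmap M p q z = 0" using z p True rep_0[OF M _ qP(1) p(2)] by auto
        then show "\<chi> q (vmap M p q z) = 0"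
          using lin_fun_0[OF cosectD(1)[OF \<chi> qP(2)] rep_subspace[OF M qP(1)]] by simp
      qed (use below_b in \<open>auto dest: less_imp_le\<close>)
    qed
  qed
qed

text \<open>No element of \<open>C\<close> is comparable with one outside, so the conditions of
  \<open>interval_summand_extend\<close> hold vacuously.\<close>

lemma components_decomposable:
  fixes P :: "'a::order set"
  assumes fin: "finite P"
    and comp: "\<And>a. a \<in> P \<Longrightarrow> \<exists>C\<subseteq>P. a \<in> C \<and> decomposable_poset TYPE('k::field) C \<and>
      (\<forall>p\<in>C. \<forall>q\<in>P. p \<le> q \<or> q \<le> p \<longrightarrow> q \<in> C)"
  shows "decomposable_poset TYPE('k) P"
proof (rule decomposable_by_summands[OF fin])
  fix M :: "('a, 'k) rep" assume M: "is_rep P M" and nz: "\<not> is_zero_rep P M"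
  obtain a where a: "a \<in> P" "vspace M a \<noteq> {0}" using nz by (auto simp: is_zero_rep_def)
  obtain C where C: "C \<subseteq> P" "a \<in> C" "decomposable_poset TYPE('k) C"
    and cl: "\<forall>p\<in>C. \<forall>q\<in>P. p \<le> q \<or> q \<le> p \<longrightarrow> q \<in> C"
    using comp[OF a(1)] by (elim exE conjE)
  have cl: "q \<in> C" if "p \<in> C" "q \<in> P" "p \<le> q \<or> q \<le> p" for p q
    using cl[rule_format, OF that] .
  have MC: "is_rep C M" by (rule rep_subset[OF M C(1)])
  obtain K w \<chi> where K: "is_interval C K" and w: "sect C M K w"
    and \<chi>: "cosect C M K \<chi>" and 1: "\<And>p. p \<in> K \<Longrightarrow> \<chi> p (w p) = 1"
    using decomposable_summand[OF C(3) MC C(2) a(2)] by metis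
  have KC: "K \<subseteq> C" using is_intervalD(1)[OF K] .
  show "interval_summand P M"
  proof (rule interval_summand_extend[OF M C(1) convex_interval_superset[OF K C(1)] KC w \<chi>])
        show "\<chi> p (w p) = 1" if "p \<in> K" for p by (rule 1[OF that])
    show "z \<in> C" if "p \<in> C" "q \<in> C" "z \<in> P" "p < z" "z < q" for p q z
      using cl[OF that(1,3)] less_imp_le[OF that(4)] by simp
    fix p q assume "p \<in> K" "q \<in> P - C" "p \<le> q"
    then show "vmap M p q (w p) = 0" using cl[of p q] KC by auto
  next
    fix p q z assume "q \<in> K" "p \<in> P - C" "p \<le> q"
    then show "\<chi> q (vmap M p q z) = 0" using cl[of q p] KC by auto
  qed
qed

section \<open>Hasse diagrams and order\<close>

lemma in_hasse: "(x, y) \<in> snd (hasse P) \<longleftrightarrow> x \<in> P \<and> y \<in> P \<and> x < y \<and> (\<forall>z\<in>P. \<not> (x < z \<and> z < y))"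
  by (auto simp: hasse_def)

lemma fst_hasse [simp]: "fst (hasse P) = P"
  by (simp add: hasse_def)

text \<open>Induction on the number of elements above \<open>p\<close> and up to \<open>q\<close>: a
  minimal one among them covers \<open>p\<close>.\<close>

lemma le_imp_hasse_path:
  assumes "finite P" "p \<in> P" "q \<in> P" "p \<le> q"
  shows "(p, q) \<in> (snd (hasse P))\<^sup>*"
  using assms(2,4)
proof (induction "card {z\<in>P. p < z \<and> z \<le> q}" arbitrary: p rule: less_induct)
  case (less p)
  show ?case
  proof (cases "p = q")
    case False
    then have "p < q" using less.prems by simp
    let ?S = "{z\<in>P. p < z \<and> z \<le> q}"
    have "finite ?S" "?S \<noteq> {}" using assms(1,3) \<open>p < q\<close> by auto
    then obtain z where z: "z \<in> ?S" "\<forall>u\<in>?S. u \<le> z \<longrightarrow> z = u" using finite_has_minimal[of ?S] by metis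
    have e: "(p, z) \<in> snd (hasse P)"
      unfolding in_hasse
    proof (intro conjI ballI notI)
      fix u assume u: "u \<in> P" "p < u \<and> u < z"
      then have "u \<in> ?S" using z(1) by auto
      then show False using z(2) u by auto
    qed (use z(1) less.prems in auto)
    have "{u\<in>P. z < u \<and> u \<le> q} \<subset> ?S" using z(1) by auto
    then have "card {u\<in>P. z < u \<and> u \<le> q} < card ?S" using \<open>finite ?S\<close> psubset_card_mono by blast
    then have "(z, q) \<in> (snd (hasse P))\<^sup>*" using less.hyps z(1) by simp
    then show ?thesis using e by (rule converse_rtrancl_into_rtrancl[rotated])
  qed simp
qed

lemma hasse_path_imp_le: "(p, q) \<in> (snd (hasse P))\<^sup>* \<Longrightarrow> p \<le> q"
proof (induction rule: rtrancl_induct)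
  case (step y z)
  then have "y < z" by (simp add: in_hasse less_imp_le)
  then show ?case using step.IH by simp
qed simp

text \<open>A discrete intermediate value argument: a property that holds at \<open>p\<close> and
  fails at \<open>q\<close> is lost on some arrow of a saturated chain. By this, knowledge of the
  arrows alone controls the order.\<close>

lemma hasse_crossing:
  assumes "finite P" "p \<in> P" "q \<in> P" "p \<le> q" "Q p" "\<not> Q q"
  obtains u v where "(u, v) \<in> snd (hasse P)" "Q u" "\<not> Q v" "p \<le> u" "v \<le> q"
proof -
  have "\<exists>u v. (u, v) \<in> snd (hasse P) \<and> Q u \<and> \<not> Q v \<and> p \<le> u \<and> v \<le> q"
    using le_imp_hasse_path[OF assms(1-4)] assms(6)
  proof (induction rule: rtrancl_induct)
    case (step y z)
    have yz: "y \<le> z" using step.hyps(2) by (simp add: in_hasse less_imp_le)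
    have py: "p \<le> y" by (rule hasse_path_imp_le[OF step.hyps(1)])
    show ?case
    proof (cases "Q y")
      case True
      then show ?thesis using step.hyps(2) step.prems py by blast
    next
      case False
      then show ?thesis using step.IH yz order_trans by blast
    qed
  qed (use assms(5) in simp)
  then show thesis using that by blast
qed

definition hasse_adj :: "'a::order set \<Rightarrow> ('a \<times> 'a) set" where
  "hasse_adj P = snd (hasse P) \<union> (snd (hasse P))\<inverse>"

lemma sym_hasse_adj: "sym (hasse_adj P)"
  by (auto simp: hasse_adj_def sym_def)

text \<open>Closure under comparability is taken within \<open>P\<close>, but connectedness refers
  to the diagram of \<open>C\<close> itself, so that a component can be treated as a poset on its
  own.\<close>

definition hasse_component :: "'a::order set \<Rightarrow> 'a set \<Rightarrow> bool" where
  "hasse_component P C \<longleftrightarrow> C \<subseteq> P \<and> C \<noteq> {} \<and> (\<forall>p\<in>C. \<forall>q\<in>P. p \<le> q \<or> q \<le> p \<longrightarrow> q \<in> C)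
     \<and> (\<forall>p\<in>C. \<forall>q\<in>C. (p, q) \<in> (hasse_adj C)\<^sup>*)"

lemma hasse_componentD:
  assumes "hasse_component P C"
  shows "C \<subseteq> P" "C \<noteq> {}" "p \<in> C \<Longrightarrow> q \<in> P \<Longrightarrow> p \<le> q \<or> q \<le> p \<Longrightarrow> q \<in> C"
    "p \<in> C \<Longrightarrow> q \<in> C \<Longrightarrow> (p, q) \<in> (hasse_adj C)\<^sup>*"
proof -
  note h = assms[unfolded hasse_component_def]
  show "C \<subseteq> P" by (rule h[THEN conjunct1])
  show "C \<noteq> {}" by (rule h[THEN conjunct2, THEN conjunct1])
  show "p \<in> C \<Longrightarrow> q \<in> P \<Longrightarrow> p \<le> q \<or> q \<le> p \<Longrightarrow> q \<in> C"
    by (rule h[THEN conjunct2, THEN conjunct2, THEN conjunct1, rule_format])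
  show "p \<in> C \<Longrightarrow> q \<in> C \<Longrightarrow> (p, q) \<in> (hasse_adj C)\<^sup>*"
    by (rule h[THEN conjunct2, THEN conjunct2, THEN conjunct2, rule_format])
qed

text \<open>Closure under comparability keeps everything between two elements of \<open>C\<close>
  inside \<open>C\<close>; therefore covers in \<open>P\<close> and in \<open>C\<close>
  agree.\<close>

lemma hasse_component_class:
  fixes P :: "'a::order set"
  assumes fin: "finite P" and a: "a \<in> P"
  defines "C \<equiv> ((hasse_adj P)\<^sup>* \<inter> P \<times> P) `` {a}"
  shows "a \<in> C" "hasse_component P C" "(C, snd (hasse P) \<inter> C \<times> C) = hasse C"
proof -
  have C: "q \<in> C \<longleftrightarrow> q \<in> P \<and> (a, q) \<in> (hasse_adj P)\<^sup>*" for q using a by (auto simp: C_def)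
  show aC: "a \<in> C" using a C by simp
  have CP: "C \<subseteq> P" using C by auto
  have sub: "(snd (hasse P))\<^sup>* \<subseteq> (hasse_adj P)\<^sup>*" by (rule rtrancl_mono) (auto simp: hasse_adj_def)
  have symr: "(q, p) \<in> (hasse_adj P)\<^sup>*" if "(p, q) \<in> (hasse_adj P)\<^sup>*" for p q
    using sym_rtrancl[OF sym_hasse_adj] that by (rule symD)
  have cl: "q \<in> C" if "p \<in> C" "q \<in> P" "p \<le> q \<or> q \<le> p" for p q
  proof -
    have pP: "p \<in> P" "(a, p) \<in> (hasse_adj P)\<^sup>*" using that(1) C by auto
    have "(p, q) \<in> (hasse_adj P)\<^sup>*"
      using that(3)
    proof
      assume "p \<le> q" then show ?thesis using le_imp_hasse_path[OF fin pP(1) that(2)] sub by auto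
    next
      assume "q \<le> p" then show ?thesis using le_imp_hasse_path[OF fin that(2) pP(1)] sub symr by auto
    qed
    then show ?thesis using pP(2) that(2) C by (auto intro: rtrancl_trans)
  qed
  have snd_eq: "snd (hasse P) \<inter> C \<times> C = snd (hasse C)"
  proof (rule set_eqI, clarify)
    fix p q
    have "z \<in> C" if "p \<in> C" "z \<in> P" "p < z" for z by (rule cl[OF that(1,2) disjI1[OF less_imp_le[OF that(3)]]])
    then show "(p, q) \<in> snd (hasse P) \<inter> C \<times> C \<longleftrightarrow> (p, q) \<in> snd (hasse C)"
      unfolding Int_iff in_hasse mem_Times_iff fst_conv snd_conv using CP by blast
  qed
  show "(C, snd (hasse P) \<inter> C \<times> C) = hasse C" unfolding snd_eq by (simp add: prod_eq_iff)
  have adj_in: "q \<in> C \<and> (p, q) \<in> hasse_adj C" if "p \<in> C" "(p, q) \<in> hasse_adj P" for p q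
  proof -
    have "q \<in> P \<and> (p \<le> q \<or> q \<le> p)" using that(2) by (auto simp: hasse_adj_def in_hasse)
    then have "q \<in> C" using cl[OF that(1)] by simp
    then show ?thesis using that snd_eq by (auto simp: hasse_adj_def)
  qed
  have from_a: "q \<in> C \<and> (a, q) \<in> (hasse_adj C)\<^sup>*" if "(a, q) \<in> (hasse_adj P)\<^sup>*" for q
    using that
  proof (induction rule: rtrancl_induct)
    case (step y z)
    then show ?case using adj_in[of y z] by (auto intro: rtrancl_into_rtrancl)
  qed (use aC in simp)
  have "(p, q) \<in> (hasse_adj C)\<^sup>*" if "p \<in> C" "q \<in> C" for p q
  proof -
    have "(a, p) \<in> (hasse_adj C)\<^sup>*" "(a, q) \<in> (hasse_adj C)\<^sup>*" using from_a that C by auto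
    then show ?thesis using symD[OF sym_rtrancl[OF sym_hasse_adj]] by (meson rtrancl_trans)
  qed
  then show "hasse_component P C"
    unfolding hasse_component_def using CP aC by (intro conjI ballI impI) (auto intro: cl)
qed

lemma quiver_components_hasse:
  assumes "finite P"
  shows "quiver_components (hasse P) = hasse ` {C. \<exists>a\<in>P. C = ((hasse_adj P)\<^sup>* \<inter> P \<times> P) `` {a}}"
  unfolding quiver_components_def quotient_def fst_hasse hasse_adj_def[symmetric]
  using hasse_component_class(3)[OF assms] by (auto simp: image_iff)

section \<open>Decomposability for the two kinds of diagrams\<close>

lemma zigzag_image:
  fixes g :: "'b::order \<Rightarrow> 'a::order"
  assumes "zigzag_poset P y" "\<And>p q. p \<in> P \<Longrightarrow> q \<in> P \<Longrightarrow> g p \<le> g q \<longleftrightarrow> p \<le> q"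
  shows "zigzag_poset (g ` P) (g y)"
  using assms
proof (induction rule: zigzag_poset.induct)
  case (single y)
  then show ?case using zigzag_poset.single by simp
next
  case (above P y x)
  note l = leaf_aboveD[OF above.hyps(2)]
  have "zigzag_poset (g ` P) (g y)" by (rule above.IH) (use above.prems in simp)
  moreover have "leaf_above (g ` P) (g y) (g x)"
    unfolding leaf_above_def
  proof (intro conjI ballI)
    show "g x \<notin> g ` P"
    proof
      assume "g x \<in> g ` P"
      then obtain p where p: "p \<in> P" "g x = g p" by (rule imageE)
      then have "x \<le> p" using above.prems[of x p] by simp
      then show False using l(4) p by simp
    qed
    fix r assume "r \<in> g ` P"
    then obtain p where p: "p \<in> P" "r = g p" by blast
    show "\<not> g x \<le> r" using p above.prems[of x p] l(4) by simp
    show "r \<le> g x \<longleftrightarrow> r \<le> g y"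
      using p above.prems[of p x] above.prems[of p y] l(1) above.hyps(2) by (simp add: leaf_above_def)
  qed (use l(1) in simp)
  ultimately show ?case using zigzag_poset.above by (simp add: image_insert)
next
  case (below P y x)
  note l = leaf_belowD[OF below.hyps(2)]
  have "zigzag_poset (g ` P) (g y)" by (rule below.IH) (use below.prems in simp)
  moreover have "leaf_below (g ` P) (g y) (g x)"
    unfolding leaf_below_def
  proof (intro conjI ballI)
    show "g x \<notin> g ` P"
    proof
      assume "g x \<in> g ` P"
      then obtain p where p: "p \<in> P" "g x = g p" by (rule imageE)
      then have "p \<le> x" using below.prems[of p x] by simp
      then show False using l(4) p by simp
    qed
    fix r assume "r \<in> g ` P"
    then obtain p where p: "p \<in> P" "r = g p" by blast
    show "\<not> r \<le> g x" using p below.prems[of p x] l(4) by simp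
    show "g x \<le> r \<longleftrightarrow> g y \<le> r"
      using p below.prems[of x p] below.prems[of y p] l(1) below.hyps(2) by (simp add: leaf_below_def)
  qed (use l(1) in simp)
  ultimately show ?case using zigzag_poset.below by (simp add: image_insert)
qed

lemma quiver_iso_sym:
  assumes "quiver_iso Q R"
  shows "quiver_iso R Q"
proof -
  obtain f where f: "bij_betw f (fst Q) (fst R)" "\<forall>x\<in>fst Q. \<forall>y\<in>fst Q. (x, y) \<in> snd Q \<longleftrightarrow> (f x, f y) \<in> snd R"
    using assms unfolding quiver_iso_def by blast
  let ?g = "inv_into (fst Q) f"
  have g: "?g x \<in> fst Q" "f (?g x) = x" if "x \<in> fst R" for x
    using f(1) that bij_betwE[OF bij_betw_inv_into[OF f(1)]] bij_betw_inv_into_right[OF f(1)] by auto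
  show ?thesis
    unfolding quiver_iso_def using bij_betw_inv_into[OF f(1)] f(2) g by (intro exI[of _ ?g]) auto
qed

text \<open>The vertices are attached in the order of their numbers. A relation across the cut
  between \<open>i\<close> and \<open>i + 1\<close> must use an arrow across it, and the only such
  arrow joins these two vertices, so \<open>x (i + 1)\<close> is a leaf at
  \<open>x i\<close>.\<close>

lemma A_quiver_decomposable:
  fixes C :: "'a::order set"
  assumes fin: "finite C" and ne: "C \<noteq> {}" and iso: "quiver_iso (hasse C) (A_quiver n a)"
  shows "decomposable_poset TYPE('k::field) C"
proof -
  obtain f where f: "bij_betw f C {1..n}"
    and e: "\<And>x y. x \<in> C \<Longrightarrow> y \<in> C \<Longrightarrow> (x, y) \<in> snd (hasse C) \<longleftrightarrow> (f x, f y) \<in> snd (A_quiver n a)"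
    using iso unfolding quiver_iso_def by (auto simp: A_quiver_def)
  \<comment> \<open>Nonemptiness excludes \<open>n = 0\<close>, and the zigzag can start at
    \<open>x 1\<close>.\<close>
  have n: "n \<ge> 1" using f ne bij_betw_empty1 by (cases n) (auto simp: bij_betw_def)
  define x where "x = inv_into C f"
  have x: "x i \<in> C" "f (x i) = i" if "1 \<le> i" "i \<le> n" for i
    using that f bij_betwE[OF bij_betw_inv_into[OF f]] bij_betw_inv_into_right[OF f] unfolding x_def by auto
  have fx: "x (f p) = p" "1 \<le> f p" "f p \<le> n" if "p \<in> C" for p
    using that bij_betw_inv_into_left[OF f] bij_betwE[OF f] unfolding x_def by auto
  \<comment> \<open>The only possible arrow across the cut at \<open>i\<close>, together with its
    direction.\<close>
  have edge: "(f u = i \<and> f v = i + 1 \<and> a i) \<or> (f u = i + 1 \<and> f v = i \<and> \<not> a i)"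
    if "(u, v) \<in> snd (hasse C)" "f u \<le> i \<and> i < f v \<or> f v \<le> i \<and> i < f u" for u v i
  proof -
    have "(f u, f v) \<in> snd (A_quiver n a)" using that(1) e by (auto simp: in_hasse)
    then consider j where "f u = j" "f v = j + 1" "a j" | j where "f u = j + 1" "f v = j" "\<not> a j"
      by (auto simp: A_quiver_def)
    then show ?thesis
    proof cases
      case 1
      then have "j = i" using that(2) by linarith
      then show ?thesis using 1 by simp
    next
      case 2
      then have "j = i" using that(2) by linarith
      then show ?thesis using 2 by simp
    qed
  qed
  have "zigzag_poset (x ` {1..i}) (x i)" if "1 \<le> i" "i \<le> n" for i
    using that
  proof (induction i rule: nat_induct_at_least)
    case base
    show ?case using zigzag_poset.single[of "x 1"] by simp
  next
    case (Suc i)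
    have i: "1 \<le> i" "i \<le> n" "i < n" using Suc by auto
    have ins: "x ` {1..Suc i} = insert (x (Suc i)) (x ` {1..i})" using i by (simp add: atLeastAtMostSuc_conv)
    have P: "p \<in> C \<and> f p \<le> i" if "p \<in> x ` {1..i}" for p using that x i by auto
    have X: "x (Suc i) \<in> C" "f (x (Suc i)) = Suc i" using x[of "Suc i"] i by auto
    have Y: "x i \<in> C" "f (x i) = i" using x[of i] i by auto
    have new: "x (Suc i) \<notin> x ` {1..i}" using P X by fastforce
    have up: "p \<le> x i \<and> a i \<and> x i \<le> x (Suc i)" if h: "p \<in> x ` {1..i}" "p \<le> x (Suc i)" for p
    proof -
      obtain u v where uv: "(u, v) \<in> snd (hasse C)" "f u \<le> i" "\<not> f v \<le> i" "p \<le> u" "v \<le> x (Suc i)"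
        using hasse_crossing[OF fin _ X(1) h(2), of "\<lambda>u. f u \<le> i"] P[OF h(1)] X(2) by auto
      then have *: "f u = i" "f v = i + 1" "a i" using edge[of u v i] by auto
      have "u \<in> C" "v \<in> C" using uv(1) by (auto simp: in_hasse)
      then have "u = x i" "v = x (Suc i)" using fx(1)[of u] fx(1)[of v] * by auto
      then show ?thesis using uv * by (auto simp: in_hasse)
    qed
    have down: "x i \<le> p \<and> \<not> a i \<and> x (Suc i) \<le> x i" if h: "p \<in> x ` {1..i}" "x (Suc i) \<le> p" for p
    proof -
      obtain u v where uv: "(u, v) \<in> snd (hasse C)" "f u > i" "\<not> f v > i" "x (Suc i) \<le> u" "v \<le> p"
        using hasse_crossing[OF fin X(1) _ h(2), of "\<lambda>u. f u > i"] P[OF h(1)] X(2) by auto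
      then have *: "f u = i + 1" "f v = i" "\<not> a i" using edge[of u v i] by auto
      have "u \<in> C" "v \<in> C" using uv(1) by (auto simp: in_hasse)
      then have "v = x i" "u = x (Suc i)" using fx(1)[of u] fx(1)[of v] * by auto
      then show ?thesis using uv * by (auto simp: in_hasse)
    qed
    have yP: "x i \<in> x ` {1..i}" using i by auto
    have IH: "zigzag_poset (x ` {1..i}) (x i)" using Suc.IH i by simp
    show ?case
    proof (cases "a i")
      case True
      have "(x i, x (Suc i)) \<in> snd (hasse C)" using e[OF Y(1) X(1)] X Y True i by (simp add: A_quiver_def)
      then have lt: "x i \<le> x (Suc i)" by (simp add: in_hasse less_imp_le)
      have "leaf_above (x ` {1..i}) (x i) (x (Suc i))"
        unfolding leaf_above_def
      proof (intro conjI ballI yP new)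
        fix p assume p: "p \<in> x ` {1..i}"
        show "\<not> x (Suc i) \<le> p" using down[OF p] True by blast
        show "p \<le> x (Suc i) \<longleftrightarrow> p \<le> x i" using up[OF p] lt order_trans by blast
      qed
      then show ?thesis unfolding ins by (rule zigzag_poset.above[OF IH])
    next
      case False
      have "(x (Suc i), x i) \<in> snd (hasse C)" using e[OF X(1) Y(1)] X Y False i by (simp add: A_quiver_def)
      then have lt: "x (Suc i) \<le> x i" by (simp add: in_hasse less_imp_le)
      have "leaf_below (x ` {1..i}) (x i) (x (Suc i))"
        unfolding leaf_below_def
      proof (intro conjI ballI yP new)
        fix p assume p: "p \<in> x ` {1..i}"
        show "\<not> p \<le> x (Suc i)" using up[OF p] False by blast
        show "x (Suc i) \<le> p \<longleftrightarrow> x i \<le> p" using down[OF p] lt order_trans by blast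
      qed
      then show ?thesis unfolding ins by (rule zigzag_poset.below[OF IH])
    qed
  qed
  then have "zigzag_poset (x ` {1..n}) (x n)" using n by blast
  moreover have "x ` {1..n} = C"
    using bij_betw_imp_surj_on[OF bij_betw_inv_into[OF f]] unfolding x_def .
  ultimately show ?thesis using zigzag_decomposable by simp
qed

text \<open>Without the top, the cycle is a path: down the unprimed side to \<open>Hat0\<close>,
  then up the primed side.\<close>

lemma C_poset_remove_top:
  assumes "0 < m" "0 < l"
  shows "\<exists>y. zigzag_poset (C_poset m l - {Hat1}) y"
proof -
  have "zigzag_poset (Unprimed ` {m - k..m}) (Unprimed (m - k))" if "k < m" for k
    using that
  proof (induction k)
    case 0
    show ?case using zigzag_poset.single[of "Unprimed m"] by simp
  next
    case (Suc k)
    have "{m - Suc k..m} = insert (m - Suc k) {m - k..m}" using Suc.prems by auto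
    then have ins: "Unprimed ` {m - Suc k..m} = insert (Unprimed (m - Suc k)) (Unprimed ` {m - k..m})" by simp
    have "leaf_below (Unprimed ` {m - k..m}) (Unprimed (m - k)) (Unprimed (m - Suc k))"
      using Suc.prems by (auto simp: leaf_below_def)
    then show ?case unfolding ins using Suc by (intro zigzag_poset.below) auto
  qed
  from this[of "m - 1"] have 1: "zigzag_poset (Unprimed ` {1..m}) (Unprimed 1)" using assms by simp
  have "leaf_below (Unprimed ` {1..m}) (Unprimed 1) Hat0" using assms by (auto simp: leaf_below_def)
  then have 2: "zigzag_poset (insert Hat0 (Unprimed ` {1..m})) Hat0" by (rule zigzag_poset.below[OF 1])
  \<comment> \<open>Before any primed vertex is attached, the free end is
    \<open>Hat0\<close>.\<close>
  have "zigzag_poset (insert Hat0 (Unprimed ` {1..m}) \<union> Primed ` {1..k}) (if k = 0 then Hat0 else Primed k)" for k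
  proof (induction k)
    case 0
    then show ?case using 2 by simp
  next
    case (Suc k)
    have ins: "insert Hat0 (Unprimed ` {1..m}) \<union> Primed ` {1..Suc k}
        = insert (Primed (Suc k)) (insert Hat0 (Unprimed ` {1..m}) \<union> Primed ` {1..k})"
      by (simp add: atLeastAtMostSuc_conv)
    have "leaf_above (insert Hat0 (Unprimed ` {1..m}) \<union> Primed ` {1..k}) (if k = 0 then Hat0 else Primed k) (Primed (Suc k))"
      by (auto simp: leaf_above_def)
    then show ?case unfolding ins using zigzag_poset.above[OF Suc] by simp
  qed
  then have "zigzag_poset (insert Hat0 (Unprimed ` {1..m}) \<union> Primed ` {1..l}) (if l = 0 then Hat0 else Primed l)" .
  moreover have "C_poset m l - {Hat1} = insert Hat0 (Unprimed ` {1..m}) \<union> Primed ` {1..l}"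
    by (auto simp: C_poset_def)
  ultimately show ?thesis by metis
qed

text \<open>Without the bottom, the path runs up the unprimed side to \<open>Hat1\<close> and then
  down the primed side.\<close>

lemma C_poset_remove_bot:
  assumes "0 < m" "0 < l"
  shows "\<exists>y. zigzag_poset (C_poset m l - {Hat0}) y"
proof -
  have "zigzag_poset (Unprimed ` {1..Suc k}) (Unprimed (Suc k))" for k
  proof (induction k)
    case 0
    show ?case using zigzag_poset.single[of "Unprimed 1"] by simp
  next
    case (Suc k)
    have ins: "Unprimed ` {1..Suc (Suc k)} = insert (Unprimed (Suc (Suc k))) (Unprimed ` {1..Suc k})"
      by (simp add: atLeastAtMostSuc_conv)
    have "leaf_above (Unprimed ` {1..Suc k}) (Unprimed (Suc k)) (Unprimed (Suc (Suc k)))"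
      by (auto simp: leaf_above_def)
    then show ?case unfolding ins by (rule zigzag_poset.above[OF Suc])
  qed
  from this[of "m - 1"] have 1: "zigzag_poset (Unprimed ` {1..m}) (Unprimed m)" using assms by simp
  have "leaf_above (Unprimed ` {1..m}) (Unprimed m) Hat1" using assms by (auto simp: leaf_above_def)
  then have 2: "zigzag_poset (insert Hat1 (Unprimed ` {1..m})) Hat1" by (rule zigzag_poset.above[OF 1])
  \<comment> \<open>\<open>k\<close> counts the primed vertices already attached, from the top
    downwards; for \<open>k = 0\<close> the range \<open>{l + 1..l}\<close> is empty and the free
    end is \<open>Hat1\<close>.\<close>
  have "zigzag_poset (insert Hat1 (Unprimed ` {1..m}) \<union> Primed ` {l + 1 - k..l}) (if k = 0 then Hat1 else Primed (l + 1 - k))"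
    if "k \<le> l" for k
    using that
  proof (induction k)
    case 0
    then show ?case using 2 by simp
  next
    case (Suc k)
    have "{l + 1 - Suc k..l} = insert (l + 1 - Suc k) {l + 1 - k..l}" using Suc.prems by auto
    then have ins: "insert Hat1 (Unprimed ` {1..m}) \<union> Primed ` {l + 1 - Suc k..l}
        = insert (Primed (l + 1 - Suc k)) (insert Hat1 (Unprimed ` {1..m}) \<union> Primed ` {l + 1 - k..l})"
      by simp
    have "leaf_below (insert Hat1 (Unprimed ` {1..m}) \<union> Primed ` {l + 1 - k..l}) (if k = 0 then Hat1 else Primed (l + 1 - k)) (Primed (l + 1 - Suc k))"
      using Suc.prems by (auto simp: leaf_below_def)
    then show ?case unfolding ins using zigzag_poset.below Suc by auto
  qed
  from this[OF order_refl] have "\<exists>y. zigzag_poset (insert Hat1 (Unprimed ` {1..m}) \<union> Primed ` {l + 1 - l..l}) y" by (rule exI)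
  moreover have "C_poset m l - {Hat0} = insert Hat1 (Unprimed ` {1..m}) \<union> Primed ` {l + 1 - l..l}"
    by (auto simp: C_poset_def)
  ultimately show ?thesis by simp
qed

text \<open>The order of a finite poset is the reflexive transitive closure of its covers, so
  preserving arrows is enough.\<close>

lemma hasse_iso_imp_le:
  assumes "finite P" "\<And>x y. (x, y) \<in> snd (hasse P) \<Longrightarrow> (f x, f y) \<in> snd (hasse Q)" "p \<in> P" "q \<in> P" "p \<le> q"
  shows "f p \<le> f q"
proof -
  have "(f p, f q) \<in> (snd (hasse Q))\<^sup>*"
    using le_imp_hasse_path[OF assms(1,3-5)]
    by (induction rule: rtrancl_induct) (auto intro: rtrancl_into_rtrancl assms(2))
  then show ?thesis by (rule hasse_path_imp_le)
qed

text \<open>A diagram isomorphism is an order isomorphism, so the bounds of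
  \<open>C_poset m l\<close> and the zigzags left by removing one of them are carried over to
  \<open>C\<close>.\<close>

lemma C_poset_decomposable:
  fixes C :: "'a::order set"
  assumes fin: "finite C" and ml: "0 < m" "0 < l" and iso: "quiver_iso (hasse C) (hasse (C_poset m l))"
  shows "decomposable_poset TYPE('k::field) C"
proof -
  obtain g where g: "bij_betw g (C_poset m l) C"
    and e: "\<And>x y. x \<in> C_poset m l \<Longrightarrow> y \<in> C_poset m l \<Longrightarrow> (x, y) \<in> snd (hasse (C_poset m l)) \<longleftrightarrow> (g x, g y) \<in> snd (hasse C)"
    using quiver_iso_sym[OF iso] unfolding quiver_iso_def by auto
  have finC: "finite (C_poset m l)" by (simp add: C_poset_def)
  define h where "h = inv_into (C_poset m l) g"
  have h: "h x \<in> C_poset m l" "g (h x) = x" if "x \<in> C" for x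
    using that bij_betwE[OF bij_betw_inv_into[OF g]] bij_betw_inv_into_right[OF g] unfolding h_def by auto
  have gC: "g p \<in> C" "h (g p) = p" if "p \<in> C_poset m l" for p
    using that bij_betwE[OF g] bij_betw_inv_into_left[OF g] unfolding h_def by auto
  have g_mono: "g p \<le> g q" if "p \<in> C_poset m l" "q \<in> C_poset m l" "p \<le> q" for p q
  proof (rule hasse_iso_imp_le[OF finC _ that])
    fix x y assume xy: "(x, y) \<in> snd (hasse (C_poset m l))"
    then have "x \<in> C_poset m l" "y \<in> C_poset m l" by (auto simp: in_hasse)
    then show "(g x, g y) \<in> snd (hasse C)" using e[of x y] xy by simp
  qed
  have h_mono: "h p \<le> h q" if "p \<in> C" "q \<in> C" "p \<le> q" for p q
  proof (rule hasse_iso_imp_le[OF fin _ that])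
    fix x y assume xy: "(x, y) \<in> snd (hasse C)"
    then have "x \<in> C" "y \<in> C" by (auto simp: in_hasse)
    then show "(h x, h y) \<in> snd (hasse (C_poset m l))" using e[of "h x" "h y"] h xy by simp
  qed
  have iff: "g p \<le> g q \<longleftrightarrow> p \<le> q" if "p \<in> C_poset m l" "q \<in> C_poset m l" for p q
    using g_mono[OF that] h_mono[of "g p" "g q"] gC that by auto
  have mem: "Hat0 \<in> C_poset m l" "Hat1 \<in> C_poset m l" by (auto simp: C_poset_def)
  have img: "g ` (C_poset m l - {z}) = C - {g z}" if "z \<in> C_poset m l" for z
    using g that unfolding bij_betw_def by (metis inj_on_image_set_diff Diff_subset image_empty image_insert insert_subset empty_subsetI)
  have dec: "decomposable_poset TYPE('k) (C - {g z})" if z: "z \<in> C_poset m l" "\<exists>y. zigzag_poset (C_poset m l - {z}) y" for z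
  proof -
    obtain y where "zigzag_poset (C_poset m l - {z}) y" using z(2) by blast
    then have "zigzag_poset (g ` (C_poset m l - {z})) (g y)" by (rule zigzag_image) (use iff in auto)
    then show ?thesis unfolding img[OF z(1)] by (rule zigzag_decomposable)
  qed
  show ?thesis
  proof (rule bounded_decomposable[OF fin, of "g Hat0" "g Hat1"])
    show "g Hat0 \<le> p" if "p \<in> C" for p
      using iff[OF mem(1) h(1)[OF that]] h(2)[OF that] by simp
    show "p \<le> g Hat1" if "p \<in> C" for p
    proof -
      have "h p \<le> Hat1" by (cases "h p") auto
      then show ?thesis using iff[OF h(1)[OF that] mem(2)] h(2)[OF that] by simp
    qed
    show "g Hat0 \<noteq> g Hat1" using iff[OF mem(2,1)] by auto
    show "decomposable_poset TYPE('k) (C - {g Hat0})" by (rule dec[OF mem(1) C_poset_remove_bot[OF ml]])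
    show "decomposable_poset TYPE('k) (C - {g Hat1})" by (rule dec[OF mem(2) C_poset_remove_top[OF ml]])
  qed (use gC mem in auto)
qed

definition good_diagram :: "'v quiver \<Rightarrow> bool" where
  "good_diagram Q \<longleftrightarrow> (\<exists>n a. quiver_iso Q (A_quiver n a)) \<or>
     (\<exists>m l. 0 < m \<and> 0 < l \<and> quiver_iso Q (hasse (C_poset m l)))"

lemma good_diagrams_imp_decomposable:
  fixes P :: "'a::order set"
  assumes fin: "finite P" and good: "\<And>Q. Q \<in> quiver_components (hasse P) \<Longrightarrow> good_diagram Q"
  shows "decomposable_poset TYPE('k::field) P"
proof (rule components_decomposable[OF fin])
  fix a assume a: "a \<in> P"
  define C where "C = ((hasse_adj P)\<^sup>* \<inter> P \<times> P) `` {a}"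
  note c = hasse_component_class[OF fin a, folded C_def]
  note cD = hasse_componentD[OF c(2)]
  have "hasse C \<in> quiver_components (hasse P)" using quiver_components_hasse[OF fin] a C_def by blast
  then have gd: "good_diagram (hasse C)" by (rule good)
  have finC: "finite C" using finite_subset[OF cD(1) fin] .
  have "decomposable_poset TYPE('k) C"
    using gd A_quiver_decomposable[OF finC cD(2)] C_poset_decomposable[OF finC] unfolding good_diagram_def by blast
  then show "\<exists>C\<subseteq>P. a \<in> C \<and> decomposable_poset TYPE('k) C \<and> (\<forall>p\<in>C. \<forall>q\<in>P. p \<le> q \<or> q \<le> p \<longrightarrow> q \<in> C)"
    using c(1) cD(1,3) by (intro exI[of _ C]) simp
qed

section \<open>Modules that are not interval-decomposable\<close>

definition plane :: "(nat \<Rightarrow> 'k::field) set" where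
  "plane = {v. \<forall>i\<ge>2. v i = 0}"

lemma plane_eqI:
  assumes "u \<in> plane" "v \<in> plane" "u 0 = v 0" "u 1 = v 1"
  shows "u = v"
proof
  fix i show "u i = v i"
  proof (cases "i \<ge> 2")
    case True then show ?thesis using assms(1,2) by (simp add: plane_def)
  next
    case False
    then have "i = 0 \<or> i = 1" by linarith
    then show ?thesis using assms(3,4) by blast
  qed
qed

lemma subspace_plane: "vec.subspace plane"
  by (rule vec.subspaceI) (auto simp: plane_def vscale_def)

definition axis :: "nat \<Rightarrow> nat \<Rightarrow> 'k::field" where
  "axis j = (\<lambda>i. if i = j then 1 else 0)"

lemma axis_in_plane: "j < 2 \<Longrightarrow> axis j \<in> plane"
  by (auto simp: axis_def plane_def)

lemma fin_dim_plane: "fin_dim_space (plane :: (nat \<Rightarrow> 'k::field) set)"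
  unfolding fin_dim_space_def
proof (intro exI[of _ "{axis 0, axis 1 :: nat \<Rightarrow> 'k}"] conjI subset_antisym)
  show "vec.span {axis 0, axis 1 :: nat \<Rightarrow> 'k} \<subseteq> plane"
    by (rule vec.span_minimal[OF _ subspace_plane]) (auto intro: axis_in_plane)
  show "plane \<subseteq> vec.span {axis 0, axis 1 :: nat \<Rightarrow> 'k}"
  proof
    fix v :: "nat \<Rightarrow> 'k" assume v: "v \<in> plane"
    have "v = vscale (v 0) (axis 0) + vscale (v 1) (axis 1)"
    proof (rule plane_eqI[OF v])
      show "vscale (v 0) (axis 0) + vscale (v 1) (axis 1) \<in> plane"
        by (intro vec.subspace_add[OF subspace_plane] vec.subspace_scale[OF subspace_plane] axis_in_plane) auto
    qed (auto simp: vscale_def axis_def)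
    moreover have "\<dots> \<in> vec.span {axis 0, axis 1 :: nat \<Rightarrow> 'k}"
      by (intro vec.span_add vec.span_scale vec.span_base) auto
    ultimately show "v \<in> vec.span {axis 0, axis 1 :: nat \<Rightarrow> 'k}" by simp
  qed
qed simp

text \<open>Equations of the three lines: the two coordinate axes for \<open>i = 0\<close> and
  \<open>i = 1\<close>, and the diagonal otherwise. They are pairwise different over every
  field.\<close>

definition line_fun :: "nat \<Rightarrow> (nat \<Rightarrow> 'k::field) \<Rightarrow> 'k" where
  "line_fun i v = (if i = 0 then v 1 else if i = 1 then v 0 else v 0 - v 1)"

definition line :: "nat \<Rightarrow> (nat \<Rightarrow> 'k::field) set" where
  "line i = {v \<in> plane. line_fun i v = 0}"

text \<open>A projection whose kernel in the plane is \<open>line i\<close>. Its image is an axis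
  whose unit vector has value 1 under \<open>line_fun i\<close>, hence it is idempotent.\<close>

definition line_proj :: "nat \<Rightarrow> (nat \<Rightarrow> 'k::field) \<Rightarrow> nat \<Rightarrow> 'k" where
  "line_proj i v = vscale (line_fun i v) (if i = 0 then axis 1 else axis 0)"

lemma line_fun_linear:
  "line_fun i (u + v) = line_fun i u + line_fun i v" "line_fun i (vscale c v) = c * line_fun i v"
  by (auto simp: line_fun_def vscale_def algebra_simps)

lemma line_proj_linear: "linear_on UNIV UNIV (line_proj i)"
  unfolding linear_on_def line_proj_def line_fun_linear by (simp add: vec.scale_left_distrib)

lemma line_proj_idem: "line_proj i (line_proj i v) = line_proj i v"
  unfolding line_proj_def line_fun_linear by (simp add: line_fun_def axis_def)

lemma line_proj_plane: "line_proj i v \<in> plane"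
  unfolding line_proj_def by (auto intro!: vec.subspace_scale[OF subspace_plane] axis_in_plane)

lemma line_proj_eq_0:
  fixes v :: "nat \<Rightarrow> 'k::field"
  shows "line_proj i v = 0 \<longleftrightarrow> line_fun i v = 0"
proof -
  have "axis j \<noteq> (0 :: nat \<Rightarrow> 'k)" for j by (metis axis_def zero_fun_apply zero_neq_one)
  then show ?thesis unfolding line_proj_def by simp
qed

lemma subspace_line: "vec.subspace (line i)"
  using subspace_plane unfolding vec.subspace_def line_def mem_Collect_eq
  by (auto simp: line_fun_linear) (simp add: line_fun_def)

lemma line_nonzero: "\<exists>w\<in>line i. w \<noteq> (0 :: nat \<Rightarrow> 'k::field)"
proof -
  define w :: "nat \<Rightarrow> 'k" where "w = (\<lambda>j. if j = 0 \<and> i \<noteq> 1 \<or> j = 1 \<and> i \<noteq> 0 then 1 else 0)"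
  have "w \<in> line i" by (auto simp: line_def plane_def w_def line_fun_def)
  moreover have "w 0 \<noteq> 0 \<or> w 1 \<noteq> 0" by (auto simp: w_def)
  then have "w \<noteq> 0" by auto
  ultimately show ?thesis by blast
qed

text \<open>A module with \<open>M\<^sub>x\<close> a plane in which three different lines are the images of the maps from
  the lower and the kernels of the maps to the upper neighbours of \<open>x\<close>.  In an interval decomposition
  each line is spanned by a member of the resulting basis of \<open>M\<^sub>x\<close>.  At \<open>p\<close> the module is \<open>U p\<close>
  modulo the kernel of the projection \<open>c p\<close>, realised as the image of \<open>c p\<close>.\<close>

lemma three_neighbours_not_decomposable:
  fixes P :: "'a::order set" and y :: "nat \<Rightarrow> 'a"
  assumes x: "x \<in> P" and yP: "\<And>i. i < 3 \<Longrightarrow> y i \<in> P" and yx: "\<And>i. i < 3 \<Longrightarrow> y i < x \<or> x < y i"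
    and low: "\<And>i j. i < 3 \<Longrightarrow> j < 3 \<Longrightarrow> y i < x \<Longrightarrow> y j < x \<Longrightarrow> y i \<le> y j \<Longrightarrow> i = j"
    and upp: "\<And>i j. i < 3 \<Longrightarrow> j < 3 \<Longrightarrow> x < y i \<Longrightarrow> x < y j \<Longrightarrow> y i \<le> y j \<Longrightarrow> i = j"
  shows "\<not> decomposable_poset TYPE('k::field) P"
proof
  assume dec: "decomposable_poset TYPE('k) P"
  \<comment> \<open>\<open>S p\<close> collects the upper neighbours of \<open>x\<close> above
    \<open>p\<close>, and \<open>U p\<close> is generated by what reaches \<open>p\<close> from
    \<open>x\<close> or from its lower neighbours.\<close>
  define S where "S p = {i. i < 3 \<and> x < y i \<and> p \<le> y i}" for p
  define U :: "'a \<Rightarrow> (nat \<Rightarrow> 'k) set" where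
    "U p = (if x \<le> p then plane else vec.span (\<Union>i\<in>{i. i < 3 \<and> y i < x \<and> y i \<le> p}. line i))" for p
  \<comment> \<open>The kernel on the plane is the intersection of the lines of the upper neighbours
    in \<open>S p\<close>: everything for none, one line for one, and 0 for two or more, as distinct
    lines meet in 0. Below \<open>x\<close> nothing is divided out yet.\<close>
  define c :: "'a \<Rightarrow> (nat \<Rightarrow> 'k) \<Rightarrow> nat \<Rightarrow> 'k" where
    "c p v = (if p \<le> x then v else if S p = {} then 0 else if \<exists>i. S p = {i} then line_proj (the_elem (S p)) v else v)" for p v
  have c_lin: "linear_on UNIV UNIV (c p)" for p
    using line_proj_linear unfolding c_def[abs_def] by (auto simp: linear_on_def)
  \<comment> \<open>As \<open>p\<close> grows, \<open>S p\<close> shrinks and the kernel grows, so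
    the second projection absorbs the first.\<close>
  have c_comp: "c q (c p v) = c q v" if "p \<le> q" for p q v
  proof -
    have Sq: "S q \<subseteq> S p" using that by (auto simp: S_def)
    have qx: "p \<le> x" if "q \<le> x" using that \<open>p \<le> q\<close> by simp
    consider "c p v = v" | "\<not> p \<le> x" "S p = {}" | i where "\<not> p \<le> x" "S p = {i}" "c p v = line_proj i v"
      unfolding c_def by (cases "p \<le> x"; cases "S p = {}"; cases "\<exists>i. S p = {i}") auto
    then show ?thesis
    proof cases
      case 2
      then show ?thesis using Sq qx by (auto simp: c_def)
    next
      case 3
      then have "S q = {} \<or> S q = {i}" using Sq subset_singletonD by metis
      then show ?thesis using 3 qx by (auto simp: c_def line_proj_idem)
    qed simp
  qed
  have line_sub: "line i \<subseteq> plane" for i :: nat by (auto simp: line_def)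
  have U_sub: "vec.subspace (U p)" for p
    unfolding U_def by (simp add: subspace_plane)
  have U_plane: "U p \<subseteq> plane" for p
    unfolding U_def using vec.span_minimal[OF _ subspace_plane, of "\<Union>i\<in>{i. i < 3 \<and> y i < x \<and> y i \<le> p}. line i"] line_sub by auto
  have U_mono: "U p \<subseteq> U q" if "p \<le> q" for p q
  proof (cases "x \<le> q")
    case True
    then show ?thesis using U_plane[of p] by (simp add: U_def)
  next
    case False
    then have "\<not> x \<le> p" using that by auto
    moreover have "(\<Union>i\<in>{i. i < 3 \<and> y i < x \<and> y i \<le> p}. line i) \<subseteq> (\<Union>i\<in>{i. i < 3 \<and> y i < x \<and> y i \<le> q}. line i :: (nat \<Rightarrow> 'k) set)"
      using that by (auto intro: order_trans)
    ultimately show ?thesis using False vec.span_mono by (simp add: U_def)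
  qed
  have c_plane: "c p v \<in> plane" if "v \<in> plane" for p v
    using that line_proj_plane vec.subspace_0[OF subspace_plane] by (auto simp: c_def)
  have c_linU: "linear_on (U p) UNIV (c p)" for p
    using c_lin unfolding linear_on_def by blast
  define M :: "('a, 'k) rep" where "M = \<lparr>vspace = (\<lambda>p. c p ` U p), vmap = (\<lambda>p q. c q)\<rparr>"
  have Ms [simp]: "vspace M p = c p ` U p" "vmap M p q = c q" for p q by (simp_all add: M_def)
  have M: "is_rep P M"
    unfolding is_rep_def Ms
  proof (intro conjI ballI impI)
    fix p assume "p \<in> P"
    show "fin_dim_space (c p ` U p)"
      by (rule fin_dim_space_mono[OF fin_dim_plane subspace_image[OF c_linU U_sub]]) (use U_plane c_plane in blast)
    show "c p v = v" if "v \<in> c p ` U p" for v using that c_comp by auto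
    fix q assume "q \<in> P" "p \<le> q"
    then have "c q ` c p ` U p = c q ` U p" "U p \<subseteq> U q" using c_comp U_mono by (auto simp: image_image)
    then have "c q ` c p ` U p \<subseteq> c q ` U q" by auto
    then show "linear_on (c p ` U p) (c q ` U q) (c q)"
      using c_lin[of q] unfolding linear_on_def by blast
    show "c r (c q v) = c r v" if "q \<le> r" for r v by (rule c_comp[OF that])
  qed
  have Mx: "vspace M x = plane" by (simp add: U_def c_def[abs_def])
  obtain n I v \<phi> where D: "interval_decomp P M n I v \<phi>" using decomposable_posetD[OF dec M] .
  have nonzero: "v t p \<noteq> 0" if "t < n" "p \<in> I t" "p \<in> P" for t p
    using interval_decompD(4)[OF D that(1,1,2)] lin_fun_0[OF cosectD(1)[OF interval_decompD(3)[OF D that(1)] that(3)] rep_subspace[OF M that(3)]]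
    by auto
  have ex: "\<exists>t<n. \<phi> t p w \<noteq> 0" if "p \<in> P" "w \<in> vspace M p" "w \<noteq> 0" for p w
  proof (rule ccontr)
    assume "\<not> ?thesis"
    then have "(\<Sum>t<n. vscale (\<phi> t p w) (v t p)) = 0" by (intro sum.neutral) auto
    then show False using interval_decompD(5)[OF D that(1,2)] that(3) by simp
  qed
  have "\<exists>t<n. x \<in> I t \<and> v t x \<in> line i" if i: "i < 3" for i
    using yx[OF i]
  proof
    \<comment> \<open>At \<open>y i\<close> the module is the line itself, so a summand alive there
      carries its generator into this line.\<close>
    assume lo: "y i < x"
    have nx: "\<not> x \<le> y i" and le: "y i \<le> x" using lo by auto
    have "{j. j < 3 \<and> y j < x \<and> y j \<le> y i} = {i}" using low i lo by auto
    then have "U (y i) = line i" using nx subspace_line by (simp add: U_def vec.span_eq_iff)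
    then have My: "vspace M (y i) = line i" using le by (simp add: c_def[abs_def])
    obtain w :: "nat \<Rightarrow> 'k" where w: "w \<in> line i" "w \<noteq> 0" using line_nonzero by blast
    obtain t where t: "t < n" "\<phi> t (y i) w \<noteq> 0" using ex[OF yP[OF i]] w My by auto
    have yI: "y i \<in> I t" using t cosectD(2)[OF interval_decompD(3)[OF D t(1)]] by blast
    have "v t x = v t (y i)" using sectD(3)[OF interval_decompD(2)[OF D t(1)] yI x le] by (simp add: c_def)
    moreover have "v t (y i) \<in> line i" using sectD(1)[OF interval_decompD(2)[OF D t(1)] yP[OF i]] My by simp
    moreover have "v t (y i) \<noteq> 0" by (rule nonzero[OF t(1) yI yP[OF i]])
    ultimately show ?thesis using t(1) sectD(2)[OF interval_decompD(2)[OF D t(1)], of x] by metis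
  next
    \<comment> \<open>A summand whose functional detects a vector of the kernel line cannot contain
      \<open>y i\<close>; hence its own generator at \<open>x\<close> is killed by the projection as
      well and lies in the same line.\<close>
    assume up: "x < y i"
    have nx: "\<not> y i \<le> x" and le: "x \<le> y i" using up by auto
    have "S (y i) = {i}" using upp i up by (auto simp: S_def)
    then have cy: "c (y i) u = line_proj i u" for u using nx by (simp add: c_def)
    obtain w :: "nat \<Rightarrow> 'k" where w: "w \<in> line i" "w \<noteq> 0" using line_nonzero by blast
    have wx: "w \<in> vspace M x" using w line_sub Mx by blast
    obtain t where t: "t < n" "\<phi> t x w \<noteq> 0" using ex[OF x wx w(2)] by auto
    have xI: "x \<in> I t" using t cosectD(2)[OF interval_decompD(3)[OF D t(1)]] by blast
    have Tw: "vmap M x (y i) w = 0" using w(1) by (simp add: cy line_proj_eq_0 line_def)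
    have "y i \<notin> I t"
    proof
      assume yI: "y i \<in> I t"
      have "\<phi> t (y i) (vmap M x (y i) w) = \<phi> t x w"
        by (rule cosectD(3)[OF interval_decompD(3)[OF D t(1)] yI x le wx])
      then show False
        using t(2) Tw lin_fun_0[OF cosectD(1)[OF interval_decompD(3)[OF D t(1)] yP[OF i]] rep_subspace[OF M yP[OF i]]] by simp
    qed
    then have "vmap M x (y i) (v t x) = 0"
      using sectD(3)[OF interval_decompD(2)[OF D t(1)] xI yP[OF i] le] sectD(2)[OF interval_decompD(2)[OF D t(1)]] by simp
    then have "line_fun i (v t x) = 0" by (simp add: cy line_proj_eq_0)
    moreover have "v t x \<in> plane" using sectD(1)[OF interval_decompD(2)[OF D t(1)] x] Mx by simp
    ultimately show ?thesis using t(1) xI by (auto simp: line_def)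
  qed
  then obtain \<tau> where \<tau>: "\<And>i. i < 3 \<Longrightarrow> \<tau> i < n \<and> x \<in> I (\<tau> i) \<and> v (\<tau> i) x \<in> line i" by metis
  define a b d where "a = v (\<tau> 0) x" and "b = v (\<tau> 1) x" and "d = v (\<tau> 2) x"
  have pl: "a \<in> plane" "b \<in> plane" "d \<in> plane" and co: "a 1 = 0" "b 0 = 0" "d 0 = d 1"
    using \<tau>[of 0] \<tau>[of 1] \<tau>[of 2] by (auto simp: a_def b_def d_def line_def line_fun_def)
  have nz: "a \<noteq> 0" "b \<noteq> 0" "d \<noteq> 0" using nonzero \<tau>[of 0] \<tau>[of 1] \<tau>[of 2] x by (auto simp: a_def b_def d_def)
  have zp: "0 \<in> plane" using vec.subspace_0[OF subspace_plane] .
  have nz': "a 0 \<noteq> 0" "b 1 \<noteq> 0" "d 0 \<noteq> 0"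
    using nz plane_eqI[OF pl(1) zp] plane_eqI[OF pl(2) zp] plane_eqI[OF pl(3) zp] co by auto
  \<comment> \<open>Vectors in three different lines of a plane are dependent, but
    \<open>\<tau> 2\<close> differs from \<open>\<tau> 0\<close> and \<open>\<tau> 1\<close>, so
    applying its dual functional gives \<open>1 = 0\<close>.\<close>
  have comb: "d = vscale (d 0 / a 0) a + vscale (d 0 / b 1) b"
    using pl nz' co by (intro plane_eqI vec.subspace_add[OF subspace_plane] vec.subspace_scale[OF subspace_plane])
      (auto simp: vscale_def)
  have t01: "\<tau> 2 \<noteq> \<tau> 0" "\<tau> 2 \<noteq> \<tau> 1"
    using nz' co unfolding a_def b_def d_def by metis+
  have l: "lin_fun plane (\<phi> (\<tau> 2) x)" using cosectD(1)[OF interval_decompD(3)[OF D] x, of "\<tau> 2"] \<tau>[of 2] Mx by simp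
  have f: "\<phi> (\<tau> 2) x a = 0" "\<phi> (\<tau> 2) x b = 0" "\<phi> (\<tau> 2) x d = 1"
    using interval_decompD(4)[OF D] \<tau>[of 0] \<tau>[of 1] \<tau>[of 2] t01 unfolding a_def b_def d_def by auto
  have "\<phi> (\<tau> 2) x (vscale (d 0 / a 0) a + vscale (d 0 / b 1) b) = d 0 / a 0 * \<phi> (\<tau> 2) x a + d 0 / b 1 * \<phi> (\<tau> 2) x b"
    unfolding lin_funD(1)[OF l vec.subspace_scale[OF subspace_plane pl(1)] vec.subspace_scale[OF subspace_plane pl(2)]]
      lin_funD(2)[OF l pl(1)] lin_funD(2)[OF l pl(2)] ..
  then have "\<phi> (\<tau> 2) x d = d 0 / a 0 * \<phi> (\<tau> 2) x a + d 0 / b 1 * \<phi> (\<tau> 2) x b"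
    unfolding comb[symmetric] .
  then show False using f by simp
qed

text \<open>Invertible on the plane over every field and never the identity; its fixed vectors are
  those with second coordinate 0.\<close>

definition shear :: "(nat \<Rightarrow> 'k::field) \<Rightarrow> nat \<Rightarrow> 'k" where
  "shear v = v + vscale (v 1) (axis 0)"

lemma shear_simps: "shear v 0 = v 0 + v 1" "shear v (Suc 0) = v (Suc 0)"
  by (simp_all add: shear_def axis_def vscale_def)

lemma shear_linear: "shear (u + v) = shear u + shear v" "shear (vscale c v) = vscale c (shear v)"
  by (auto simp: shear_def fun_eq_iff vscale_def algebra_simps)

lemma shear_plane: "v \<in> plane \<Longrightarrow> shear v \<in> plane"
  by (auto simp: shear_def intro!: vec.subspace_add[OF subspace_plane] vec.subspace_scale[OF subspace_plane] axis_in_plane)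

lemma shear_surj: "v \<in> plane \<Longrightarrow> \<exists>u\<in>plane. shear u = v"
proof
  assume v: "v \<in> plane"
  let ?u = "v - vscale (v 1) (axis 0)"
  show "?u \<in> plane" using v by (intro vec.subspace_diff[OF subspace_plane] vec.subspace_scale[OF subspace_plane] axis_in_plane) auto
  show "shear ?u = v" by (auto simp: shear_def fun_eq_iff axis_def vscale_def)
qed

lemma shear_eq_0: "shear v = 0 \<Longrightarrow> v \<in> plane \<Longrightarrow> v = 0"
proof -
  assume s: "shear v = 0" and v: "v \<in> plane"
  have "v 1 = 0" "v 0 = 0" using shear_simps[of v] s by auto
  then show "v = 0" using plane_eqI[OF v vec.subspace_0[OF subspace_plane]] by simp
qed

text \<open>All spaces are planes and the monodromy around the cycle is a shear.  In an interval decomposition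
  every interval would be all of \<open>C\<close>, which makes the monodromy trivial.\<close>

lemma cycle_not_decomposable:
  fixes P :: "'a::order set"
  assumes CP: "C \<subseteq> P" and closed: "\<And>p q. p \<in> C \<Longrightarrow> q \<in> P \<Longrightarrow> p \<le> q \<or> q \<le> p \<Longrightarrow> q \<in> C"
    and conn: "connected_poset C"
    and y: "y \<in> C" "\<And>p. p \<in> C \<Longrightarrow> y \<le> p \<Longrightarrow> p = y"
    and x1: "x1 \<in> C" "x1 < y" and x2: "x2 \<in> C" "x2 < y"
    and below: "\<And>p. p \<in> C \<Longrightarrow> p < y \<Longrightarrow> p \<le> x1 \<or> p \<le> x2"
    and disj: "\<And>p. p \<in> C \<Longrightarrow> \<not> (p \<le> x1 \<and> p \<le> x2)"
    and path: "(x1, x2) \<in> {(u, v). u \<in> C - {y} \<and> v \<in> C - {y} \<and> (u \<le> v \<or> v \<le> u)}\<^sup>*"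
  shows "\<not> decomposable_poset TYPE('k::field) P"
proof
  assume dec: "decomposable_poset TYPE('k) P"
  \<comment> \<open>The shear is placed on the maps into \<open>y\<close> from the elements below
    \<open>x1\<close>; by \<open>disj\<close> none of these factors through \<open>x2\<close>, so
    the choice is consistent.\<close>
  define tw where "tw a b \<longleftrightarrow> b = y \<and> a \<noteq> y \<and> a \<le> x1" for a b
  define m :: "'a \<Rightarrow> 'a \<Rightarrow> (nat \<Rightarrow> 'k) \<Rightarrow> nat \<Rightarrow> 'k" where
    "m a b v = (if a \<in> C \<and> b \<in> C then if tw a b then shear v else v else 0)" for a b v
  define M :: "('a, 'k) rep" where "M = \<lparr>vspace = (\<lambda>p. if p \<in> C then plane else {0}), vmap = m\<rparr>"
  have Ms [simp]: "vspace M p = (if p \<in> C then plane else {0})" "vmap M = m" for p by (simp_all add: M_def)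
  \<comment> \<open>The only delicate case is \<open>c = y\<close> with \<open>b\<close> below it.
    Then \<open>b\<close> lies under \<open>x1\<close> or \<open>x2\<close>, and if \<open>a\<close>
    is under \<open>x1\<close>, the second would put \<open>a\<close> under both; so
    \<open>a\<close> and \<open>b\<close> lie on the same side.\<close>
  have tw_comp: "tw a c \<longleftrightarrow> tw a b \<or> tw b c" if "a \<in> C" "b \<in> C" "c \<in> C" "a \<le> b" "b \<le> c" for a b c
  proof (cases "c = y \<and> b \<noteq> y")
    case True
    then have by': "b < y" "a \<noteq> y" using that y(2)[of b] by auto
    have "a \<le> x1 \<longleftrightarrow> b \<le> x1"
    proof
      assume a: "a \<le> x1"
      then have "\<not> b \<le> x2" using disj[OF that(1)] that(4) order_trans by blast
      then show "b \<le> x1" using below[OF that(2) by'(1)] by blast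
    qed (use that(4) in simp)
    then show ?thesis using True by' by (auto simp: tw_def)
  next
    case False
    then show ?thesis using y(2)[of c] that(3,5) by (auto simp: tw_def)
  qed
  have tw_one: "\<not> (tw a b \<and> tw b c)" for a b c by (auto simp: tw_def)
  have M: "is_rep P M"
    unfolding is_rep_def Ms
  proof (intro conjI ballI impI)
    fix p assume p: "p \<in> P"
    show "fin_dim_space (if p \<in> C then plane else {0} :: (nat \<Rightarrow> 'k) set)" by (simp add: fin_dim_plane fin_dim_zero)
    show "m p p v = v" if "v \<in> (if p \<in> C then plane else {0})" for v
      using that by (auto simp: m_def tw_def split: if_splits)
    fix q assume q: "q \<in> P" "p \<le> q"
    show "linear_on (if p \<in> C then plane else {0}) (if q \<in> C then plane else {0}) (m p q)"
      unfolding linear_on_def using closed[of p q] p q vec.subspace_0[OF subspace_plane]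
      by (auto simp: m_def shear_linear shear_plane)
    fix r v assume r: "r \<in> P" "q \<le> r" and v: "v \<in> (if p \<in> C then plane else {0} :: (nat \<Rightarrow> 'k) set)"
    show "m q r (m p q v) = m p r v"
    proof (cases "p \<in> C")
      case True
      have qC: "q \<in> C" using closed[OF True q(1)] q(2) by simp
      have rC: "r \<in> C" using closed[OF qC r(1)] r(2) by simp
      show ?thesis using tw_comp[OF True qC rC q(2) r(2)] tw_one[of p q r] True qC rC by (auto simp: m_def)
    next
      case False
      then have "q \<notin> C" using closed[of q p] p q by blast
      then show ?thesis using False by (simp add: m_def)
    qed
  qed
  obtain n I v \<phi> where D: "interval_decomp P M n I v \<phi>" using decomposable_posetD[OF dec M] .
  have vx: "v t x1 1 = 0" if t: "t < n" for t
  proof -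
    note s = interval_decompD(2)[OF D t] and f = interval_decompD(3)[OF D t]
    have IP: "p \<in> P" if "p \<in> I t" for p using is_intervalD(1)[OF interval_decompD(1)[OF D t]] that by auto
    have one: "\<phi> t p (v t p) = 1" if "p \<in> I t" for p using interval_decompD(4)[OF D t t that] by simp
    have nz: "v t p \<noteq> 0" if "p \<in> I t" for p
      using one[OF that] lin_fun_0[OF cosectD(1)[OF f IP[OF that]] rep_subspace[OF M IP[OF that]]] by auto
    have pl: "v t p \<in> plane" if "p \<in> C" for p using sectD(1)[OF s, of p] that CP by auto
    obtain a where a: "a \<in> I t" using is_intervalD(2)[OF interval_decompD(1)[OF D t]] by blast
    have aC: "a \<in> C" using sectD(1)[OF s IP[OF a]] nz[OF a] by (auto split: if_splits)
    \<comment> \<open>All maps between vertices of \<open>C\<close> are bijective, so a summand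
      alive at one vertex is alive at every comparable one.\<close>
    have all: "q \<in> I t" if q: "q \<in> C" for q
    proof (rule connected_poset_induct[OF conn aC q, of "\<lambda>q. q \<in> I t"])
      fix p r assume p: "p \<in> C" and r: "r \<in> C" and cmp: "p \<le> r \<or> r \<le> p" and pI: "p \<in> I t"
      have rP: "r \<in> P" using r CP by auto
      show "r \<in> I t"
        using cmp
      proof
        assume le: "p \<le> r"
        have "m p r (v t p) = v t r" using sectD(3)[OF s pI rP le] by simp
        moreover have "m p r (v t p) \<noteq> 0" using nz[OF pI] shear_eq_0[OF _ pl[OF p]] p r by (auto simp: m_def)
        ultimately show ?thesis using sectD(2)[OF s, of r] by auto
      next
        assume le: "r \<le> p"
        obtain u where u: "u \<in> plane" "m r p u = v t p"
          using shear_surj[OF pl[OF p]] pl[OF p] p r unfolding m_def by (cases "tw r p") auto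
        have "\<phi> t p (vmap M r p u) = \<phi> t r u" by (rule cosectD(3)[OF f pI rP le]) (use u r in simp)
        then have "\<phi> t r u = 1" using u(2) one[OF pI] by simp
        then show ?thesis using cosectD(2)[OF f, of r u] by auto
      qed
    qed (rule a)
    \<comment> \<open>Away from \<open>y\<close> no map is twisted, so the generator is constant
      along the path. Arriving at \<open>y\<close> from both sides then shows that it is fixed by
      the shear.\<close>
    have "v t x2 = v t x1"
      using path
    proof (induction rule: rtrancl_induct)
      case (step p r)
      then have p: "p \<in> C" "p \<noteq> y" and r: "r \<in> C" "r \<noteq> y" and cmp: "p \<le> r \<or> r \<le> p" by auto
      have "v t r = v t p"
        using cmp
      proof
        assume "p \<le> r"
        then show ?thesis using sectD(3)[OF s all[OF p(1)], of r] p r CP by (auto simp: m_def tw_def)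
      next
        assume "r \<le> p"
        then show ?thesis using sectD(3)[OF s all[OF r(1)], of p] p r CP by (auto simp: m_def tw_def)
      qed
      then show ?case using step.IH by simp
    qed simp
    moreover have "v t y = shear (v t x1)"
      using sectD(3)[OF s all[OF x1(1)], of y] y(1) CP x1(1) less_imp_le[OF x1(2)] less_imp_neq[OF x1(2)] by (auto simp: m_def tw_def)
    moreover have "v t y = v t x2"
      using sectD(3)[OF s all[OF x2(1)], of y] y(1) CP x2(1) less_imp_le[OF x2(2)] less_imp_neq[OF x2(2)] disj[OF x2(1)] by (auto simp: m_def tw_def)
    ultimately have "shear (v t x1) = v t x1" by simp
    then show "v t x1 1 = 0" using shear_simps(1)[of "v t x1"] by simp
  qed
  \<comment> \<open>All generators have second coordinate 0 at \<open>x1\<close>, so they cannot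
    combine to \<open>axis 1\<close>.\<close>
  have x1P: "x1 \<in> P" using x1(1) CP by auto
  have "axis 1 \<in> vspace M x1" using x1(1) axis_in_plane[of 1] by simp
  then have "(\<Sum>t<n. vscale (\<phi> t x1 (axis 1)) (v t x1)) = axis 1" by (rule interval_decompD(5)[OF D x1P])
  then have "(\<Sum>t<n. vscale (\<phi> t x1 (axis 1)) (v t x1)) 1 = (1 :: 'k)" by (simp add: axis_def)
  then show False using vx unfolding sum_fun_apply by (simp add: vscale_def)
qed

section \<open>Hasse diagrams of posets with only interval-decomposable modules\<close>

lemma hasse_adj_cases: "(a, b) \<in> hasse_adj C \<Longrightarrow> (a, b) \<in> snd (hasse C) \<or> (b, a) \<in> snd (hasse C)"
  by (auto simp: hasse_adj_def)

lemma hasse_adjI: "(a, b) \<in> snd (hasse C) \<Longrightarrow> (a, b) \<in> hasse_adj C" "(a, b) \<in> snd (hasse C) \<Longrightarrow> (b, a) \<in> hasse_adj C"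
  by (auto simp: hasse_adj_def)

lemma hasse_adj_sym: "(a, b) \<in> hasse_adj C \<Longrightarrow> (b, a) \<in> hasse_adj C"
  by (auto simp: hasse_adj_def)

lemma hasse_adj_mem: "(a, b) \<in> hasse_adj C \<Longrightarrow> a \<in> C \<and> b \<in> C \<and> a \<noteq> b"
  by (auto simp: hasse_adj_def in_hasse)

text \<open>Neighbours on the same side of \<open>x\<close> are incomparable, since \<open>x\<close>
  covers or is covered by each of them; this is all that the module of type \<open>D_4\<close>
  requires.\<close>

lemma at_most_two_neighbours:
  assumes dec: "decomposable_poset TYPE('k::field) P" and CP: "C \<subseteq> P"
    and nb: "(x, a) \<in> hasse_adj C" "(x, b) \<in> hasse_adj C" "(x, d) \<in> hasse_adj C" and ne: "a \<noteq> b" "a \<noteq> d"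
  shows "b = d"
proof (rule ccontr)
  assume bd: "b \<noteq> d"
  define y where "y i = (if i = 0 then a else if i = 1 then b else d)" for i :: nat
  have adj: "(x, y i) \<in> hasse_adj C" for i using nb by (simp add: y_def)
  have inj: "i = j" if "i < 3" "j < 3" "y i = y j" for i j
    using that ne bd by (auto simp: y_def split: if_splits)
  have "\<not> decomposable_poset TYPE('k) P"
  proof (rule three_neighbours_not_decomposable[of x P y])
    show "x \<in> P" "y i \<in> P" for i using hasse_adj_mem[OF adj] CP by auto
    show "y i < x \<or> x < y i" for i using hasse_adj_cases[OF adj] by (auto simp: in_hasse)
    fix i j assume ij: "i < (3::nat)" "j < (3::nat)" "y i \<le> y j"
    show "i = j" if lt: "y i < x" "y j < x"
    proof -
      have "(y i, x) \<in> snd (hasse C)" using hasse_adj_cases[OF adj[of i]] lt(1) by (auto simp: in_hasse)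
      then have "\<not> (y i < y j)" using lt(2) hasse_adj_mem[OF adj[of j]] by (auto simp: in_hasse)
      then show ?thesis using inj[OF ij(1,2)] ij(3) by (simp add: order.order_iff_strict)
    qed
    show "i = j" if lt: "x < y i" "x < y j"
    proof -
      have "(x, y j) \<in> snd (hasse C)" using hasse_adj_cases[OF adj[of j]] lt(2) by (auto simp: in_hasse)
      then have "\<not> (y i < y j)" using lt(1) hasse_adj_mem[OF adj[of i]] by (auto simp: in_hasse)
      then show ?thesis using inj[OF ij(1,2)] ij(3) by (simp add: order.order_iff_strict)
    qed
  qed
  then show False using dec by blast
qed

section \<open>Connected graphs of degree at most two\<close>

definition simple_path :: "'v set \<Rightarrow> ('v \<times> 'v) set \<Rightarrow> 'v list \<Rightarrow> bool" where
  "simple_path C G xs \<longleftrightarrow> xs \<noteq> [] \<and> distinct xs \<and> set xs \<subseteq> C \<and> (\<forall>i. Suc i < length xs \<longrightarrow> (xs ! i, xs ! Suc i) \<in> G)"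

text \<open>A longest simple path is closed under adjacency: at its ends by maximality, at inner
  vertices because their two neighbours are used up. By connectedness it is everything, and the same
  count leaves room for only one further edge, between the ends. The condition \<open>deg\<close>
  excludes three different neighbours.\<close>

lemma path_or_cycle:
  assumes fin: "finite C" and ne: "C \<noteq> {}"
    and sym: "\<And>a b. (a, b) \<in> G \<Longrightarrow> (b, a) \<in> G" and mem: "\<And>a b. (a, b) \<in> G \<Longrightarrow> a \<in> C \<and> b \<in> C \<and> a \<noteq> b"
    and conn: "\<And>p q. p \<in> C \<Longrightarrow> q \<in> C \<Longrightarrow> (p, q) \<in> G\<^sup>*"
    and deg: "\<And>x a b d. (x, a) \<in> G \<Longrightarrow> (x, b) \<in> G \<Longrightarrow> (x, d) \<in> G \<Longrightarrow> a \<noteq> b \<Longrightarrow> a \<noteq> d \<Longrightarrow> b = d"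
  obtains xs where "distinct xs" "set xs = C" "\<And>i. Suc i < length xs \<Longrightarrow> (xs ! i, xs ! Suc i) \<in> G"
    "\<And>i j. i < j \<Longrightarrow> j < length xs \<Longrightarrow> (xs ! i, xs ! j) \<in> G \<Longrightarrow> j = Suc i \<or> i = 0 \<and> Suc j = length xs"
proof -
  obtain c where c: "c \<in> C" using ne by blast
  have "\<exists>xs. simple_path C G xs \<and> (\<forall>ys. simple_path C G ys \<longrightarrow> length ys \<le> length xs)"
  proof (rule ex_has_greatest_nat[of _ "[c]" _ "Suc (card C)"])
    show "simple_path C G [c]" using c by (simp add: simple_path_def)
    show "\<forall>ys. simple_path C G ys \<longrightarrow> length ys < Suc (card C)"
      using card_mono[OF fin] distinct_card by (metis le_imp_less_Suc simple_path_def)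
  qed
  then obtain xs where xs: "simple_path C G xs" and mx: "\<And>ys. simple_path C G ys \<Longrightarrow> length ys \<le> length xs" by blast
  have d: "distinct xs" "set xs \<subseteq> C" "xs \<noteq> []" using xs unfolding simple_path_def by auto
  define n where "n = length xs"
  have n: "0 < n" using d(3) by (simp add: n_def)
  have e: "(xs ! i, xs ! Suc i) \<in> G" if "Suc i < n" for i using xs that unfolding simple_path_def n_def by blast
  have e': "(xs ! Suc i, xs ! i) \<in> G" if "Suc i < n" for i by (rule sym[OF e[OF that]])
  have inj: "i = j" if "xs ! i = xs ! j" "i < n" "j < n" for i j
    using nth_eq_iff_index_eq[OF d(1)] that by (simp add: n_def)
  have nbr: "z \<in> set xs" if i: "i < n" and z: "(xs ! i, z) \<in> G" for i z
  proof (rule ccontr)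
    assume nz: "z \<notin> set xs"
    have zC: "z \<in> C" using mem[OF z] by simp
    have not0: "i \<noteq> 0"
    proof
      assume "i = 0"
      then have "simple_path C G (z # xs)"
        unfolding simple_path_def using d nz zC sym[OF z] e by (auto simp: nth_Cons n_def split: nat.splits)
      then show False using mx by fastforce
    qed
    have "Suc i \<noteq> n"
    proof
      assume si: "Suc i = n"
      have "simple_path C G (xs @ [z])"
        unfolding simple_path_def
      proof (intro conjI allI impI)
        fix j assume j: "Suc j < length (xs @ [z])"
        show "((xs @ [z]) ! j, (xs @ [z]) ! Suc j) \<in> G"
        proof (cases "Suc j < n")
          case True
          then show ?thesis using e by (simp add: nth_append n_def)
        next
          case False
          then have "j = i" using j si by (simp add: n_def)
          then show ?thesis using z si by (simp add: nth_append n_def)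
        qed
      qed (use d nz zC in auto)
      then show False using mx by fastforce
    qed
    then have si: "Suc i < n" using i by simp
    obtain i' where i': "i = Suc i'" using not0 by (cases i) auto
    have "xs ! i' \<noteq> xs ! Suc i" using inj[of i' "Suc i"] si i' by auto
    moreover have "xs ! i' \<noteq> z" "xs ! Suc i \<noteq> z" using nz si i' by (auto simp: n_def)
    ultimately show False using deg[of "xs ! i" "xs ! i'" "xs ! Suc i" z] e[OF si] e'[of i'] z i' i by auto
  qed
  have set: "set xs = C"
  proof
    show "C \<subseteq> set xs"
    proof
      fix q assume q: "q \<in> C"
      have "(xs ! 0, q) \<in> G\<^sup>*" using conn[OF _ q] d(2) n by (simp add: n_def subset_iff)
      then show "q \<in> set xs"
      proof (induction rule: rtrancl_induct)
        case base show ?case using n by (simp add: n_def)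
      next
        case (step a b)
        then obtain i where "i < n" "xs ! i = a" by (auto simp: in_set_conv_nth n_def)
        then show ?case using nbr step.hyps(2) by blast
      qed
    qed
  qed (rule d(2))
  \<comment> \<open>Any other chord has an endpoint that is an inner vertex, and gives it a third
    neighbour.\<close>
  have "j = Suc i \<or> i = 0 \<and> Suc j = n" if ij: "i < j" "j < n" and g: "(xs ! i, xs ! j) \<in> G" for i j
  proof (rule ccontr)
    assume neg: "\<not> ?thesis"
    show False
    proof (cases i)
      case (Suc i')
      have "xs ! i' \<noteq> xs ! Suc i" "xs ! i' \<noteq> xs ! j" "xs ! Suc i \<noteq> xs ! j"
        using inj[of i' "Suc i"] inj[of i' j] inj[of "Suc i" j] Suc ij neg by auto
      then show False using deg[of "xs ! i" "xs ! i'" "xs ! Suc i" "xs ! j"] e[of i] e'[of i'] g ij Suc neg by auto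
    next
      case 0
      then have sj: "Suc j < n" using neg ij by auto
      obtain j' where j': "j = Suc j'" using ij by (cases j) auto
      have "xs ! j' \<noteq> xs ! Suc j" "xs ! j' \<noteq> xs ! i" "xs ! Suc j \<noteq> xs ! i"
        using inj[of j' "Suc j"] inj[of j' i] inj[of "Suc j" i] 0 ij j' neg sj by auto
      then show False using deg[of "xs ! j" "xs ! j'" "xs ! Suc j" "xs ! i"] e[of j] e'[of j'] sym[OF g] ij j' sj by auto
    qed
  qed
  then show thesis using that[OF d(1) set] e unfolding n_def by blast
qed

text \<open>List positions start at 0 and the vertices of \<open>A_quiver\<close> at 1, whence the
  shift by one. The orientation \<open>a\<close> is read off from the direction of the
  covers.\<close>

lemma path_good_diagram:
  fixes C :: "'a::order set"
  assumes xs: "distinct xs" "set xs = C" "\<And>i. Suc i < length xs \<Longrightarrow> (xs ! i, xs ! Suc i) \<in> hasse_adj C"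
    and only: "\<And>i j. i < j \<Longrightarrow> j < length xs \<Longrightarrow> (xs ! i, xs ! j) \<in> hasse_adj C \<Longrightarrow> j = Suc i"
  shows "good_diagram (hasse C)"
proof -
  define n where "n = length xs"
  define a where "a i \<longleftrightarrow> (xs ! (i - 1), xs ! i) \<in> snd (hasse C)" for i
  define f where "f i = xs ! (i - 1)" for i
  have asym: "(u, v) \<in> snd (hasse C) \<Longrightarrow> (v, u) \<notin> snd (hasse C)" for u v
    by (auto simp: in_hasse)
  have "quiver_iso (A_quiver n a) (hasse C)"
    unfolding quiver_iso_def
  proof (intro exI[of _ f] conjI ballI)
    have "bij_betw (\<lambda>i. xs ! i) {..<n} C" using bij_betw_nth[OF xs(1)] xs(2) n_def by blast
    moreover have "bij_betw (\<lambda>i. i - 1) {1..n} {..<n}"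
      by (rule bij_betw_byWitness[of _ Suc]) auto
    ultimately have "bij_betw ((\<lambda>i. xs ! i) \<circ> (\<lambda>i. i - 1)) {1..n} C" by (rule bij_betw_trans[rotated])
    then show "bij_betw f (fst (A_quiver n a)) (fst (hasse C))"
      by (simp add: A_quiver_def f_def[abs_def] comp_def)
    fix i j assume "i \<in> fst (A_quiver n a)" "j \<in> fst (A_quiver n a)"
    then have ij: "1 \<le> i" "i \<le> n" "1 \<le> j" "j \<le> n" by (auto simp: A_quiver_def)
    have A: "(i, j) \<in> snd (A_quiver n a) \<longleftrightarrow> (j = i + 1 \<and> a i) \<or> (i = j + 1 \<and> \<not> a j)"
      using ij by (auto simp: A_quiver_def)
    show "(i, j) \<in> snd (A_quiver n a) \<longleftrightarrow> (f i, f j) \<in> snd (hasse C)"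
    proof
      assume "(i, j) \<in> snd (A_quiver n a)"
      then consider "j = i + 1" "a i" | "i = j + 1" "\<not> a j" using A by blast
      then show "(f i, f j) \<in> snd (hasse C)"
      proof cases
        case 1
        then show ?thesis by (simp add: f_def a_def)
      next
        case 2
        have "(xs ! (j - 1), xs ! j) \<in> hasse_adj C" using xs(3)[of "j - 1"] ij 2 by (simp add: n_def)
        then show ?thesis using hasse_adj_cases 2 by (fastforce simp: f_def a_def)
      qed
    next
      assume e: "(f i, f j) \<in> snd (hasse C)"
      consider "i < j" | "i = j" | "j < i" by linarith
      then show "(i, j) \<in> snd (A_quiver n a)"
      proof cases
        case 1
        have "j - 1 = Suc (i - 1)" using only[of "i - 1" "j - 1"] hasse_adjI(1)[OF e] 1 ij by (simp add: f_def n_def)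
        then have "j = i + 1" using ij 1 by simp
        then show ?thesis using A e by (simp add: a_def f_def)
      next
        case 2
        then show ?thesis using e by (simp add: in_hasse)
      next
        case 3
        have "i - 1 = Suc (j - 1)" using only[of "j - 1" "i - 1"] hasse_adjI(2)[OF e] 3 ij by (simp add: f_def n_def)
        then have "i = j + 1" using ij 3 by simp
        then show ?thesis using A e asym[OF e] by (simp add: a_def f_def)
      qed
    qed
  qed
  then show ?thesis unfolding good_diagram_def using quiver_iso_sym by blast
qed

text \<open>The cycle is numbered with its maximum at \<open>Suc m\<close> and its minimum at
  \<open>i\<close>. One side of the order runs through \<open>i - 1\<close> down to 0 and has
  \<open>i\<close> inner vertices, the other through \<open>i + 1\<close> up to \<open>m\<close> and
  has \<open>m - i\<close>; so this is the diagram of \<open>C_poset i (m - i)\<close>.\<close>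

lemma cycle_good_diagram:
  fixes C :: "'a::order set"
  assumes ys: "bij_betw ys {..Suc m} C" and i: "0 < i" "i < m"
    and E: "\<And>r s. r \<le> Suc m \<Longrightarrow> s \<le> Suc m \<Longrightarrow> (ys r, ys s) \<in> snd (hasse C) \<longleftrightarrow>
      (r = Suc s \<and> r \<le> i) \<or> (s = Suc r \<and> i \<le> r \<and> s \<le> m) \<or> (s = Suc m \<and> (r = 0 \<or> r = m))"
  shows "good_diagram (hasse C)"
proof -
  define k where "k z = (case z of Hat0 \<Rightarrow> i | Hat1 \<Rightarrow> Suc m | Unprimed j \<Rightarrow> i - j | Primed j \<Rightarrow> i + j)" for z
  let ?K = "C_poset i (m - i)"
  have mem: "z = Hat0 \<or> z = Hat1 \<or> (\<exists>j. z = Unprimed j \<and> 1 \<le> j \<and> j \<le> i) \<or> (\<exists>j. z = Primed j \<and> 1 \<le> j \<and> j \<le> m - i)"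
    if "z \<in> ?K" for z using that by (auto simp: C_poset_def)
  have kb: "k z \<le> Suc m" if "z \<in> ?K" for z using mem[OF that] i by (auto simp: k_def)
  have kbij: "bij_betw k ?K {..Suc m}"
    unfolding bij_betw_def
  proof
    show "inj_on k ?K"
    proof (rule inj_onI)
      fix u v assume "u \<in> ?K" "v \<in> ?K" "k u = k v"
      then show "u = v" using mem[of u] mem[of v] i by (auto simp: k_def)
    qed
    show "k ` ?K = {..Suc m}"
    proof
      show "k ` ?K \<subseteq> {..Suc m}" using kb by auto
      show "{..Suc m} \<subseteq> k ` ?K"
      proof
        fix r assume r: "r \<in> {..Suc m}"
        consider "r < i" | "r = i" | "i < r" "r \<le> m" | "r = Suc m" using r by (auto, linarith)
        then show "r \<in> k ` ?K"
        proof cases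
          case 1
          then have "r = k (Unprimed (i - r))" "i - r \<in> {1..i}" by (auto simp: k_def)
          then have "r = k (Unprimed (i - r))" "Unprimed (i - r) \<in> ?K" unfolding C_poset_def by blast+
          then show ?thesis by (rule image_eqI)
        next
          case 2
          then have "r = k Hat0" "Hat0 \<in> ?K" by (auto simp: k_def C_poset_def)
          then show ?thesis by (rule image_eqI)
        next
          case 3
          then have "r = k (Primed (r - i))" "r - i \<in> {1..m - i}" by (auto simp: k_def)
          then have "r = k (Primed (r - i))" "Primed (r - i) \<in> ?K" unfolding C_poset_def by blast+
          then show ?thesis by (rule image_eqI)
        next
          case 4
          then have "r = k Hat1" "Hat1 \<in> ?K" by (auto simp: k_def C_poset_def)
          then show ?thesis by (rule image_eqI)
        qed
      qed
    qed
  qed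
  have edges: "(u, v) \<in> snd (hasse ?K) \<longleftrightarrow>
      (k u = Suc (k v) \<and> k u \<le> i) \<or> (k v = Suc (k u) \<and> i \<le> k u \<and> k v \<le> m) \<or> (k v = Suc m \<and> (k u = 0 \<or> k u = m))"
    if "u \<in> ?K" "v \<in> ?K" for u v
  proof -
    have "0 < i" "0 < m - i" using i by auto
    show ?thesis
      unfolding hasse_C_poset[OF \<open>0 < i\<close> \<open>0 < m - i\<close>]
      using mem[OF that(1)] mem[OF that(2)] i
      by (elim disjE exE conjE) (auto simp: k_def)
  qed
  have "quiver_iso (hasse ?K) (hasse C)"
    unfolding quiver_iso_def
  proof (intro exI[of _ "ys \<circ> k"] conjI ballI)
    show "bij_betw (ys \<circ> k) (fst (hasse ?K)) (fst (hasse C))"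
      using bij_betw_trans[OF kbij ys] by simp
    fix u v assume "u \<in> fst (hasse ?K)" "v \<in> fst (hasse ?K)"
    then have uv: "u \<in> ?K" "v \<in> ?K" by simp_all
    show "(u, v) \<in> snd (hasse ?K) \<longleftrightarrow> ((ys \<circ> k) u, (ys \<circ> k) v) \<in> snd (hasse C)"
      unfolding edges[OF uv] comp_def using E[OF kb[OF uv(1)] kb[OF uv(2)]] by simp
  qed
  then have "quiver_iso (hasse C) (hasse ?K)" by (rule quiver_iso_sym)
  then show ?thesis unfolding good_diagram_def using i by (intro disjI2 exI[of _ i] exI[of _ "m - i"]) simp
qed

lemma add_mod_cancel:
  fixes r s :: nat
  assumes "(a + r) mod n = (a + s) mod n" "r < n" "s < n"
  shows "r = s"
proof -
  have "r = s" if h: "r \<le> s" "(a + r) mod n = (a + s) mod n" "s < n" for r s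
  proof -
    have "n dvd (a + s) - (a + r)" using mod_eq_dvd_iff_nat[of "a + r" "a + s" n] h by simp
    then have "n dvd s - r" by simp
    then show ?thesis using h nat_dvd_not_less[of "s - r" n] by (cases "r = s") auto
  qed
  from this[of r s] this[of s r] show ?thesis using assms by (cases "r \<le> s") auto
qed

text \<open>By the degree bound the diagram is a path or a cycle. A cycle is numbered so that a
  maximal element \<open>y\<close> comes last; its neighbours are then \<open>ys 0\<close> and
  \<open>ys m\<close>. If these have no common lower bound, the twisted module contradicts
  decomposability; otherwise a common lower bound is the only source.\<close>

lemma decomposable_component_good:
  fixes P :: "'a::order set"
  assumes fin: "finite P" and dec: "decomposable_poset TYPE('k::field) P" and comp: "hasse_component P C"
  shows "good_diagram (hasse C)"
proof -
  note cD = hasse_componentD[OF comp]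
  have finC: "finite C" using finite_subset[OF cD(1) fin] .
  note deg = at_most_two_neighbours[OF dec cD(1)]
  have "\<exists>xs. distinct xs \<and> set xs = C \<and> (\<forall>i. Suc i < length xs \<longrightarrow> (xs ! i, xs ! Suc i) \<in> hasse_adj C) \<and>
    (\<forall>i j. i < j \<longrightarrow> j < length xs \<longrightarrow> (xs ! i, xs ! j) \<in> hasse_adj C \<longrightarrow> j = Suc i \<or> i = 0 \<and> Suc j = length xs)"
  proof (rule path_or_cycle[OF finC cD(2), of "hasse_adj C"])
    show "b = d" if "(x, a) \<in> hasse_adj C" "(x, b) \<in> hasse_adj C" "(x, d) \<in> hasse_adj C" "a \<noteq> b" "a \<noteq> d" for x a b d
      by (rule deg[OF that])
    show "(b, a) \<in> hasse_adj C" if "(a, b) \<in> hasse_adj C" for a b by (rule hasse_adj_sym[OF that])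
    show "a \<in> C \<and> b \<in> C \<and> a \<noteq> b" if "(a, b) \<in> hasse_adj C" for a b by (rule hasse_adj_mem[OF that])
    show "(p, q) \<in> (hasse_adj C)\<^sup>*" if "p \<in> C" "q \<in> C" for p q by (rule cD(4)[OF that])
    fix xs assume h: "distinct xs" "set xs = C" "\<And>i. Suc i < length xs \<Longrightarrow> (xs ! i, xs ! Suc i) \<in> hasse_adj C"
      "\<And>i j. i < j \<Longrightarrow> j < length xs \<Longrightarrow> (xs ! i, xs ! j) \<in> hasse_adj C \<Longrightarrow> j = Suc i \<or> i = 0 \<and> Suc j = length xs"
    show ?thesis by (intro exI[of _ xs] conjI allI impI) (fact h)+
  qed
  then obtain xs where xs: "distinct xs" "set xs = C" and "\<forall>i. Suc i < length xs \<longrightarrow> (xs ! i, xs ! Suc i) \<in> hasse_adj C"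
    and "\<forall>i j. i < j \<longrightarrow> j < length xs \<longrightarrow> (xs ! i, xs ! j) \<in> hasse_adj C \<longrightarrow> j = Suc i \<or> i = 0 \<and> Suc j = length xs"
    by blast
  then have xs: "distinct xs" "set xs = C" "\<And>i. Suc i < length xs \<Longrightarrow> (xs ! i, xs ! Suc i) \<in> hasse_adj C"
    and only: "\<And>i j. i < j \<Longrightarrow> j < length xs \<Longrightarrow> (xs ! i, xs ! j) \<in> hasse_adj C \<Longrightarrow> j = Suc i \<or> i = 0 \<and> Suc j = length xs"
    by simp_all
  define n where "n = length xs"
  have n0: "0 < n" using xs(2) cD(2) by (auto simp: n_def)
  show ?thesis
  \<comment> \<open>For \<open>n = 2\<close> the edge between first and last vertex is the path edge
    itself, so a genuine cycle needs \<open>3 \<le> n\<close>.\<close>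
  proof (cases "3 \<le> n \<and> (xs ! 0, xs ! (n - 1)) \<in> hasse_adj C")
    case False
    show ?thesis
    proof (rule path_good_diagram[OF xs])
      fix i j assume h: "i < j" "j < length xs" "(xs ! i, xs ! j) \<in> hasse_adj C"
      show "j = Suc i"
      proof (rule ccontr)
        assume "j \<noteq> Suc i"
        then have "i = 0" "Suc j = n" "j \<noteq> 1" using only[OF h] by (auto simp: n_def)
        then have "3 \<le> n" "j = n - 1" using h(1) by auto
        then show False using False h(3) \<open>i = 0\<close> by simp
      qed
    qed
  next
    case True
    obtain y where yC: "y \<in> C" and ymax: "\<And>p. p \<in> C \<Longrightarrow> y \<le> p \<Longrightarrow> p = y"
      using finite_has_maximal[OF finC cD(2)] by metis
    obtain k where k: "k < n" "xs ! k = y" using yC xs(2) by (auto simp: in_set_conv_nth n_def)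
    \<comment> \<open>Rotation by \<open>Suc k\<close> moves \<open>y\<close> from position
      \<open>k\<close> to the last position \<open>n - 1\<close>.\<close>
    define ys where "ys i = xs ! ((Suc k + i) mod n)" for i
    obtain m where m: "n = Suc (Suc m)" "0 < m" using True by (cases n; cases "n - 1") auto
    have ymn: "ys (Suc m) = y"
    proof -
      have "Suc k + Suc m = k + n" using m by simp
      then show ?thesis using k unfolding ys_def by (simp only: mod_add_self2 mod_less)
    qed
    have xadj: "(xs ! i, xs ! (Suc i mod n)) \<in> hasse_adj C" if "i < n" for i
    proof (cases "Suc i = n")
      case True': True
      then show ?thesis using True hasse_adj_sym[of "xs ! 0"] by auto
    next
      case False
      then show ?thesis using xs(3)[of i] that by (simp add: n_def)
    qed
    have yadj: "(ys i, ys (Suc i)) \<in> hasse_adj C" for i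
    proof -
      have "(Suc k + Suc i) mod n = Suc ((Suc k + i) mod n) mod n" by (simp add: mod_Suc_eq)
      then show ?thesis unfolding ys_def using xadj[of "(Suc k + i) mod n"] n0 by simp
    qed
    have yadj0: "(y, ys 0) \<in> hasse_adj C"
    proof -
      have "ys (Suc (Suc m)) = ys 0" unfolding ys_def m(1)[symmetric] mod_add_self2 by simp
      then show ?thesis using yadj[of "Suc m"] ymn by simp
    qed
    have inj: "r = s" if "ys r = ys s" "r < n" "s < n" for r s
    proof -
      have "(Suc k + r) mod n = (Suc k + s) mod n"
        using that(1) nth_eq_iff_index_eq[OF xs(1)] n0 unfolding ys_def by (simp add: n_def)
      then show ?thesis using that(2,3) by (rule add_mod_cancel)
    qed
    have bij: "bij_betw ys {..Suc m} C"
    proof -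
      have i: "inj_on ys {..Suc m}" using inj m by (auto intro!: inj_onI)
      have "ys ` {..Suc m} \<subseteq> C" using n0 xs(2) by (auto simp: ys_def n_def)
      moreover have "card C = card {..Suc m}" using xs(1,2) m distinct_card[of xs] by (simp add: n_def)
      ultimately have "ys ` {..Suc m} = C" using card_image[OF i] by (intro card_subset_eq[OF finC]) simp_all
      then show ?thesis using i by (simp add: bij_betw_def)
    qed
    have ysC: "ys r \<in> C" if "r \<le> Suc m" for r using bij_betwE[OF bij] that by auto
    have idx: "\<exists>r\<le>Suc m. p = ys r" if "p \<in> C" for p
      using bij_betw_imp_surj_on[OF bij] that by (metis atMost_iff imageE)
    have idx': "\<exists>r\<le>m. p = ys r" if "p \<in> C" "p \<noteq> y" for p
      using idx[OF that(1)] ymn that(2) le_Suc_eq by metis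
    have ney: "ys r \<noteq> y" if "r \<le> m" for r using inj[of r "Suc m"] ymn that m by auto
    have ynbr: "z = ys 0 \<or> z = ys m" if "(y, z) \<in> hasse_adj C" for z
    proof (rule ccontr)
      assume neg: "\<not> ?thesis"
      have "(y, ys m) \<in> hasse_adj C" using hasse_adj_sym[OF yadj[of m]] ymn by simp
      moreover have "ys 0 \<noteq> ys m" using inj[of 0 m] m by auto
      ultimately show False using deg[OF yadj0 _ that, of "ys m"] neg by auto
    qed
    have nbr: "s = Suc r" if rs: "r < s" "s \<le> m" and g: "(ys r, ys s) \<in> hasse_adj C" for r s
    proof (rule ccontr)
      assume neg: "s \<noteq> Suc r"
      obtain z where z: "(ys r, z) \<in> hasse_adj C" "z \<noteq> ys (Suc r)" "z \<noteq> ys s"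
      proof (cases r)
        case 0
        have "(ys r, y) \<in> hasse_adj C" using hasse_adj_sym[OF yadj0] 0 by simp
        moreover have "y \<noteq> ys (Suc r)" "y \<noteq> ys s" using ney[of "Suc r"] ney[of s] rs by auto
        ultimately show ?thesis by (rule that)
      next
        case (Suc r')
        have "(ys r, ys r') \<in> hasse_adj C" using hasse_adj_sym[OF yadj[of r']] Suc by simp
        moreover have "ys r' \<noteq> ys (Suc r)" "ys r' \<noteq> ys s" using inj[of r' "Suc r"] inj[of r' s] Suc rs m by auto
        ultimately show ?thesis by (rule that)
      qed
      have "ys (Suc r) = ys s" by (rule deg[OF z(1) yadj g z(2,3)])
      then show False using inj[of "Suc r" s] rs m neg by auto
    qed
    \<comment> \<open>Nothing passes through the maximal element \<open>y\<close> on the way to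
      another vertex, so a relation between two positions up to \<open>m\<close> uses every edge
      between them, in its own direction. Relations toward smaller indices are treated here, those
      toward larger ones in \<open>up\<close>.\<close>
    have down: "(ys (Suc r), ys r) \<in> snd (hasse C)" if h: "ys s \<le> ys t" "t \<le> r" "r < s" "s \<le> m" for r s t
    proof -
      have "t \<le> m" using h by simp
      then have tC: "ys t \<in> C" and sC: "ys s \<in> C" using ysC h by auto
      let ?Q = "\<lambda>u. \<exists>q. r < q \<and> q \<le> m \<and> u = ys q"
      have nQ: "\<not> ?Q (ys t)" using inj[of t] h m by auto
      have Q: "?Q (ys s)" using h by auto
      obtain u v where uv: "(u, v) \<in> snd (hasse C)" "?Q u" "\<not> ?Q v" "ys s \<le> u" "v \<le> ys t"
        by (rule hasse_crossing[OF finC sC tC h(1), of ?Q, OF Q nQ])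
      have vC: "v \<in> C" using uv(1) by (simp add: in_hasse)
      have "v \<noteq> y" using ymax[OF tC] uv(5) ney[OF \<open>t \<le> m\<close>] by auto
      then obtain p where p: "p \<le> m" "v = ys p" using idx'[OF vC] by auto
      obtain q where q: "r < q" "q \<le> m" "u = ys q" using uv(2) by auto
      have "p \<le> r" using uv(3) p not_le by blast
      then have "q = Suc p" using nbr[of p q] hasse_adjI(2)[OF uv(1)] p q by simp
      then have "p = r" "q = Suc r" using q(1) \<open>p \<le> r\<close> by auto
      then show ?thesis using uv(1) p q by simp
    qed
    have up: "(ys r, ys (Suc r)) \<in> snd (hasse C)" if h: "ys s \<le> ys t" "s \<le> r" "r < t" "t \<le> m" for r s t
    proof -
      have "s \<le> m" using h by simp
      then have tC: "ys t \<in> C" and sC: "ys s \<in> C" using ysC h by auto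
      let ?Q = "\<lambda>u. \<exists>q. q \<le> r \<and> u = ys q"
      have nQ: "\<not> ?Q (ys t)"
      proof
        assume "?Q (ys t)"
        then obtain q where "q \<le> r" "ys t = ys q" by blast
        then show False using inj[of t q] h m by auto
      qed
      have Q: "?Q (ys s)" using h by auto
      obtain u v where uv: "(u, v) \<in> snd (hasse C)" "?Q u" "\<not> ?Q v" "ys s \<le> u" "v \<le> ys t"
        by (rule hasse_crossing[OF finC sC tC h(1), of ?Q, OF Q nQ])
      have vC: "v \<in> C" using uv(1) by (simp add: in_hasse)
      have "v \<noteq> y" using ymax[OF tC] uv(5) ney[OF h(4)] by auto
      then obtain p where p: "p \<le> m" "v = ys p" using idx'[OF vC] by auto
      obtain q where q: "q \<le> r" "u = ys q" using uv(2) by auto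
      have "r < p" using uv(3) p not_le by blast
      then have "p = Suc q" using nbr[of q p] hasse_adjI(1)[OF uv(1)] p q by simp
      then have "q = r" "p = Suc r" using q(1) \<open>r < p\<close> by auto
      then show ?thesis using uv(1) p q by simp
    qed
    have E0: "(ys 0, y) \<in> snd (hasse C)"
      using hasse_adj_cases[OF yadj0] ymax[OF ysC[of 0]] ney[of 0] by (auto simp: in_hasse less_imp_le)
    have Em: "(ys m, y) \<in> snd (hasse C)"
      using hasse_adj_cases[OF yadj[of m]] ymn ymax[OF ysC[of m]] ney[of m] by (auto simp: in_hasse less_imp_le)
    show ?thesis
    proof (cases "\<exists>a\<in>C. a \<le> ys 0 \<and> a \<le> ys m")
      case False
      have "\<not> decomposable_poset TYPE('k) P"
      proof (rule cycle_not_decomposable[where ?x1.0 = "ys 0" and ?x2.0 = "ys m", OF cD(1) _ _ yC])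
        show "q \<in> C" if "p \<in> C" "q \<in> P" "p \<le> q \<or> q \<le> p" for p q by (rule cD(3)[OF that])
        show "p = y" if "p \<in> C" "y \<le> p" for p by (rule ymax[OF that])
        show "connected_poset C"
          unfolding connected_poset_def
        proof (intro ballI)
          fix p q assume "p \<in> C" "q \<in> C"
          then have "(p, q) \<in> (hasse_adj C)\<^sup>*" by (rule cD(4))
          moreover have "hasse_adj C \<subseteq> {(u, v). u \<in> C \<and> v \<in> C \<and> (u \<le> v \<or> v \<le> u)}"
            by (auto simp: hasse_adj_def in_hasse less_imp_le)
          ultimately show "(p, q) \<in> {(u, v). u \<in> C \<and> v \<in> C \<and> (u \<le> v \<or> v \<le> u)}\<^sup>*"
            using rtrancl_mono by blast
        qed
        show "ys 0 \<in> C" "ys m \<in> C" using ysC by auto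
        show "ys 0 < y" "ys m < y" using E0 Em by (auto simp: in_hasse)
        show "p \<le> ys 0 \<or> p \<le> ys m" if p: "p \<in> C" "p < y" for p
        proof -
          obtain u v where uv: "(u, v) \<in> snd (hasse C)" "u \<noteq> y" "\<not> v \<noteq> y" "p \<le> u"
            using hasse_crossing[OF finC p(1) yC less_imp_le[OF p(2)], of "\<lambda>u. u \<noteq> y"] p(2) by auto
          then show ?thesis using ynbr[of u] hasse_adjI(2)[OF uv(1)] by auto
        qed
        show "\<not> (p \<le> ys 0 \<and> p \<le> ys m)" if "p \<in> C" for p using False that by blast
        let ?R = "{(u, v). u \<in> C - {y} \<and> v \<in> C - {y} \<and> (u \<le> v \<or> v \<le> u)}"
        have "(ys 0, ys r) \<in> ?R\<^sup>*" if "r \<le> m" for r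
          using that
        proof (induction r)
          case (Suc r)
          have "ys r \<le> ys (Suc r) \<or> ys (Suc r) \<le> ys r"
            using hasse_adj_cases[OF yadj[of r]] by (auto simp: in_hasse less_imp_le)
          then have "(ys r, ys (Suc r)) \<in> ?R" using Suc.prems ysC[of r] ysC[of "Suc r"] ney[of r] ney[of "Suc r"] by auto
          then show ?case using Suc by (meson Suc_leD rtrancl_into_rtrancl)
        qed simp
        then show "(ys 0, ys m) \<in> ?R\<^sup>*" by blast
      qed
      then show ?thesis using dec by blast
    next
      case True
      then obtain a where a: "a \<in> C" "a \<le> ys 0" "a \<le> ys m" by blast
      have "a \<noteq> y" using a(2) ymax[OF ysC[of 0]] ney[of 0] by auto
      then obtain i where i: "i \<le> m" "a = ys i" using idx'[OF a(1)] by auto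
      have lt0: "ys 0 < y" and ltm: "ys m < y" using E0 Em by (auto simp: in_hasse)
      have ne0m: "ys 0 \<noteq> ys m" using inj[of 0 m] m by auto
      \<comment> \<open>If \<open>a\<close> were one neighbour of \<open>y\<close>, the other would
        lie strictly between it and \<open>y\<close>, against the covering.\<close>
      have "i \<noteq> 0"
      proof
        assume "i = 0"
        then have "ys 0 < ys m" using a i ne0m by (simp add: order.not_eq_order_implies_strict)
        then show False using E0 ltm ysC[of m] by (auto simp: in_hasse)
      qed
      moreover have "i \<noteq> m"
      proof
        assume "i = m"
        then have "ys m < ys 0" using a i ne0m by (simp add: order.not_eq_order_implies_strict)
        then show False using Em lt0 ysC[of 0] by (auto simp: in_hasse)
      qed
      ultimately have i': "0 < i" "i < m" using i by auto
      \<comment> \<open>The relations from \<open>a\<close> to both neighbours of \<open>y\<close>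
        direct all edges of the path away from \<open>a\<close>.\<close>
      have dn: "(ys (Suc r), ys r) \<in> snd (hasse C)" if "r < i" for r
        using down[of i 0 r] a(2) i that by simp
      have uu: "(ys r, ys (Suc r)) \<in> snd (hasse C)" if "i \<le> r" "r < m" for r
        using up[of i m r] a(3) i that by simp
      have asym: "(v, u) \<notin> snd (hasse C)" if "(u, v) \<in> snd (hasse C)" for u v
        using that by (auto simp: in_hasse)
      show ?thesis
      proof (rule cycle_good_diagram[OF bij i'])
        fix r s assume r: "r \<le> Suc m" and s: "s \<le> Suc m"
        show "(ys r, ys s) \<in> snd (hasse C) \<longleftrightarrow>
          (r = Suc s \<and> r \<le> i) \<or> (s = Suc r \<and> i \<le> r \<and> s \<le> m) \<or> (s = Suc m \<and> (r = 0 \<or> r = m))"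
          (is "?L \<longleftrightarrow> ?R")
        proof
          assume ?R
          then show ?L using dn[of s] uu[of r] E0 Em ymn by auto
        next
          assume e: ?L
          have lt: "ys r < ys s" using e by (simp add: in_hasse)
          have rm: "r \<le> m"
          proof (rule ccontr)
            assume "\<not> r \<le> m"
            then have "r = Suc m" using r by simp
            then have "y < ys s" using lt ymn by simp
            then show False using ymax[OF ysC[OF s] less_imp_le] by auto
          qed
          show ?R
          proof (cases "s = Suc m")
            case True
            then have "ys r = ys 0 \<or> ys r = ys m" using ynbr[of "ys r"] hasse_adjI(2)[OF e] ymn by simp
            then have "r = 0 \<or> r = m" using inj[of r 0] inj[of r m] rm m by auto
            then show ?thesis using True by simp
          next
            case False
            then have sm: "s \<le> m" using s by simp
            consider "r < s" | "s < r" using lt by (cases "r = s") (auto, linarith)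
            then show ?thesis
            proof cases
              case 1
              then have sr: "s = Suc r" using nbr[of r s] hasse_adjI(1)[OF e] sm by simp
              then have "i \<le> r" using asym[OF e] dn[of r] by (meson not_le)
              then show ?thesis using sr sm by simp
            next
              case 2
              then have rs: "r = Suc s" using nbr[of s r] hasse_adjI(2)[OF e] rm by simp
              then have "r \<le> i" using asym[OF e] uu[of s] rm by (metis Suc_le_eq not_le)
              then show ?thesis using rs by simp
            qed
          qed
        qed
      qed
    qed
  qed
qed

lemma decomposable_iff_good_diagrams:
  fixes P :: "'a::order set"
  assumes fin: "finite P"
  shows "decomposable_poset TYPE('k::field) P \<longleftrightarrow> (\<forall>Q\<in>quiver_components (hasse P). good_diagram Q)"
proof
  assume dec: "decomposable_poset TYPE('k) P"
  show "\<forall>Q\<in>quiver_components (hasse P). good_diagram Q"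
  proof
    fix Q assume "Q \<in> quiver_components (hasse P)"
    then obtain a where a: "a \<in> P" "Q = hasse (((hasse_adj P)\<^sup>* \<inter> P \<times> P) `` {a})"
      unfolding quiver_components_hasse[OF fin] by blast
    show "good_diagram Q"
      unfolding a(2) by (rule decomposable_component_good[OF fin dec hasse_component_class(2)[OF fin a(1)]])
  qed
next
  assume "\<forall>Q\<in>quiver_components (hasse P). good_diagram Q"
  then show "decomposable_poset TYPE('k) P" by (intro good_diagrams_imp_decomposable[OF fin]) simp
qed

section \<open>Interval covers\<close>

text \<open>A morphism \<open>k\<^sub>J \<rightarrow> k\<^sub>I\<close>, given by its scalars \<open>c p\<close>.\<close>

definition interval_hom :: "'a::order set \<Rightarrow> 'a set \<Rightarrow> ('a \<Rightarrow> 'k::field) \<Rightarrow> bool" where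
  "interval_hom J I c \<longleftrightarrow> (\<forall>p. p \<notin> J \<or> p \<notin> I \<longrightarrow> c p = 0) \<and> (\<forall>p\<in>J. \<forall>q\<in>I. p \<le> q \<longrightarrow> c p = c q)"

lemma interval_homD:
  assumes "interval_hom J I c"
  shows "p \<notin> J \<Longrightarrow> c p = 0" "p \<notin> I \<Longrightarrow> c p = 0" "p \<in> J \<Longrightarrow> q \<in> I \<Longrightarrow> p \<le> q \<Longrightarrow> c p = c q"
  using assms unfolding interval_hom_def by blast+

lemma interval_homI:
  assumes "\<And>p. p \<notin> J \<Longrightarrow> c p = 0" "\<And>p. p \<notin> I \<Longrightarrow> c p = 0" "\<And>p q. p \<in> J \<Longrightarrow> q \<in> I \<Longrightarrow> p \<le> q \<Longrightarrow> c p = c q"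
  shows "interval_hom J I c"
  unfolding interval_hom_def using assms by metis

lemma interval_hom_comp:
  assumes d: "interval_hom K J d" and c: "interval_hom J I c"
  shows "interval_hom K I (\<lambda>p. c p * d p)"
proof (rule interval_homI)
  fix p q assume pq: "p \<in> K" "q \<in> I" "p \<le> q"
  show "c p * d p = c q * d q"
    using interval_homD(1,2)[OF c] interval_homD(1,2)[OF d] interval_homD(3)[OF c _ pq(2,3)] interval_homD(3)[OF d pq(1) _ pq(3)]
    by (cases "p \<in> J"; cases "q \<in> J") auto
qed (use interval_homD(1,2)[OF c] interval_homD(1,2)[OF d] in auto)

lemma interval_hom_diff: "interval_hom J I c \<Longrightarrow> interval_hom J I d \<Longrightarrow> interval_hom J I (\<lambda>p. c p - d p)"
  unfolding interval_hom_def by simp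

lemma interval_hom_scale: "interval_hom J I c \<Longrightarrow> interval_hom J I (\<lambda>p. c p * a)"
  unfolding interval_hom_def by simp

text \<open>Composition of a morphism from \<open>M\<close> to \<open>k_J\<close> with one from
  \<open>k_J\<close> to \<open>k_I\<close>.\<close>

lemma cosect_interval_hom:
  assumes \<psi>: "cosect P M J \<psi>" and c: "interval_hom J I c"
  shows "cosect P M I (\<lambda>p u. c p * \<psi> p u)"
  unfolding cosect_def
proof (intro conjI ballI allI impI)
  fix p assume "p \<in> P"
  from lin_funD[OF cosectD(1)[OF \<psi> this]] show "lin_fun (vspace M p) (\<lambda>u. c p * \<psi> p u)"
    by (simp add: lin_fun_def algebra_simps)
next
  fix p w assume "p \<notin> I" then show "c p * \<psi> p w = 0" using interval_homD(2)[OF c] by simp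
next
  fix q p w assume h: "q \<in> I" "p \<in> P" "p \<le> q" "w \<in> vspace M p"
  show "c q * \<psi> q (vmap M p q w) = c p * \<psi> p w"
    using interval_homD(1,2)[OF c] interval_homD(3)[OF c _ h(1,3)] cosectD(2)[OF \<psi>, of p] cosectD(3)[OF \<psi> _ h(2,3,4)]
    by (cases "p \<in> J"; cases "q \<in> J") auto
qed

lemma cosect_sum:
  assumes "\<And>s. s \<in> S \<Longrightarrow> cosect P M I (\<psi> s)"
  shows "cosect P M I (\<lambda>p u. \<Sum>s\<in>S. \<psi> s p u)"
  unfolding cosect_def
proof (intro conjI ballI allI impI)
  fix p assume p: "p \<in> P"
  show "lin_fun (vspace M p) (\<lambda>u. \<Sum>s\<in>S. \<psi> s p u)"
    unfolding lin_fun_def sum_distrib_left sum.distrib[symmetric]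
    using lin_funD[OF cosectD(1)[OF assms p]] by (auto intro!: sum.cong)
next
  fix p w assume "p \<notin> I" then show "(\<Sum>s\<in>S. \<psi> s p w) = 0" using cosectD(2)[OF assms] by (intro sum.neutral) auto
next
  fix q p w assume "q \<in> I" "p \<in> P" "p \<le> q" "w \<in> vspace M p"
  then show "(\<Sum>s\<in>S. \<psi> s q (vmap M p q w)) = (\<Sum>s\<in>S. \<psi> s p w)"
    using cosectD(3)[OF assms] by (intro sum.cong) auto
qed

text \<open>A right approximation of \<open>M\<close> by a sum of interval modules, not yet minimal.
  Lifting is required for single interval modules only, since a morphism out of a sum is given on
  the summands. The index type is free so that pairs and deleted indices can be used before
  renumbering.\<close>

definition interval_approx :: "'a::order set \<Rightarrow> ('a, 'k::field) rep \<Rightarrow> 'i set \<Rightarrow> ('i \<Rightarrow> 'a set) \<Rightarrow> ('i \<Rightarrow> 'a \<Rightarrow> nat \<Rightarrow> 'k) \<Rightarrow> bool" where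
  "interval_approx P M T I v \<longleftrightarrow> finite T \<and> (\<forall>t\<in>T. is_interval P (I t) \<and> sect P M (I t) (v t)) \<and>
     (\<forall>J w. is_interval P J \<longrightarrow> sect P M J w \<longrightarrow>
        (\<exists>c. (\<forall>t\<in>T. interval_hom J (I t) (c t)) \<and> (\<forall>p. w p = (\<Sum>t\<in>T. vscale (c t p) (v t p)))))"

lemma interval_approx_lift:
  assumes "interval_approx P M T I v" "is_interval P J" "sect P M J w"
  shows "\<exists>c. (\<forall>t\<in>T. interval_hom J (I t) (c t)) \<and> (\<forall>p. w p = (\<Sum>t\<in>T. vscale (c t p) (v t p)))"
  using assms unfolding interval_approx_def by simp

lemma interval_approx_reindex:
  assumes "interval_approx P M T I v"
  shows "\<exists>I v. interval_approx P M {..<card T} I v"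
proof -
  have fT: "finite T" using assms unfolding interval_approx_def by blast
  obtain h where h: "bij_betw h {..<card T} T" using ex_bij_betw_nat_finite[OF fT] by (auto simp: lessThan_atLeast0)
  have hT: "h t \<in> T" if "t < card T" for t using bij_betwE[OF h] that by auto
  have "interval_approx P M {..<card T} (I \<circ> h) (v \<circ> h)"
    unfolding interval_approx_def
  proof (intro conjI ballI allI impI)
    fix J w assume J: "is_interval P J" "sect P M J w"
    obtain c where c: "\<forall>t\<in>T. interval_hom J (I t) (c t)" "\<forall>p. w p = (\<Sum>t\<in>T. vscale (c t p) (v t p))"
      using interval_approx_lift[OF assms J] by blast
    show "\<exists>c. (\<forall>t\<in>{..<card T}. interval_hom J ((I \<circ> h) t) (c t)) \<and> (\<forall>p. w p = (\<Sum>t<card T. vscale (c t p) ((v \<circ> h) t p)))"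
    proof (intro exI[of _ "c \<circ> h"] conjI ballI allI)
      show "interval_hom J ((I \<circ> h) t) ((c \<circ> h) t)" if "t \<in> {..<card T}" for t using c(1) hT that by simp
      show "w p = (\<Sum>t<card T. vscale ((c \<circ> h) t p) ((v \<circ> h) t p))" for p
        using c(2) sum.reindex_bij_betw[OF h, of "\<lambda>t. vscale (c t p) (v t p)"] by simp
    qed
  qed (use assms hT in \<open>auto simp: interval_approx_def\<close>)
  then show ?thesis by blast
qed

text \<open>The morphisms from \<open>k_J\<close> to \<open>M\<close> form a finite dimensional
  space. Their values at all vertices are packed by blocks into one sequence, so that the theory of
  finite dimensional subspaces of the sequence space applies.\<close>

lemma sections_finite_span:
  fixes P :: "'a::order set" and M :: "('a, 'k::field) rep"
  assumes fin: "finite P" and M: "is_rep P M" and JP: "J \<subseteq> P"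
  shows "\<exists>B :: ('a \<Rightarrow> nat \<Rightarrow> 'k) set. finite B \<and> (\<forall>b\<in>B. sect P M J b) \<and>
    (\<forall>w. sect P M J w \<longrightarrow> (\<exists>r. \<forall>p. w p = (\<Sum>b\<in>B. vscale (r b) (b p))))"
proof -
  obtain ps where ps: "set ps = P" "distinct ps" using finite_distinct_list[OF fin] by blast
  define Ms :: "('a, 'k) rep list" where "Ms = map (\<lambda>p. \<lparr>vspace = (\<lambda>_. vspace M p), vmap = (\<lambda>_ _ v. v)\<rparr>) ps"
  define W where "W = vspace (direct_sum Ms) (undefined :: 'a)"
  have lenM [simp]: "length Ms = length ps" by (simp add: Ms_def)
  have W: "u \<in> W \<longleftrightarrow> (\<forall>i. vblock i u \<in> (if i < length ps then vspace M (ps ! i) else {0}))" for u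
    unfolding W_def in_direct_sum_iff by (simp add: Ms_def)
  have fdW: "fin_dim_space W"
    unfolding W_def using M ps(1) by (intro fin_dim_direct_sum) (auto simp: Ms_def is_rep_def)
  define enc where "enc w = (\<lambda>m. case prod_decode m of (i, j) \<Rightarrow> if i < length ps then w (ps ! i) j else 0)"
    for w :: "'a \<Rightarrow> nat \<Rightarrow> 'k"
  have blk: "vblock i (enc w) = (if i < length ps then w (ps ! i) else 0)" for i w
    by (auto simp: vblock_def enc_def fun_eq_iff)
  define dc where "dc u p = (\<Sum>i<length ps. if ps ! i = p then vblock i u else 0)" for u :: "nat \<Rightarrow> 'k" and p
  have dc_nth: "dc u (ps ! i) = vblock i u" if "i < length ps" for u i
  proof -
    have "dc u (ps ! i) = (\<Sum>j<length ps. if j = i then vblock j u else 0)"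
      unfolding dc_def using that nth_eq_iff_index_eq[OF ps(2)] by (intro sum.cong) auto
    then show ?thesis using that by simp
  qed
  have dc_out: "dc u p = 0" if "p \<notin> P" for u p
    unfolding dc_def using ps(1) that nth_mem by (intro sum.neutral) fastforce
  have PE: "\<exists>i<length ps. p = ps ! i" if "p \<in> P" for p using that ps(1) by (metis in_set_conv_nth)
  have dc_enc: "dc (enc w) p = w p" if "sect P M J w" for w p
  proof (cases "p \<in> P")
    case True
    then show ?thesis using PE dc_nth blk by metis
  next
    case False
    then show ?thesis using dc_out JP sectD(2)[OF that, of p] by auto
  qed
  have dc_add: "dc (u + u') p = dc u p + dc u' p" and dc_scale: "dc (vscale c u) p = vscale c (dc u p)" for u u' c p
    unfolding dc_def vscale_sum sum.distrib[symmetric] by (auto intro!: sum.cong)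
  have dc_zero: "dc 0 p = 0" for p unfolding dc_def by (rule sum.neutral) simp
  have dc_sum: "dc (\<Sum>b\<in>B. vscale (r b) b) p = (\<Sum>b\<in>B. vscale (r b) (dc b p))" for B r p
  proof (induction B rule: infinite_finite_induct)
    case (insert b B)
    show ?case unfolding sum.insert[OF insert(1,2)] dc_add dc_scale insert.IH ..
  next
    case (infinite B)
    show ?case unfolding sum.infinite[OF infinite] by (rule dc_zero)
  next
    case empty
    show ?case unfolding sum.empty by (rule dc_zero)
  qed
  define S where "S = {u \<in> W. sect P M J (dc u)}"
  have encS: "enc w \<in> S" if w: "sect P M J w" for w
  proof -
    have "dc (enc w) = w" using dc_enc[OF w] by blast
    moreover have "enc w \<in> W" using sectD(1)[OF w] ps(1) by (auto simp: W blk)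
    ultimately show ?thesis using w by (simp add: S_def)
  qed
  have subS: "vec.subspace S"
  proof (rule vec.subspaceI)
    have sW: "vec.subspace W" using fin_dim_space_subspace[OF fdW] .
    have "dc 0 = (\<lambda>p. 0)" using dc_zero by blast
    moreover have "sect P M J (\<lambda>p. 0)"
      unfolding sect_def
    proof (intro conjI ballI allI impI)
      show "0 \<in> vspace M p" if "p \<in> P" for p using vec.subspace_0[OF rep_subspace[OF M that]] .
      show "vmap M p q 0 = 0" if "p \<in> J" "q \<in> P" "p \<le> q" for p q
        using rep_0[OF M _ that(2,3)] that(1) JP by auto
    qed simp
    ultimately show "0 \<in> S" using vec.subspace_0[OF sW] by (simp add: S_def)
    fix u assume u: "u \<in> S"
    then have su: "sect P M J (dc u)" and uW: "u \<in> W" by (auto simp: S_def)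
    have "sect P M J (dc (vscale c u))" for c
      unfolding sect_def dc_scale
    proof (intro conjI ballI allI impI)
      show "vscale c (dc u p) \<in> vspace M p" if "p \<in> P" for p
        using vec.subspace_scale[OF rep_subspace[OF M that] sectD(1)[OF su that]] .
      show "vmap M p q (vscale c (dc u p)) = vscale c (dc u q)" if "p \<in> J" "q \<in> P" "p \<le> q" for p q
        using linear_onD(3)[OF rep_linear[OF M _ that(2,3)] sectD(1)[OF su]] sectD(3)[OF su that] JP that(1) by auto
    qed (use sectD(2)[OF su] in simp)
    then show "vscale c u \<in> S" for c using vec.subspace_scale[OF sW uW] by (simp add: S_def)
    fix u' assume u': "u' \<in> S"
    then have su': "sect P M J (dc u')" and uW': "u' \<in> W" by (auto simp: S_def)
    have "sect P M J (dc (u + u'))"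
      unfolding sect_def dc_add
    proof (intro conjI ballI allI impI)
      show "dc u p + dc u' p \<in> vspace M p" if "p \<in> P" for p
        using vec.subspace_add[OF rep_subspace[OF M that] sectD(1)[OF su that] sectD(1)[OF su' that]] .
      show "vmap M p q (dc u p + dc u' p) = dc u q + dc u' q" if "p \<in> J" "q \<in> P" "p \<le> q" for p q
        using linear_onD(2)[OF rep_linear[OF M _ that(2,3)] sectD(1)[OF su] sectD(1)[OF su']]
          sectD(3)[OF su that] sectD(3)[OF su' that] JP that(1) by auto
    qed (use sectD(2)[OF su] sectD(2)[OF su'] in simp)
    then show "u + u' \<in> S" using vec.subspace_add[OF sW uW uW'] by (simp add: S_def)
  qed
  have "fin_dim_space S" by (rule fin_dim_space_mono[OF fdW subS]) (auto simp: S_def)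
  then obtain B where B: "finite B" "vec.span B = S" by (auto simp: fin_dim_space_def)
  have BS: "sect P M J (dc b)" if "b \<in> B" for b using vec.span_base[OF that] B(2) by (simp add: S_def)
  define D where "D = dc ` B"
  have "\<exists>r. \<forall>p. w p = (\<Sum>d\<in>D. vscale (r d) (d p))" if w: "sect P M J w" for w
  proof -
    have "enc w \<in> vec.span B" using encS[OF w] B(2) by simp
    then obtain r where r: "enc w = (\<Sum>b\<in>B. vscale (r b) b)" using vec.span_finite[OF B(1)] by auto
    \<comment> \<open>Elements of \<open>B\<close> with the same image under \<open>dc\<close> are
      merged and their coefficients added.\<close>
    have "w p = (\<Sum>d\<in>D. vscale (\<Sum>b\<in>{b\<in>B. dc b = d}. r b) (d p))" for p
    proof -
      have "w p = (\<Sum>b\<in>B. vscale (r b) (dc b p))" using dc_enc[OF w, of p] dc_sum[of r B p] r by simp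
      also have "\<dots> = (\<Sum>d\<in>D. \<Sum>b\<in>{b\<in>B. dc b = d}. vscale (r b) (dc b p))"
        unfolding D_def by (rule sum.image_gen[OF B(1)])
      also have "\<dots> = (\<Sum>d\<in>D. vscale (\<Sum>b\<in>{b\<in>B. dc b = d}. r b) (d p))"
        unfolding vec.scale_sum_left by (intro sum.cong refl) auto
      finally show ?thesis .
    qed
    then show ?thesis by (intro exI[of _ "\<lambda>d. \<Sum>b\<in>{b\<in>B. dc b = d}. r b"] allI)
  qed
  then show ?thesis using B(1) BS by (intro exI[of _ D]) (auto simp: D_def)
qed

text \<open>One copy of \<open>k_J\<close> is taken for every interval \<open>J\<close> and every
  member of a finite spanning set of the morphisms from \<open>k_J\<close> to \<open>M\<close>. A
  lift of a morphism from \<open>k_J\<close> uses only the copies with the same \<open>J\<close>,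
  with scalar coefficients.\<close>

lemma interval_approx_exists:
  fixes P :: "'a::order set" and M :: "('a, 'k::field) rep"
  assumes fin: "finite P" and M: "is_rep P M"
  shows "\<exists>(n::nat) I v. interval_approx P M {..<n} I v"
proof -
  define \<Phi> where "\<Phi> J B \<longleftrightarrow> finite B \<and> (\<forall>b\<in>B. sect P M J b) \<and>
    (\<forall>w. sect P M J w \<longrightarrow> (\<exists>r. \<forall>p. w p = (\<Sum>b\<in>B. vscale (r b) (b p))))" for J and B :: "('a \<Rightarrow> nat \<Rightarrow> 'k) set"
  have "\<forall>J\<in>Pow P. \<exists>B. \<Phi> J B" using sections_finite_span[OF fin M] unfolding \<Phi>_def by simp
  then obtain B where "\<forall>J\<in>Pow P. \<Phi> J (B J)" by metis
  then have \<Phi>B: "\<Phi> J (B J)" if "is_interval P J" for J using is_intervalD(1)[OF that] by simp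
  have B: "finite (B J)" "\<forall>b\<in>B J. sect P M J b"
      "\<forall>w. sect P M J w \<longrightarrow> (\<exists>r. \<forall>p. w p = (\<Sum>b\<in>B J. vscale (r b) (b p)))" if "is_interval P J" for J
    by (rule \<Phi>B[OF that, unfolded \<Phi>_def, THEN conjunct1],
      rule \<Phi>B[OF that, unfolded \<Phi>_def, THEN conjunct2, THEN conjunct1],
      rule \<Phi>B[OF that, unfolded \<Phi>_def, THEN conjunct2, THEN conjunct2])
  define \<I> where "\<I> = {J. is_interval P J}"
  have fI: "finite \<I>" by (rule finite_subset[of _ "Pow P"]) (use fin is_intervalD(1) in \<open>auto simp: \<I>_def\<close>)
  define T where "T = Sigma \<I> B"
  have fT: "finite T" unfolding T_def by (rule finite_SigmaI[OF fI]) (use B(1) in \<open>simp add: \<I>_def\<close>)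
  have "interval_approx P M T fst snd"
    unfolding interval_approx_def
  proof (intro conjI ballI allI impI)
    fix J w assume J: "is_interval P J" and w: "sect P M J w"
    obtain r where r: "\<And>p. w p = (\<Sum>b\<in>B J. vscale (r b) (b p))" using B(3)[OF J] w by blast
    define c where "c t p = (if fst t = J \<and> p \<in> J then r (snd t) else 0)" for t :: "'a set \<times> ('a \<Rightarrow> nat \<Rightarrow> 'k)" and p
    have "interval_hom J (fst t) (c t)" for t by (rule interval_homI) (auto simp: c_def)
    moreover have "w p = (\<Sum>t\<in>T. vscale (c t p) (snd t p))" for p
    proof -
      have "(\<Sum>t\<in>T. vscale (c t p) (snd t p)) = (\<Sum>t\<in>Pair J ` B J. vscale (c t p) (snd t p))"
        by (rule sum.mono_neutral_right[OF fT]) (use J in \<open>auto simp: T_def \<I>_def c_def\<close>)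
      also have "\<dots> = (\<Sum>b\<in>B J. vscale (c (J, b) p) (b p))"
        by (subst sum.reindex) (auto simp: inj_on_def)
      also have "\<dots> = w p"
      proof (cases "p \<in> J")
        case True
        then show ?thesis unfolding r by (simp add: c_def)
      next
        case False
        then show ?thesis using sectD(2)[OF w False] by (simp add: c_def)
      qed
      finally show ?thesis by simp
    qed
    ultimately show "\<exists>c. (\<forall>t\<in>T. interval_hom J (fst t) (c t)) \<and> (\<forall>p. w p = (\<Sum>t\<in>T. vscale (c t p) (snd t p)))"
      by blast
  qed (use fT B(2) in \<open>auto simp: T_def \<I>_def\<close>)
  from interval_approx_reindex[OF this] show ?thesis by (rule exI)
qed

text \<open>From a point of \<open>C \<inter> D\<close>, \<open>C\<close> allows moves up in
  \<open>J\<close> and down in \<open>I\<close>, and \<open>D\<close> the reverse. So the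
  intersection absorbs everything comparable in \<open>I\<close> or \<open>J\<close>, and
  connectedness makes it equal to both.\<close>

lemma hom_le_antisym:
  assumes "hom_le a I J" "hom_le a J I" "connected_poset I" "connected_poset J"
  shows "I = J"
proof -
  obtain C where C: "hom_support a I J C" using assms(1) unfolding hom_le_def by (rule exE)
  obtain D where D: "hom_support a J I D" using assms(2) unfolding hom_le_def by (rule exE)
  note c = hom_supportD[OF C] and d = hom_supportD[OF D]
  have stepI: "q \<in> C \<inter> D" if "p \<in> C \<inter> D" "q \<in> I \<union> J" "p \<le> q \<or> q \<le> p" for p q
  proof -
    have "q \<in> C \<or> q \<in> D" using that c(4,5)[of p q] d(4,5)[of p q] by auto
    then have "q \<in> I" "q \<in> J" using c(1,2) d(1,2) by auto
    then show ?thesis using that c(4,5)[of p q] d(4,5)[of p q] by auto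
  qed
  have a: "a \<in> C \<inter> D" "a \<in> I" "a \<in> J" using c(1-3) d(3) by auto
  have "b \<in> C \<inter> D" if "b \<in> I" for b
    by (rule connected_poset_induct[OF assms(3) a(2) that, of "\<lambda>b. b \<in> C \<inter> D"]) (use a(1) stepI in blast)+
  moreover have "b \<in> C \<inter> D" if "b \<in> J" for b
    by (rule connected_poset_induct[OF assms(4) a(3) that, of "\<lambda>b. b \<in> C \<inter> D"]) (use a(1) stepI in blast)+
  ultimately show ?thesis using c(1,2) by auto
qed

text \<open>If a relation \<open>H\<close> among the morphisms \<open>v\<close> has an invertible coefficient \<open>H i\<close>, then \<open>v i\<close>
  factors through the others.\<close>

lemma interval_approx_eliminate:
  fixes M :: "('a::order, 'k::field) rep" and n :: nat
  assumes ap: "interval_approx P M {..<n} I v" and ij: "i < n" "j < n" "I i = I j"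
    and H: "\<And>l. l < n \<Longrightarrow> interval_hom (I j) (I l) (H l)"
    and rel: "\<And>p. p \<in> I j \<Longrightarrow> (\<Sum>l<n. vscale (H l p) (v l p)) = 0"
    and a: "a \<in> I j" "H i a \<noteq> 0"
  shows "\<exists>I v. interval_approx P M {..<n - 1} I v"
proof -
  define h where "h = H i a"
  have int: "is_interval P (I l)" and sec: "sect P M (I l) (v l)" if "l < n" for l
    using ap that unfolding interval_approx_def by auto
  \<comment> \<open>An endomorphism of \<open>k_I\<close> is a scalar because \<open>I\<close> is
    connected; hence the coefficient \<open>H i\<close> is invertible on the whole interval once it
    is nonzero at \<open>a\<close>.\<close>
  have const: "H i p = h" if p: "p \<in> I j" for p
  proof (rule connected_poset_induct[of "I j" a p "\<lambda>p. H i p = h"])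
    show "connected_poset (I j)" by (rule is_intervalD(3)[OF int[OF ij(2)]])
    fix x y assume xy: "x \<in> I j" "y \<in> I j" and cmp: "x \<le> y \<or> y \<le> x" and hx: "H i x = h"
    have mem: "x \<in> I i" "y \<in> I i" using xy ij(3) by simp_all
    from cmp show "H i y = h"
    proof
      assume "x \<le> y"
      from interval_homD(3)[OF H[OF ij(1)] xy(1) mem(2) this] show ?thesis using hx by simp
    next
      assume "y \<le> x"
      from interval_homD(3)[OF H[OF ij(1)] xy(2) mem(1) this] show ?thesis using hx by simp
    qed
  qed (use a(1) p in \<open>simp_all add: h_def\<close>)
  let ?T = "{..<n} - {i}"
  have split: "(\<Sum>l<n. f l) = f i + (\<Sum>l\<in>?T. f l)" for f :: "nat \<Rightarrow> nat \<Rightarrow> 'k"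
    by (rule sum.remove) (use ij in auto)
  have vi: "v i p = (\<Sum>l\<in>?T. vscale (- (H l p * inverse h)) (v l p))" for p
  proof (cases "p \<in> I j")
    case True
    have "vscale h (v i p) = - (\<Sum>l\<in>?T. vscale (H l p) (v l p))"
      using rel[OF True] unfolding split const[OF True] by (rule eq_neg_iff_add_eq_0[THEN iffD2])
    then have "vscale (inverse h) (vscale h (v i p)) = vscale (inverse h) (- (\<Sum>l\<in>?T. vscale (H l p) (v l p)))" by simp
    then have "v i p = vscale (inverse h) (- (\<Sum>l\<in>?T. vscale (H l p) (v l p)))" using a(2) by (simp add: h_def)
    then show ?thesis by (simp add: vscale_sum sum_negf[symmetric] mult.commute)
  next
    case False
    then have "H l p = 0" if "l < n" for l using interval_homD(1)[OF H[OF that]] by blast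
    then show ?thesis using sectD(2)[OF sec[OF ij(1)]] False ij(3) by (simp add: sum.neutral)
  qed
  have "interval_approx P M ?T I v"
    unfolding interval_approx_def
  proof (intro conjI ballI allI impI)
    fix J w assume J: "is_interval P J" and w: "sect P M J w"
    obtain c where "\<forall>t\<in>{..<n}. interval_hom J (I t) (c t)" "\<forall>p. w p = (\<Sum>t<n. vscale (c t p) (v t p))"
      using interval_approx_lift[OF ap J w] by blast
    then have c: "\<And>t. t < n \<Longrightarrow> interval_hom J (I t) (c t)" "\<And>p. w p = (\<Sum>t<n. vscale (c t p) (v t p))" by auto
    \<comment> \<open>The result of substituting the expression for \<open>v i\<close> into the
      given lift.\<close>
    define c' where "c' l p = c l p - (H l p * c i p) * inverse h" for l p
    have ci: "interval_hom J (I j) (c i)" using c(1)[of i] ij by simp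
    have "interval_hom J (I l) (c' l)" if "l \<in> ?T" for l
      unfolding c'_def using c(1)[of l] interval_hom_comp[OF ci H, of l] that
      by (intro interval_hom_diff interval_hom_scale) auto
    moreover have "w p = (\<Sum>l\<in>?T. vscale (c' l p) (v l p))" for p
    proof -
      have "w p = vscale (c i p) (v i p) + (\<Sum>l\<in>?T. vscale (c l p) (v l p))"
        unfolding c(2) by (rule split)
      also have "vscale (c i p) (v i p) = (\<Sum>l\<in>?T. vscale (- ((H l p * c i p) * inverse h)) (v l p))"
        by (subst vi) (simp add: vscale_sum mult_ac)
      also have "\<dots> + (\<Sum>l\<in>?T. vscale (c l p) (v l p)) = (\<Sum>l\<in>?T. vscale (c' l p) (v l p))"
        unfolding sum.distrib[symmetric] vec.scale_left_distrib[symmetric] c'_def by simp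
      finally show ?thesis .
    qed
    ultimately show "\<exists>c. (\<forall>t\<in>?T. interval_hom J (I t) (c t)) \<and> (\<forall>p. w p = (\<Sum>t\<in>?T. vscale (c t p) (v t p)))"
      by blast
  qed (use int sec in auto)
  from interval_approx_reindex[OF this] show ?thesis using ij(1) by simp
qed

text \<open>An injective map keeps a basis independent, so a proper image would contain too many
  independent vectors.\<close>

lemma injective_endo_surj:
  fixes V :: "(nat \<Rightarrow> 'k::field) set"
  assumes V: "fin_dim_space V" and f: "linear_on V V f" and inj: "\<And>u. u \<in> V \<Longrightarrow> f u = 0 \<Longrightarrow> u = 0"
  shows "f ` V = V"
proof (rule ccontr)
  assume ne: "f ` V \<noteq> V"
  note sV = fin_dim_space_subspace[OF V]
  have sub: "f ` V \<subset> V" using linear_onD(1)[OF f] ne by blast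
  have less: "vec.dim (f ` V) < vec.dim V" by (rule fin_dim_space_dim_less[OF V subspace_image[OF f sV] sub])
  have fdf: "fin_dim_space (f ` V)" by (rule fin_dim_space_mono[OF V subspace_image[OF f sV]]) (use sub in auto)
  obtain B where B: "B \<subseteq> V" "vec.independent B" "V \<subseteq> vec.span B" "card B = vec.dim V"
    using vec.basis_exists by metis
  obtain C where C: "C \<subseteq> f ` V" "vec.independent C" "f ` V \<subseteq> vec.span C" "card C = vec.dim (f ` V)"
    using vec.basis_exists by metis
  have inj_on: "inj_on f V"
  proof (rule inj_onI)
    fix x y assume xy: "x \<in> V" "y \<in> V" "f x = f y"
    then have "f (x - y) = 0" using linear_on_diff[OF f sV] by simp
    then show "x = y" using inj[OF vec.subspace_diff[OF sV xy(1,2)]] by simp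
  qed
  have ind: "vec.independent (f ` B)"
    unfolding vec.dependent_explicit
  proof (intro notI, elim exE conjE bexE)
    fix S r x assume S: "finite S" "S \<subseteq> f ` B" "(\<Sum>x\<in>S. vscale (r x) x) = 0" and x: "x \<in> S" "r x \<noteq> 0"
    obtain S' where S': "S' \<subseteq> B" "S = f ` S'" using S(2) by (meson subset_image_iff)
    have i: "inj_on f S'" using inj_on S'(1) B(1) by (meson inj_on_subset order_trans)
    have fS': "finite S'" using S(1) S'(2) finite_image_iff[OF i] by simp
    have S'V: "b \<in> V" if "b \<in> S'" for b using that S'(1) B(1) by auto
    have "(\<Sum>b\<in>S'. vscale (r (f b)) (f b)) = 0" using S(3) unfolding S'(2) sum.reindex[OF i] by simp
    then have "f (\<Sum>b\<in>S'. vscale (r (f b)) b) = 0" using linear_on_sum[OF f sV, of S' "\<lambda>b. b"] S'V by simp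
    moreover have "(\<Sum>b\<in>S'. vscale (r (f b)) b) \<in> V"
      using S'V by (intro vec.subspace_sum[OF sV] vec.subspace_scale[OF sV]) auto
    ultimately have "(\<Sum>b\<in>S'. vscale (r (f b)) b) = 0" using inj by blast
    then have "\<forall>b\<in>S'. r (f b) = 0" using vec.independentD[OF B(2) fS' S'(1), of "\<lambda>b. r (f b)"] by simp
    then show False using x S'(2) by auto
  qed
  obtain A where A: "finite A" "vec.span A = V" using V by (auto simp: fin_dim_space_def)
  have fC: "finite C" using vec.independent_span_bound[OF A(1) C(2)] A(2) C(1) sub by auto
  have "f ` B \<subseteq> vec.span C" using B(1) C(3) by blast
  then have "card (f ` B) \<le> card C" using vec.independent_span_bound[OF fC ind] by blast
  moreover have "card (f ` B) = card B" using card_image[of f B] inj_on B(1) inj_on_subset by blast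
  ultimately show False using less B(4) C(4) by simp
qed

text \<open>Pointwise inverses of a morphism commute with the maps automatically.\<close>

lemma bijective_hom_iso:
  assumes M: "is_rep P M" and N: "is_rep P N" and f: "is_hom P M N f"
    and inj: "\<And>p u. p \<in> P \<Longrightarrow> u \<in> vspace M p \<Longrightarrow> f p u = 0 \<Longrightarrow> u = 0"
    and surj: "\<And>p. p \<in> P \<Longrightarrow> f p ` vspace M p = vspace N p"
  shows "is_iso P M N f"
proof -
  have "\<forall>p\<in>P. \<exists>g. linear_on (vspace N p) (vspace M p) g \<and> (\<forall>u\<in>vspace M p. g (f p u) = u) \<and> (\<forall>u\<in>vspace N p. f p (g u) = u)"
  proof
    fix p assume p: "p \<in> P"
    show "\<exists>g. linear_on (vspace N p) (vspace M p) g \<and> (\<forall>u\<in>vspace M p. g (f p u) = u) \<and> (\<forall>u\<in>vspace N p. f p (g u) = u)"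
      by (rule linear_on_inverse[OF homD(1)[OF f p] rep_subspace[OF M p] surj[OF p] inj[OF p]]) blast+
  qed
  then obtain g where "\<forall>p\<in>P. linear_on (vspace N p) (vspace M p) (g p) \<and> (\<forall>u\<in>vspace M p. g p (f p u) = u) \<and> (\<forall>u\<in>vspace N p. f p (g p u) = u)"
    by metis
  then have lin: "linear_on (vspace N p) (vspace M p) (g p)" and gf: "\<forall>u\<in>vspace M p. g p (f p u) = u"
    and fg: "\<forall>u\<in>vspace N p. f p (g p u) = u" if "p \<in> P" for p using that by blast+
  have "is_hom P N M g"
    unfolding is_hom_def
  proof (intro conjI ballI impI lin)
    fix p q w assume pq: "p \<in> P" "q \<in> P" "p \<le> q" and w: "w \<in> vspace N p"
    have gw: "g p w \<in> vspace M p" by (rule linear_onD(1)[OF lin[OF pq(1)] w])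
    have "f q (vmap M p q (g p w)) = vmap N p q w" using homD(2)[OF f pq gw] fg[OF pq(1)] w by simp
    then show "g q (vmap N p q w) = vmap M p q (g p w)" using gf[OF pq(2)] rep_in[OF M pq gw] by metis
  qed
  then show ?thesis
    unfolding is_iso_def hom_eq_def hom_comp_def hom_id_def using f fg gf by (intro conjI exI[of _ g]) auto
qed

text \<open>A finite acyclic relation is well-founded, but every element of \<open>S\<close> has a
  predecessor in \<open>S\<close>, so none is minimal.\<close>

lemma finite_relation_cycle:
  assumes "finite S" "S \<noteq> {}" "\<And>t. t \<in> S \<Longrightarrow> \<exists>s\<in>S. (s, t) \<in> R" "R \<subseteq> S \<times> S"
  obtains t s where "(t, s) \<in> R" "(s, t) \<in> R\<^sup>*"
proof -
  have "\<not> acyclic R"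
  proof
    assume "acyclic R"
    moreover have "finite R" using finite_subset[OF assms(4)] assms(1) by simp
    ultimately have "wf R" using finite_acyclic_wf by blast
    then obtain t where "t \<in> S" "\<And>s. (s, t) \<in> R \<Longrightarrow> s \<notin> S" using assms(2) by (metis all_not_in_conv wfE_min)
    then show False using assms(3) by blast
  qed
  then obtain t where "(t, t) \<in> R\<^sup>+" unfolding acyclic_def by blast
  then show thesis using that by (meson tranclD)
qed

lemma interval_sum_decomposable: "\<forall>I\<in>set Is. is_interval P I \<Longrightarrow> interval_decomposable P (interval_sum Is)"
  unfolding interval_decomposable_def isomorphic_def is_iso_def
  by (intro exI[of _ Is] exI[of _ hom_id] conjI)
    (auto simp: is_hom_def linear_on_def hom_id_def hom_eq_def hom_comp_def)

text \<open>An approximation with the least number of summands is a cover.  If \<open>f \<circ> g = f\<close>, then by minimality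
  the components of \<open>1 - g\<close> between equal intervals vanish.  A nonzero kernel vector of \<open>g\<close> would be
  fixed by \<open>1 - g\<close>, hence give a cycle of nonzero components, and by antisymmetry of \<open>hom_le\<close> these
  would be between equal intervals.\<close>

lemma interval_cover_exists:
  fixes P :: "'a::order set" and M :: "('a, 'k::field) rep"
  assumes fin: "finite P" and M: "is_rep P M"
  shows "\<exists>X f. is_interval_cover P M X f"
proof -
  define Q where "Q m \<longleftrightarrow> (\<exists>I v. interval_approx P M {..<m} I v)" for m :: nat
  have "\<exists>m. Q m" using interval_approx_exists[OF fin M] unfolding Q_def .
  then obtain n where "Q n" and least: "\<And>m. Q m \<Longrightarrow> n \<le> m" using LeastI_ex[of Q] Least_le[of Q] by metis
  then obtain I v where ap: "interval_approx P M {..<n} I v" unfolding Q_def by blast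
  have int: "is_interval P (I l)" and sec: "sect P M (I l) (v l)" if "l < n" for l
    using ap that unfolding interval_approx_def by auto
  define Is where "Is = map I [0..<n]"
  have len [simp]: "length Is = n" and nth [simp]: "t < n \<Longrightarrow> Is ! t = I t" for t by (auto simp: Is_def)
  have Isint: "\<forall>J\<in>set Is. is_interval P J" using int by (auto simp: Is_def)
  define X :: "('a, 'k) rep" where "X = interval_sum Is"
  have X: "is_rep P X" unfolding X_def by (rule is_rep_interval_sum[OF Isint])
  define f where "f p u = (\<Sum>t<n. vscale (icoord t u) (v t p))" for p u
  have f: "is_hom P X M f"
    using sections_hom[OF M, of Is v] sec unfolding X_def f_def[abs_def] by simp
  have Xdec: "interval_decomposable P X" unfolding X_def by (rule interval_sum_decomposable[OF Isint])
  \<comment> \<open>A morphism from \<open>Y\<close> restricts to a section on each summand. Each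
    section is lifted separately, and the lifts \<open>c s t\<close> are joined with the cosections
    of \<open>Y\<close> in \<open>\<chi>\<close>.\<close>
  have lift: "\<exists>g. is_hom P Y X g \<and> hom_eq P Y (hom_comp f g) h"
    if Y: "is_rep P Y" "interval_decomposable P Y" and h: "is_hom P Y M h" for Y h
  proof -
    obtain k J y \<psi> where D: "interval_decomp P Y k J y \<psi>" using interval_decomposable_imp_decomp[OF Y] by blast
    define w where "w s p = (if p \<in> J s then h p (y s p) else 0)" for s p
    have JP: "p \<in> P" if "s < k" "p \<in> J s" for s p using is_intervalD(1)[OF interval_decompD(1)[OF D that(1)]] that(2) by blast
    have h0: "h p 0 = 0" if "p \<in> P" for p using linear_on_0[OF homD(1)[OF h that] rep_subspace[OF Y(1) that]] .
    have wh: "w s p = h p (y s p)" if "s < k" "p \<in> P" for s p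
      using h0[OF that(2)] sectD(2)[OF interval_decompD(2)[OF D that(1)], of p] by (simp add: w_def)
    have ysec: "y s p \<in> vspace Y p" if "s < k" "p \<in> P" for s p
      using sectD(1)[OF interval_decompD(2)[OF D that(1)] that(2)] .
    have wsec: "sect P M (J s) (w s)" if s: "s < k" for s
      unfolding sect_def
    proof (intro conjI ballI allI impI)
      show "w s p \<in> vspace M p" if "p \<in> P" for p using wh[OF s that] homD(3)[OF h that ysec[OF s that]] by simp
      show "w s p = 0" if "p \<notin> J s" for p using that by (simp add: w_def)
      fix p q assume p: "p \<in> J s" and q: "q \<in> P" "p \<le> q"
      show "vmap M p q (w s p) = w s q"
        using homD(2)[OF h JP[OF s p] q ysec[OF s JP[OF s p]]] sectD(3)[OF interval_decompD(2)[OF D s] p q]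
          wh[OF s JP[OF s p]] wh[OF s q(1)] by simp
    qed
    have "\<forall>s. \<exists>c. s < k \<longrightarrow> (\<forall>t<n. interval_hom (J s) (I t) (c t)) \<and> (\<forall>p. w s p = (\<Sum>t<n. vscale (c t p) (v t p)))"
    proof
      fix s show "\<exists>c. s < k \<longrightarrow> (\<forall>t<n. interval_hom (J s) (I t) (c t)) \<and> (\<forall>p. w s p = (\<Sum>t<n. vscale (c t p) (v t p)))"
        using interval_approx_lift[OF ap interval_decompD(1)[OF D] wsec, of s] by (cases "s < k") auto
    qed
    then obtain c where c: "\<And>s t. s < k \<Longrightarrow> t < n \<Longrightarrow> interval_hom (J s) (I t) (c s t)"
        "\<And>s p. s < k \<Longrightarrow> w s p = (\<Sum>t<n. vscale (c s t p) (v t p))" by metis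
    define \<chi> where "\<chi> t p u = (\<Sum>s<k. c s t p * \<psi> s p u)" for t p u
    have \<chi>: "cosect P Y (I t) (\<chi> t)" if "t < n" for t
      unfolding \<chi>_def[abs_def] using cosect_interval_hom[OF interval_decompD(3)[OF D] c(1)[OF _ that]]
      by (intro cosect_sum) simp
    define g where "g p u = (\<Sum>t<n. vscale (\<chi> t p u) (iunit t))" for p u
    have "is_hom P Y X g" using cosections_hom[OF Isint, of Y \<chi>] \<chi> unfolding X_def g_def[abs_def] by simp
    moreover have "f p (g p u) = h p u" if p: "p \<in> P" and u: "u \<in> vspace Y p" for p u
    proof -
      have "f p (g p u) = (\<Sum>t<n. vscale (\<chi> t p u) (v t p))"
        unfolding f_def g_def icoord_combination by simp
      also have "\<dots> = (\<Sum>t<n. \<Sum>s<k. vscale (\<psi> s p u) (vscale (c s t p) (v t p)))"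
        unfolding \<chi>_def vec.scale_sum_left by (simp add: mult.commute)
      also have "\<dots> = (\<Sum>s<k. vscale (\<psi> s p u) (w s p))"
        by (subst sum.swap) (simp add: c(2) vscale_sum)
      also have "\<dots> = (\<Sum>s<k. vscale (\<psi> s p u) (h p (y s p)))"
        using wh p by (intro sum.cong) auto
      also have "\<dots> = h p (\<Sum>s<k. vscale (\<psi> s p u) (y s p))"
        by (rule linear_on_sum[symmetric, OF homD(1)[OF h p] rep_subspace[OF Y(1) p]]) (use ysec p in auto)
      finally show ?thesis using interval_decompD(5)[OF D p u] by simp
    qed
    ultimately show ?thesis unfolding hom_eq_def hom_comp_def by (intro exI[of _ g]) simp
  qed
  have min: "is_iso P X X g" if g: "is_hom P X X g" and fg: "hom_eq P X (hom_comp f g) f" for g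
  proof -
    have fg: "f p (g p u) = f p u" if "p \<in> P" "u \<in> vspace X p" for p u
      using fg that by (simp add: hom_eq_def hom_comp_def)
    have IP: "p \<in> P" if "s < n" "p \<in> I s" for s p using is_intervalD(1)[OF int[OF that(1)]] that(2) by blast
    have un: "iunit s \<in> vspace X p" if "s < n" "p \<in> I s" for s p
      unfolding X_def by (rule iunit_in) (use that in simp_all)
    \<comment> \<open>The matrix of \<open>1 - g\<close>, with entry from summand \<open>s\<close>
      to summand \<open>t\<close>; the equation \<open>f g = f\<close> makes each row a relation
      among the \<open>v l\<close>.\<close>
    define H where "H s t p = (if p \<in> I s then (if t = s then 1 else 0) - icoord t (g p (iunit s)) else 0)" for s t p
    have H: "interval_hom (I s) (I t) (H s t)" if s: "s < n" and t: "t < n" for s t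
    proof (rule interval_homI)
      fix p assume p: "p \<notin> I t"
      show "H s t p = 0"
      proof (cases "p \<in> I s")
        case True
        then have "t \<noteq> s" using p by auto
        moreover have "icoord t (g p (iunit s)) = 0"
          using icoord_zero[of "g p (iunit s)" Is p t] homD(3)[OF g IP[OF s True] un[OF s True]] p t unfolding X_def by simp
        ultimately show ?thesis by (simp add: H_def)
      qed (simp add: H_def)
    next
      fix p q assume p: "p \<in> I s" and q: "q \<in> I t" and le: "p \<le> q"
      have pP: "p \<in> P" and qP: "q \<in> P" using IP s t p q by auto
      have unq: "vmap X p q (iunit s) = (if q \<in> I s then iunit s else 0)"
      proof (rule interval_sum_eqI)
        show "vmap X p q (iunit s) \<in> vspace (interval_sum Is :: ('a, 'k) rep) q"
          unfolding X_def[symmetric] by (rule rep_in[OF X pP qP le un[OF s p]])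
        show "(if q \<in> I s then iunit s else 0) \<in> vspace (interval_sum Is :: ('a, 'k) rep) q"
          unfolding X_def[symmetric] using un[OF s] vec.subspace_0[OF rep_subspace[OF X qP]] by simp
      qed (use p s in \<open>auto simp: X_def icoord_vmap\<close>)
      have "g q (vmap X p q (iunit s)) = vmap X p q (g p (iunit s))" by (rule homD(2)[OF g pP qP le un[OF s p]])
      then have eq: "icoord t (g q (if q \<in> I s then iunit s else 0)) = (if p \<in> I t then icoord t (g p (iunit s)) else 0)"
        unfolding unq using t q by (simp add: X_def icoord_vmap)
      have z: "icoord t (g p (iunit s)) = 0" if "p \<notin> I t"
        using icoord_zero[of "g p (iunit s)" Is p t] homD(3)[OF g pP un[OF s p]] that t unfolding X_def by simp
      have g0: "g q 0 = 0" using linear_on_0[OF homD(1)[OF g qP] rep_subspace[OF X qP]] .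
      show "H s t p = H s t q"
        using eq z g0 p q by (cases "q \<in> I s"; cases "p \<in> I t") (auto simp: H_def)
    qed (simp add: H_def)
    have rel: "(\<Sum>l<n. vscale (H s l p) (v l p)) = 0" if s: "s < n" and p: "p \<in> I s" for s p
    proof -
      have "(\<Sum>l<n. vscale (H s l p) (v l p)) = f p (iunit s) - f p (g p (iunit s))"
        unfolding f_def sum_subtractf[symmetric] vec.scale_left_diff_distrib[symmetric]
        by (intro sum.cong) (use p in \<open>auto simp: H_def\<close>)
      then show ?thesis using fg[OF IP[OF s p] un[OF s p]] by simp
    qed
    have no_iso: "H s t p = 0" if s: "s < n" and t: "t < n" and eq: "I t = I s" for s t p
    proof (rule ccontr)
      assume nz: "H s t p \<noteq> 0"
      then have p: "p \<in> I s" using interval_homD(1)[OF H[OF s t]] by blast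
      have "\<exists>I v. interval_approx P M {..<n - 1} I v"
        using interval_approx_eliminate[OF ap t s eq H[OF s] rel[OF s] p nz] .
      then have "n \<le> n - 1" using least unfolding Q_def by blast
      then show False using s by simp
    qed
    have inj: "u = 0" if p: "p \<in> P" and u: "u \<in> vspace X p" and gu: "g p u = 0" for p u
    proof (rule ccontr)
      assume u0: "u \<noteq> 0"
      have uz: "icoord s u = 0" if "s < n" "p \<notin> I s" for s
        using icoord_zero[of u Is p s] u that unfolding X_def by simp
      have expand: "(\<Sum>s<n. vscale (icoord s u) (iunit s)) = u"
        using interval_sum_expand[of u Is p] u unfolding X_def by simp
      let ?A = "{s. s < n \<and> p \<in> I s}"
      have uA: "u = (\<Sum>s\<in>?A. vscale (icoord s u) (iunit s))"
      proof -
        have "(\<Sum>s<n. vscale (icoord s u) (iunit s)) = (\<Sum>s\<in>?A. vscale (icoord s u) (iunit s))"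
          by (rule sum.mono_neutral_right) (use uz in auto)
        then show ?thesis using expand by simp
      qed
      \<comment> \<open>Since \<open>g u = 0\<close>, the map \<open>1 - g\<close> fixes
        \<open>u\<close>; so each nonzero coordinate of \<open>u\<close> receives a nonzero
        contribution from some nonzero coordinate.\<close>
      have coord: "icoord t u = (\<Sum>s\<in>?A. icoord s u * H s t p)" if t: "t < n" for t
      proof -
        have "g p u = (\<Sum>s\<in>?A. vscale (icoord s u) (g p (iunit s)))"
          by (subst uA, rule linear_on_sum[OF homD(1)[OF g p] rep_subspace[OF X p]]) (use un in auto)
        then have "(\<Sum>s\<in>?A. icoord s u * icoord t (g p (iunit s))) = 0"
          using gu by (metis (no_types, lifting) icoord_simps(2,3) icoord_sum sum.cong)
        moreover have "icoord t u = (\<Sum>s\<in>?A. icoord s u * (if t = s then 1 else 0))"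
          by (subst uA) simp
        moreover have "(\<Sum>s\<in>?A. icoord s u * H s t p) = (\<Sum>s\<in>?A. icoord s u * (if t = s then 1 else 0))
            - (\<Sum>s\<in>?A. icoord s u * icoord t (g p (iunit s)))"
          unfolding sum_subtractf[symmetric] by (intro sum.cong) (auto simp: H_def algebra_simps)
        ultimately show ?thesis by simp
      qed
      define S where "S = {s. s < n \<and> icoord s u \<noteq> 0}"
      define R where "R = {(s, t). s \<in> S \<and> t \<in> S \<and> H s t p \<noteq> 0}"
      have Sn: "s < n" "p \<in> I s" if "s \<in> S" for s using that uz by (auto simp: S_def)
      have "S \<noteq> {}"
      proof
        assume "S = {}"
        then have "(\<Sum>s<n. vscale (icoord s u) (iunit s)) = 0" by (intro sum.neutral) (auto simp: S_def)
        then show False using expand u0 by simp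
      qed
      moreover have "\<exists>s\<in>S. (s, t) \<in> R" if t: "t \<in> S" for t
      proof (rule ccontr)
        assume "\<not> ?thesis"
        then have "(\<Sum>s\<in>?A. icoord s u * H s t p) = 0" using t by (intro sum.neutral) (auto simp: R_def S_def)
        then show False using coord[OF Sn(1)[OF t]] t by (simp add: S_def)
      qed
      ultimately obtain t s where ts: "(t, s) \<in> R" "(s, t) \<in> R\<^sup>*"
        using finite_relation_cycle[of S R] by (auto simp: R_def S_def)
      have edge: "hom_le p (I a) (I b)" if "(a, b) \<in> R" for a b
      proof -
        have ab: "a < n" "b < n" "H a b p \<noteq> 0" using that by (auto simp: R_def S_def)
        note h = interval_homD[OF H[OF ab(1,2)]]
        show ?thesis
        proof (rule hom_leI[of _ _ _ "{q. H a b q \<noteq> 0}"], rule hom_supportI)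
          fix q r assume q: "q \<in> {q. H a b q \<noteq> 0}"
          show "r \<in> {q. H a b q \<noteq> 0}" if "r \<in> I b" "q \<le> r" using h(1)[of q] h(3)[of q r] q that by (cases "q \<in> I a") auto
          show "r \<in> {q. H a b q \<noteq> 0}" if "r \<in> I a" "r \<le> q" using h(2)[of q] h(3)[of r q] q that by (cases "q \<in> I b") auto
        qed (use h(1,2) ab(3) in auto)
      qed
      have sS: "s \<in> S" "t \<in> S" using ts(1) by (auto simp: R_def)
      have "hom_le p (I s) (I t)"
        using ts(2)
      proof (induction rule: rtrancl_induct)
        case base
        show ?case by (rule hom_leI[of _ _ _ "I s"], rule hom_supportI) (use Sn(2)[OF sS(1)] in auto)
      next
        case (step a b)
        show ?case by (rule hom_le_trans[OF step.IH edge[OF step.hyps(2)]])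
      qed
      then have "I s = I t"
        using hom_le_antisym edge[OF ts(1)] is_intervalD(3)[OF int[OF Sn(1)[OF sS(1)]]] is_intervalD(3)[OF int[OF Sn(1)[OF sS(2)]]] by blast
      then have "H t s p = 0" by (rule no_iso[OF Sn(1)[OF sS(2)] Sn(1)[OF sS(1)]])
      then show False using ts(1) by (simp add: R_def)
    qed
    show ?thesis
    proof (rule bijective_hom_iso[OF X X g inj])
      show "g p ` vspace X p = vspace X p" if p: "p \<in> P" for p
        by (rule injective_endo_surj[OF _ homD(1)[OF g p] inj[OF p]]) (use X p in \<open>simp add: is_rep_def\<close>)
    qed
  qed
  show ?thesis
    unfolding is_interval_cover_def using X Xdec f lift min by blast
qed

section \<open>Surjectivity of covers and vanishing of the syzygy\<close>

lemma is_hom_comp: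
  assumes "is_hom P L M f" "is_hom P M N g"
  shows "is_hom P L N (hom_comp g f)"
  unfolding is_hom_def linear_on_def hom_comp_def
proof (intro conjI ballI allI impI)
  fix p assume p: "p \<in> P"
  note lf = linear_onD[OF homD(1)[OF assms(1) p]] and lg = linear_onD[OF homD(1)[OF assms(2) p]]
  show "(g p \<circ> f p) ` vspace L p \<subseteq> vspace N p" using lf(1) lg(1) by auto
  show "(g p \<circ> f p) (u + v) = (g p \<circ> f p) u + (g p \<circ> f p) v" if "u \<in> vspace L p" "v \<in> vspace L p" for u v
    unfolding comp_def lf(2)[OF that] by (rule lg(2)[OF lf(1)[OF that(1)] lf(1)[OF that(2)]])
  show "(g p \<circ> f p) (vscale c v) = vscale c ((g p \<circ> f p) v)" if "v \<in> vspace L p" for c v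
    using lf(1,3)[OF that] lg(3) by simp
next
  fix p q w assume pq: "p \<in> P" "q \<in> P" "p \<le> q" "w \<in> vspace L p"
  show "(g q \<circ> f q) (vmap L p q w) = vmap N p q ((g p \<circ> f p) w)"
    using homD(2)[OF assms(1) pq] homD(2)[OF assms(2) pq(1-3) homD(3)[OF assms(1) pq(1,4)]] by simp
qed

lemma isomorphic_sym: "isomorphic P M N \<Longrightarrow> isomorphic P N M"
  unfolding isomorphic_def is_iso_def by blast

lemma isomorphic_trans:
  assumes "isomorphic P L M" "isomorphic P M N"
  shows "isomorphic P L N"
proof -
  obtain f f' where f: "is_hom P L M f" "is_hom P M L f'"
    "\<And>p w. p \<in> P \<Longrightarrow> w \<in> vspace L p \<Longrightarrow> f' p (f p w) = w" "\<And>p w. p \<in> P \<Longrightarrow> w \<in> vspace M p \<Longrightarrow> f p (f' p w) = w"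
    using isomorphicE[OF assms(1)] by metis
  obtain g g' where g: "is_hom P M N g" "is_hom P N M g'"
    "\<And>p w. p \<in> P \<Longrightarrow> w \<in> vspace M p \<Longrightarrow> g' p (g p w) = w" "\<And>p w. p \<in> P \<Longrightarrow> w \<in> vspace N p \<Longrightarrow> g p (g' p w) = w"
    using isomorphicE[OF assms(2)] by metis
  show ?thesis
    unfolding isomorphic_def is_iso_def
    using is_hom_comp[OF f(1) g(1)] is_hom_comp[OF g(2) f(2)] f(3,4) g(3,4) homD(3)[OF f(1)] homD(3)[OF g(2)]
    by (intro exI[of _ "hom_comp g f"] conjI exI[of _ "hom_comp f' g'"]) (auto simp: hom_eq_def hom_comp_def hom_id_def)
qed

text \<open>For the principal up-set \<open>J\<close> of \<open>a\<close>, a morphism from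
  \<open>k_J\<close> to \<open>M\<close> amounts to the choice of a vector at \<open>a\<close>.
  Lifting the morphism chosen by \<open>w\<close> through the cover gives a preimage of
  \<open>w\<close>.\<close>

lemma interval_cover_surj:
  fixes M :: "('a::order, 'k::field) rep"
  assumes M: "is_rep P M" and cov: "is_interval_cover P M X f" and a: "a \<in> P"
  shows "f a ` vspace X a = vspace M a"
proof
  have f: "is_hom P X M f" and lift: "\<And>Y h. is_rep P Y \<Longrightarrow> interval_decomposable P Y \<Longrightarrow> is_hom P Y M h \<Longrightarrow>
      \<exists>g. is_hom P Y X g \<and> hom_eq P Y (hom_comp f g) h"
    using cov unfolding is_interval_cover_def by blast+
  show "f a ` vspace X a \<subseteq> vspace M a" using homD(3)[OF f a] by blast
  show "vspace M a \<subseteq> f a ` vspace X a"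
  proof
    fix w assume w: "w \<in> vspace M a"
    define J where "J = {q\<in>P. a \<le> q}"
    have aJ: "a \<in> J" using a by (simp add: J_def)
    have J: "is_interval P J"
    proof (rule is_intervalI)
      show "connected_poset J"
        unfolding connected_poset_def
      proof (intro ballI)
        fix p q assume "p \<in> J" "q \<in> J"
        then have "(p, a) \<in> {(u, v). u \<in> J \<and> v \<in> J \<and> (u \<le> v \<or> v \<le> u)}" "(a, q) \<in> {(u, v). u \<in> J \<and> v \<in> J \<and> (u \<le> v \<or> v \<le> u)}"
          using a by (auto simp: J_def)
        then show "(p, q) \<in> {(u, v). u \<in> J \<and> v \<in> J \<and> (u \<le> v \<or> v \<le> u)}\<^sup>*" by (meson r_into_rtrancl rtrancl_trans)
      qed
      fix x y z assume "x \<in> J" "y \<in> J" "z \<in> P" "x < z" "z < y"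
      then show "z \<in> J" using order_trans[OF _ less_imp_le, of a x z] by (simp add: J_def)
    qed (use a in \<open>auto simp: J_def\<close>)
    define v where "v q = (if q \<in> J then vmap M a q w else 0)" for q
    have v: "sect P M J v"
      unfolding sect_def
    proof (intro conjI ballI allI impI)
      show "v p \<in> vspace M p" if "p \<in> P" for p
        using rep_in[OF M a that _ w] vec.subspace_0[OF rep_subspace[OF M that]] by (simp add: v_def J_def)
      fix p q assume pq: "p \<in> J" "q \<in> P" "p \<le> q"
      then have "q \<in> J" using order_trans[of a p q] by (simp add: J_def)
      then show "vmap M p q (v p) = v q"
        using rep_comp[OF M a _ pq(2) _ pq(3) w, of] pq(1) by (simp add: v_def J_def)
    qed (simp add: v_def)
    let ?Y = "interval_sum [J] :: ('a, 'k) rep"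
    have Y: "is_rep P ?Y" by (rule is_rep_interval_sum) (simp add: J)
    have "interval_decomposable P ?Y" by (rule interval_sum_decomposable) (simp add: J)
    moreover have h: "is_hom P ?Y M (\<lambda>p u. \<Sum>t<length [J]. vscale (icoord t u) (v p))"
      by (rule sections_hom[OF M]) (use v in simp)
    ultimately obtain g where g: "is_hom P ?Y X g" "hom_eq P ?Y (hom_comp f g) (\<lambda>p u. \<Sum>t<length [J]. vscale (icoord t u) (v p))"
      using lift[OF Y _ h] by blast
    have e: "iunit 0 \<in> vspace ?Y a" by (rule iunit_in) (use aJ in simp_all)
    have "f a (g a (iunit 0)) = v a" using g(2) a e by (simp add: hom_eq_def hom_comp_def)
    also have "v a = w" using aJ rep_id[OF M a w] by (simp add: v_def)
    finally show "w \<in> f a ` vspace X a" using homD(3)[OF g(1) a e] by (metis imageI)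
  qed
qed

text \<open>The arbitrary choice in \<open>Omega\<close> is a cover because one exists.\<close>

lemma Omega_kernel:
  fixes M :: "('a::order, 'k::field) rep"
  assumes "finite P" "is_rep P M"
  obtains X f where "is_interval_cover P M X f" "Omega P M = kernel_rep X f"
proof -
  have "\<exists>c. case c of (X, f) \<Rightarrow> is_interval_cover P M X f" using interval_cover_exists[OF assms] by auto
  then have "case (SOME (X, f). is_interval_cover P M X f) of (X, f) \<Rightarrow> is_interval_cover P M X f" by (rule someI_ex)
  then show thesis using that unfolding Omega_def by (auto split: prod.splits)
qed

text \<open>If the kernel vanishes, the surjective cover is an isomorphism. Conversely, the identity
  of a decomposable \<open>M\<close> lifts to a right inverse \<open>s\<close> of the cover
  \<open>f\<close>, and \<open>f s f = f\<close> forces \<open>s f\<close> to be invertible, so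
  \<open>f\<close> is injective.\<close>

lemma Omega_zero_iff:
  fixes M :: "('a::order, 'k::field) rep"
  assumes fin: "finite P" and M: "is_rep P M"
  shows "is_zero_rep P (Omega P M) \<longleftrightarrow> interval_decomposable P M"
proof -
  obtain X f where cov: "is_interval_cover P M X f" and Om: "Omega P M = kernel_rep X f"
    by (rule Omega_kernel[OF fin M])
  have X: "is_rep P X" "interval_decomposable P X" and f: "is_hom P X M f"
    and lift: "\<And>Y h. is_rep P Y \<Longrightarrow> interval_decomposable P Y \<Longrightarrow> is_hom P Y M h \<Longrightarrow>
      \<exists>g. is_hom P Y X g \<and> hom_eq P Y (hom_comp f g) h"
    and min: "\<And>g. is_hom P X X g \<Longrightarrow> hom_eq P X (hom_comp f g) f \<Longrightarrow> is_iso P X X g"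
    using cov unfolding is_interval_cover_def by blast+
  have zero_iff: "is_zero_rep P (Omega P M) \<longleftrightarrow> (\<forall>p\<in>P. \<forall>u\<in>vspace X p. f p u = 0 \<longrightarrow> u = 0)"
    unfolding Om is_zero_rep_def kernel_rep_def rep.simps
    using vec.subspace_0[OF rep_subspace[OF X(1)]] linear_on_0[OF homD(1)[OF f] rep_subspace[OF X(1)]] by blast
  show ?thesis
  proof
    assume "is_zero_rep P (Omega P M)"
    then have "is_iso P X M f"
      using zero_iff interval_cover_surj[OF M cov] by (intro bijective_hom_iso[OF X(1) M f]) auto
    then have "isomorphic P M X" using isomorphic_sym unfolding isomorphic_def by blast
    then show "interval_decomposable P M"
      using X(2) isomorphic_trans unfolding interval_decomposable_def by blast
  next
    assume dec: "interval_decomposable P M"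
    have "is_hom P M M hom_id" by (auto simp: is_hom_def linear_on_def hom_id_def)
    then obtain s where s: "is_hom P M X s" "hom_eq P M (hom_comp f s) hom_id" using lift[OF M dec] by blast
    have "is_iso P X X (hom_comp s f)"
    proof (rule min[OF is_hom_comp[OF f s(1)]])
      show "hom_eq P X (hom_comp f (hom_comp s f)) f"
        using s(2) homD(3)[OF f] by (simp add: hom_eq_def hom_comp_def hom_id_def)
    qed
    then obtain g where g: "is_hom P X X g" "hom_eq P X (hom_comp g (hom_comp s f)) hom_id"
      unfolding is_iso_def by blast
    have "u = 0" if p: "p \<in> P" and u: "u \<in> vspace X p" "f p u = 0" for p u
    proof -
      have "s p 0 = 0" using linear_on_0[OF homD(1)[OF s(1) p] rep_subspace[OF M p]] .
      moreover have "g p 0 = 0" using linear_on_0[OF homD(1)[OF g(1) p] rep_subspace[OF X(1) p]] .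
      moreover have "g p (s p (f p u)) = u" using g(2) p u(1) by (simp add: hom_eq_def hom_comp_def hom_id_def)
      ultimately show ?thesis using u(2) by simp
    qed
    then show "is_zero_rep P (Omega P M)" using zero_iff by blast
  qed
qed

text \<open>The infimum of a nonempty set in \<open>enat\<close> is attained, and the set is
  nonempty because otherwise its infimum would be infinite.\<close>

lemma interval_resdim_0_iff: "interval_resdim P M = 0 \<longleftrightarrow> is_zero_rep P (Omega P M)"
proof
  assume 0: "interval_resdim P M = 0"
  let ?A = "{enat m | m. is_zero_rep P ((Omega P ^^ (m + 1)) M)}"
  have "?A \<noteq> {}" using 0 unfolding interval_resdim_def by (auto simp: Inf_enat_def split: if_splits)
  then have "Inf ?A \<in> ?A" unfolding Inf_enat_def using LeastI_ex[of "\<lambda>x. x \<in> ?A"] by auto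
  then have "enat 0 \<in> ?A" using 0 unfolding interval_resdim_def by (simp add: zero_enat_def)
  then show "is_zero_rep P (Omega P M)" by simp
next
  assume "is_zero_rep P (Omega P M)"
  then have "enat 0 \<in> {enat m | m. is_zero_rep P ((Omega P ^^ (m + 1)) M)}" by simp
  then have "interval_resdim P M \<le> enat 0" unfolding interval_resdim_def by (rule Inf_lower)
  then show "interval_resdim P M = 0" unfolding zero_enat_def[symmetric] by simp
qed

text \<open>As 0 is the bottom of \<open>enat\<close>, a supremum is 0 only if every member
  is.\<close>

lemma interval_resgldim_0_iff:
  "interval_resgldim TYPE('k::field) P = 0 \<longleftrightarrow>
     (\<forall>M :: ('a::order, 'k) rep. is_rep P M \<longrightarrow> is_zero_rep P (Omega P M))"
  unfolding interval_resgldim_def interval_resdim_0_iff[symmetric] bot_enat_def[symmetric] SUP_bot_conv by auto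

lemma interval_decomposable_iff_poset:
  "(\<forall>M :: ('a::order, 'k::field) rep. is_rep P M \<longrightarrow> interval_decomposable P M) \<longleftrightarrow> decomposable_poset TYPE('k) P"
  unfolding decomposable_poset_def
  using interval_decomposable_imp_decomp decomp_imp_interval_decomposable by blast

theorem theorem1p3:
  fixes P :: "'a::order set"
  assumes "finite P"
  shows "(interval_resgldim TYPE('k::field) P = 0 \<longleftrightarrow>
           (\<forall>M :: ('a, 'k) rep. is_rep P M \<longrightarrow> interval_decomposable P M))
       \<and> (interval_resgldim TYPE('k) P = 0 \<longleftrightarrow>
           (\<forall>Q \<in> quiver_components (hasse P).
             (\<exists>n a. quiver_iso Q (A_quiver n a)) \<or>
             (\<exists>m l. 0 < m \<and> 0 < l \<and> quiver_iso Q (hasse (C_poset m l)))))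
       \<and> (interval_resgldim TYPE('k) P = 0 \<longleftrightarrow> interval_resgldim TYPE('l::field) P = 0)"
proof -
  have k: "interval_resgldim TYPE('k) P = 0 \<longleftrightarrow> (\<forall>M :: ('a, 'k) rep. is_rep P M \<longrightarrow> interval_decomposable P M)"
    unfolding interval_resgldim_0_iff using Omega_zero_iff[OF assms] by blast
  have l: "interval_resgldim TYPE('l) P = 0 \<longleftrightarrow> (\<forall>M :: ('a, 'l) rep. is_rep P M \<longrightarrow> interval_decomposable P M)"
    unfolding interval_resgldim_0_iff using Omega_zero_iff[OF assms] by blast
  \<comment> \<open>The condition on the diagrams does not mention the field; comparing it for
    \<open>'k\<close> and \<open>'l\<close> yields the independence of the field.\<close>
  show ?thesis
    using k l unfolding interval_decomposable_iff_poset decomposable_iff_good_diagrams[OF assms] good_diagram_def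
    by simp
qed

end
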